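(* Let $k$ be a field of characteristic zero, let $n, m$ be positive integers, and let $\lambda = (\lambda_1,\ldots,\lambda_n)\in\mathbb{Z}_{\geqslant 0}^n$ satisfy $\lambda_1+\ldots+\lambda_n = m+1$. Let $R = k[x_i^{(j)} \mid 1\leqslant i\leqslant n,\ 0\leqslant j\leqslant m]$, let $J_m(x_1\cdots x_n)\subset R$ be the $m$-th jet ideal of the ideal $(x_1\cdots x_n)\subset k[x_1,\ldots,x_n]$, let $\mathfrak{p}_\lambda\subset R$ be the prime ideal generated by all $x_i^{(j)}$ with $1\leqslant i\leqslant n$ and $0\leqslant j<\lambda_i$, and let $K_\lambda$ be the subfield $k\left(x_i^{(j)}\mid 1\leqslant i\leqslant n,\ \lambda_i\leqslant j\leqslant m\right)$ of the field of fractions of $R$. Then there is an isomorphism of $K_\lambda$-algebras $$\left(R/J_m(x_1\cdots x_n)\right)_{\mathfrak{p}_\lambda}\cong A_\lambda(K_\lambda).$$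
   Context: Jet ideal: $J_m(x_1\cdots x_n)$ is the ideal of the polynomial ring $R=k[x_i^{(j)}\mid 1\leqslant i\leqslant n,\ 0\leqslant j\leqslant m]$ (the $x_i^{(j)}$ are independent variables) generated by the coefficients of $1,t,\ldots,t^m$ in the product $\prod_{i=1}^n\left(x_i^{(0)}+x_i^{(1)}t+\ldots+x_i^{(m)}t^m\right)$ taken modulo $t^{m+1}$. The elements $x_i^{(j)}$ with $j\geqslant\lambda_i$ are algebraically independent modulo $\mathfrak{p}_\lambda$, so the localization at $\mathfrak{p}_\lambda$ is naturally a $K_\lambda$-algebra. The algebra $A_\lambda(F)$: let $F$ be a field of characteristic zero, $\lambda=(\lambda_1,\ldots,\lambda_n)\in\mathbb{Z}_{\geqslant 0}^n$ and $\ell=\lambda_1+\ldots+\lambda_n\geqslant 1$. Put $\Lambda_1=0$ and $\Lambda_i=\lambda_1+\ldots+\lambda_{i-1}$ for $1\leqslant i\leqslant n+1$. A polynomial in $F[z_1,\ldots,z_\ell]$ is called $\lambda$-symmetric if for every $1\leqslant i\leqslant n$ it is symmetric in the variables $z_{\Lambda_i+1},\ldots,z_{\Lambda_{i+1}}$. Let $I_S\subset F[z_1,\ldots,z_\ell]$ be the ideal generated by all symmetric polynomials in $z_1,\ldots,z_\ell$ with zero constant term. Then $A_\lambda(F)$ is the subalgebra of $F[z_1,\ldots,z_\ell]/I_S$ consisting of the images of all $\lambda$-symmetric polynomials. *)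

theory Defs
  imports
    "HOL-Algebra.Algebraic_Closure_Type"
    "HOL-Algebra.Generated_Fields"
    "HOL-Algebra.Module"
    "HOL-Algebra.QuotRing"
    "HOL-Combinatorics.Permutations"
    "HOL-Computational_Algebra.Fraction_Field"
    "HOL-Computational_Algebra.Polynomial"
    "HOL-Library.Poly_Mapping"
    "HOL-Library.Product_Lexorder"
begin

text \<open>
  Subrings of a type-class ring are handled as HOL-Algebra records obtained from
  \<^const>\<open>ring_of_type_algebra\<close> by restricting the carrier.
\<close>

section \<open>Multivariate polynomials\<close>

text \<open>Finitely supported maps from exponent vectors to coefficients.\<close>

type_synonym ('v, 'a) mpoly = "('v \<Rightarrow>\<^sub>0 nat) \<Rightarrow>\<^sub>0 'a"

definition mconst :: "'a::zero \<Rightarrow> ('v, 'a) mpoly" where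
  "mconst c = Poly_Mapping.single 0 c"

definition mvar :: "'v \<Rightarrow> ('v, 'a::zero_neq_one) mpoly" where
  "mvar v = Poly_Mapping.single (Poly_Mapping.single v 1) 1"

definition mpoly_over :: "'a::zero set \<Rightarrow> 'v set \<Rightarrow> ('v, 'a) mpoly set" where
  "mpoly_over K V =
     {p. (\<forall>e. Poly_Mapping.lookup p e \<in> K) \<and>
         (\<forall>e \<in> Poly_Mapping.keys p. Poly_Mapping.keys e \<subseteq> V)}"

text \<open>The polynomial ring $K[V]$, for a subring $K$ of the coefficient type.\<close>

definition mpoly_ring :: "'a::comm_ring_1 set \<Rightarrow> 'v set \<Rightarrow> ('v, 'a) mpoly ring" where
  "mpoly_ring K V = ring_of_type_algebra\<lparr>carrier := mpoly_over K V\<rparr>"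

text \<open>
  For a permutation \<open>\<sigma>\<close>, \<open>map_key \<sigma>\<close> sends an exponent vector \<open>e\<close> to \<open>e \<circ> \<sigma>\<close>; applying
  \<open>map_key\<close> to this map permutes the variables of a polynomial.
\<close>

definition symmetric_in :: "'v set \<Rightarrow> ('v, 'a::zero) mpoly \<Rightarrow> bool" where
  "symmetric_in B p \<longleftrightarrow>
     (\<forall>\<sigma>. \<sigma> permutes B \<longrightarrow> Poly_Mapping.map_key (Poly_Mapping.map_key \<sigma>) p = p)"

section \<open>Localization\<close>

definition loc_rel :: "('a, 'm) ring_scheme \<Rightarrow> 'a set \<Rightarrow> (('a \<times> 'a) \<times> ('a \<times> 'a)) set" where
  "loc_rel Q S =
     {((a, s), (b, t)). a \<in> carrier Q \<and> b \<in> carrier Q \<and> s \<in> S \<and> t \<in> S \<and>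
        (\<exists>u \<in> S. u \<otimes>\<^bsub>Q\<^esub> (a \<otimes>\<^bsub>Q\<^esub> t) = u \<otimes>\<^bsub>Q\<^esub> (b \<otimes>\<^bsub>Q\<^esub> s))}"

definition loc_frac ::
    "('a, 'm) ring_scheme \<Rightarrow> 'a set \<Rightarrow> 'a \<Rightarrow> 'a \<Rightarrow> ('a \<times> 'a) set" where
  "loc_frac Q S a s = loc_rel Q S `` {(a, s)}"

text \<open>
  $S^{-1}Q$ for a multiplicative subset $S$ of a commutative ring $Q$. Sums and products of
  classes are unions over representatives, all members of the union being equal.
\<close>

definition localization ::
    "('a, 'm) ring_scheme \<Rightarrow> 'a set \<Rightarrow> ('a \<times> 'a) set ring" where
  "localization Q S =
     \<lparr>carrier = (carrier Q \<times> S) // loc_rel Q S,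
      monoid.mult = (\<lambda>C D. \<Union>x \<in> C. \<Union>y \<in> D.
               loc_frac Q S (fst x \<otimes>\<^bsub>Q\<^esub> fst y) (snd x \<otimes>\<^bsub>Q\<^esub> snd y)),
      one = loc_frac Q S \<one>\<^bsub>Q\<^esub> \<one>\<^bsub>Q\<^esub>,
      ring.zero = loc_frac Q S \<zero>\<^bsub>Q\<^esub> \<one>\<^bsub>Q\<^esub>,
      add = (\<lambda>C D. \<Union>x \<in> C. \<Union>y \<in> D.
               loc_frac Q S (fst x \<otimes>\<^bsub>Q\<^esub> snd y \<oplus>\<^bsub>Q\<^esub> fst y \<otimes>\<^bsub>Q\<^esub> snd x) (snd x \<otimes>\<^bsub>Q\<^esub> snd y))\<rparr>"

section \<open>Algebras over a ring\<close>

text \<open>The ring \<open>A\<close> as an algebra via a structure map \<open>h\<close> into it.\<close>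

definition algebra_via :: "'b ring \<Rightarrow> ('c \<Rightarrow> 'b) \<Rightarrow> ('c, 'b) module" where
  "algebra_via A h =
     \<lparr>carrier = carrier A, monoid.mult = monoid.mult A, one = one A,
      ring.zero = ring.zero A, add = add A,
      module.smult = (\<lambda>c x. h c \<otimes>\<^bsub>A\<^esub> x)\<rparr>"

definition algebra_isomorphic ::
    "('c, 'm) ring_scheme \<Rightarrow> ('c, 'a) module \<Rightarrow> ('c, 'b) module \<Rightarrow> bool" where
  "algebra_isomorphic K A B \<longleftrightarrow>
     algebra K A \<and> algebra K B \<and>
     (\<exists>\<phi> \<in> ring_iso A B.
        \<forall>c \<in> carrier K. \<forall>x \<in> carrier A. \<phi> (c \<odot>\<^bsub>A\<^esub> x) = c \<odot>\<^bsub>B\<^esub> \<phi> x)"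

section \<open>The algebra $A_\lambda(F)$\<close>

text \<open>$F$ is a subfield of the type \<open>'f\<close>; the variable $z_a$ is \<open>mvar a\<close>, $1 \le a \le \ell$.\<close>

definition Lam :: "(nat \<Rightarrow> nat) \<Rightarrow> nat \<Rightarrow> nat" where
  "Lam lam i = (\<Sum>j \<in> {1..<i}. lam j)"

definition lam_symmetric :: "nat \<Rightarrow> (nat \<Rightarrow> nat) \<Rightarrow> (nat, 'f::zero) mpoly \<Rightarrow> bool" where
  "lam_symmetric n lam p \<longleftrightarrow>
     (\<forall>i \<in> {1..n}. symmetric_in {Lam lam i + 1..Lam lam (i + 1)} p)"

definition z_ring :: "'f::field set \<Rightarrow> nat \<Rightarrow> (nat, 'f) mpoly ring" where
  "z_ring F l = mpoly_ring F {1..l}"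

definition sym_ideal :: "'f::field set \<Rightarrow> nat \<Rightarrow> (nat, 'f) mpoly set" where
  "sym_ideal F l =
     genideal (z_ring F l)
       {p \<in> carrier (z_ring F l). symmetric_in {1..l} p \<and> Poly_Mapping.lookup p 0 = 0}"

definition A_lam ::
    "'f::field set \<Rightarrow> nat \<Rightarrow> (nat \<Rightarrow> nat) \<Rightarrow> ('f, (nat, 'f) mpoly set) module" where
  "A_lam F n lam =
     (let l = (\<Sum>i \<in> {1..n}. lam i); P = z_ring F l; I = sym_ideal F l
      in algebra_via
           ((P Quot I)
              \<lparr>carrier := (\<lambda>p. I +>\<^bsub>P\<^esub> p) ` {p \<in> carrier P. lam_symmetric n lam p}\<rparr>)
           (\<lambda>c. I +>\<^bsub>P\<^esub> mconst c))"

section \<open>Jets of $x_1 \cdots x_n$\<close>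

text \<open>The variable $x_i^{(j)}$ is \<open>mvar (i, j)\<close>, with $1 \le i \le n$ and $0 \le j \le m$.\<close>

type_synonym 'k jet_poly = "(nat \<times> nat, 'k) mpoly"

definition jet_ring :: "nat \<Rightarrow> nat \<Rightarrow> 'k::field jet_poly ring" where
  "jet_ring n m = mpoly_ring UNIV ({1..n} \<times> {0..m})"

definition jet_product :: "nat \<Rightarrow> nat \<Rightarrow> 'k::field jet_poly poly" where
  "jet_product n m = (\<Prod>i \<in> {1..n}. \<Sum>j \<in> {0..m}. Polynomial.monom (mvar (i, j)) j)"

definition jet_ideal :: "nat \<Rightarrow> nat \<Rightarrow> 'k::field jet_poly set" where
  "jet_ideal n m =
     genideal (jet_ring n m) {Polynomial.coeff (jet_product n m) s | s. s \<le> m}"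

definition p_lam :: "nat \<Rightarrow> nat \<Rightarrow> (nat \<Rightarrow> nat) \<Rightarrow> 'k::field jet_poly set" where
  "p_lam n m lam = genideal (jet_ring n m) {mvar (i, j) | i j. i \<in> {1..n} \<and> j < lam i}"

definition free_vars :: "nat \<Rightarrow> nat \<Rightarrow> (nat \<Rightarrow> nat) \<Rightarrow> (nat \<times> nat) set" where
  "free_vars n m lam = {(i, j). i \<in> {1..n} \<and> lam i \<le> j \<and> j \<le> m}"

text \<open>
  The field \<open>'k jet_poly fract\<close> also has fractions in variables outside $R$; it contains the
  fraction field of $R$, and the subfield generated below lies in the latter.
\<close>

definition K_lam :: "nat \<Rightarrow> nat \<Rightarrow> (nat \<Rightarrow> nat) \<Rightarrow> 'k::field jet_poly fract set" where
  "K_lam n m lam =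
     generate_field ring_of_type_algebra
       (range (\<lambda>c. Fract (mconst c) 1) \<union> (\<lambda>v. Fract (mvar v) 1) ` free_vars n m lam)"

definition K_lam_ring ::
    "nat \<Rightarrow> nat \<Rightarrow> (nat \<Rightarrow> nat) \<Rightarrow> 'k::field jet_poly fract ring" where
  "K_lam_ring n m lam = ring_of_type_algebra\<lparr>carrier := K_lam n m lam\<rparr>"

text \<open>
  The localization of $R/J$ at $\mathfrak{p}_\lambda$ inverts the image of
  $R \setminus \mathfrak{p}_\lambda$. Its structure map sends $f/g \in K_\lambda$, with $f, g$
  polynomials in the $x_i^{(j)}$, $j \ge \lambda_i$, and $g \ne 0$ (whence
  $g \notin \mathfrak{p}_\lambda$), to the fraction of the images of $f$ and $g$ in $R/J$.
\<close>

definition jet_quot :: "nat \<Rightarrow> nat \<Rightarrow> 'k::field jet_poly set ring" where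
  "jet_quot n m = jet_ring n m Quot jet_ideal n m"

definition jet_class :: "nat \<Rightarrow> nat \<Rightarrow> 'k::field jet_poly \<Rightarrow> 'k jet_poly set" where
  "jet_class n m f = jet_ideal n m +>\<^bsub>jet_ring n m\<^esub> f"

definition jet_denoms :: "nat \<Rightarrow> nat \<Rightarrow> (nat \<Rightarrow> nat) \<Rightarrow> 'k::field jet_poly set set" where
  "jet_denoms n m lam = jet_class n m ` (carrier (jet_ring n m) - p_lam n m lam)"

definition jet_loc_map ::
    "nat \<Rightarrow> nat \<Rightarrow> (nat \<Rightarrow> nat) \<Rightarrow> 'k::field jet_poly fract
       \<Rightarrow> ('k jet_poly set \<times> 'k jet_poly set) set" where
  "jet_loc_map n m lam c =
     (THE y. \<exists>f g. f \<in> mpoly_over UNIV (free_vars n m lam) \<and>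
                   g \<in> mpoly_over UNIV (free_vars n m lam) \<and> g \<noteq> 0 \<and> c = Fract f g \<and>
                   y = loc_frac (jet_quot n m) (jet_denoms n m lam)
                         (jet_class n m f) (jet_class n m g))"

definition jet_local_algebra ::
    "nat \<Rightarrow> nat \<Rightarrow> (nat \<Rightarrow> nat)
       \<Rightarrow> ('k::field jet_poly fract, ('k jet_poly set \<times> 'k jet_poly set) set) module" where
  "jet_local_algebra n m lam =
     algebra_via (localization (jet_quot n m) (jet_denoms n m lam)) (jet_loc_map n m lam)"

end

(* The isomorphism comes from Weierstrass factorization.  Over the localization at p_lambda, each jet
   x_i(t) is a unit times a monic polynomial W_i(t) of degree lambda_i with nilpotent lower
   coefficients (nilpotency is Armendariz' argument applied to the radical of the jet ideal), so the
   vanishing of the product modulo t^(m+1) says that W_1 ... W_n = t^(m+1).  On the other side, by the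
   fundamental theorem on symmetric polynomials, applied block by block, and averaging over the block
   permutations, A_lambda(K) is the quotient of the polynomial ring K[a_ik] in the coefficients of
   generic monic polynomials G_1, ..., G_n of degrees lambda_i by the lower coefficients of the
   product G_1 ... G_n.

   Concretely, divide the part of x_i(t) of order at least lambda_i by G_i, with remainder r_i: the
   substitution of -r_i for the part of order less than lambda_i makes x_i(t) divisible by G_i.  This
   defines phi from the jet ring to K[a_ik].  Sending a_ik to the coefficients of W_i is a left
   inverse, whence injectivity; surjectivity holds because the linear parts of the coefficients of
   r_i are triangular in the a_ik and the maximal ideal of A_lambda(K) is nilpotent. *)

theory Submission
  imports Defs
begin

section \<open>Subrings, ideals and ring homomorphisms inside a type\<close>

text \<open>Linearity over \<open>K_lam\<close> fixes the images of all \<open>x_i^(j)\<close> with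
  j at least \<open>lam i\<close>; only the low part of each jet is then free, and divisibility by
  \<open>G_i\<close> determines it. This is why a remainder appears in \<open>phi\<close>. The
  localized jet ring is not complete, so a Weierstrass factorization can only be approximated along
  powers of the maximal ideal. It becomes exact modulo the jet ideal because the low variables are
  nilpotent there: in the product of the \<open>x_k^(lam k)\<close> the indices add up to m+1, so
  lowering a single index gives a total of at most m, while all other factors are units.
  Surjectivity follows the same pattern: approximate up to an order at which the error dies.
  Characteristic zero enters when coefficients are averaged over block permutations, which divides
  by the factorials of the block sizes. The localized jet ring is studied inside the field of
  fractions, with congruences modulo an ideal in place of quotients; only the last part passes to
  the actual quotient and localization.\<close>

locale ring_map =
  fixes h :: "'a::comm_ring_1 \<Rightarrow> 'b::comm_ring_1"
  assumes map_one: "h 1 = 1"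
    and map_add: "h (x + y) = h x + h y"
    and map_mult: "h (x * y) = h x * h y"
begin

lemma map_zero: "h 0 = 0"
  using map_add[of 0 0] by simp

lemma map_uminus: "h (- x) = - h x"
  using map_add[of x "- x"] map_zero by (simp add: eq_neg_iff_add_eq_0 add.commute)

lemma map_minus: "h (x - y) = h x - h y"
  using map_add[of x "- y"] map_uminus[of y] by simp

lemma map_power: "h (x ^ n) = h x ^ n"
  by (induction n) (simp_all add: map_one map_mult)

lemma map_sum: "h (sum f A) = (\<Sum>x\<in>A. h (f x))"
  by (induction A rule: infinite_finite_induct) (simp_all add: map_zero map_add)

lemma map_prod: "h (prod f A) = (\<Prod>x\<in>A. h (f x))"
  by (induction A rule: infinite_finite_induct) (simp_all add: map_one map_mult)

lemma coeff_map [simp]: "coeff (map_poly h p) i = h (coeff p i)"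
  by (simp add: coeff_map_poly map_zero)

lemma ring_map_map_poly: "ring_map (map_poly h)"
proof
  show "map_poly h 1 = 1"
    by (rule poly_eqI) (simp add: coeff_1 map_one map_zero)
  show "map_poly h (p + q) = map_poly h p + map_poly h q" for p q
    by (rule poly_eqI) (simp add: map_add)
  show "map_poly h (p * q) = map_poly h p * map_poly h q" for p q
    by (rule poly_eqI) (simp add: coeff_mult map_sum map_mult)
qed

end

lemma ring_map_comp: "ring_map g \<Longrightarrow> ring_map h \<Longrightarrow> ring_map (g \<circ> h)"
  by (simp add: ring_map_def)

text \<open>Subrings are sets inside a fixed type, because the rings concerned depend on
  \<open>n\<close>, \<open>m\<close> and \<open>lam\<close> and so cannot be types
  themselves.\<close>

locale usubring =
  fixes D :: "'a::comm_ring_1 set"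
  assumes one_in: "1 \<in> D"
    and diff_in: "x \<in> D \<Longrightarrow> y \<in> D \<Longrightarrow> x - y \<in> D"
    and mult_in: "x \<in> D \<Longrightarrow> y \<in> D \<Longrightarrow> x * y \<in> D"
begin

lemma zero_in: "0 \<in> D"
  using diff_in[OF one_in one_in] by simp

lemma uminus_in: "x \<in> D \<Longrightarrow> - x \<in> D"
  using diff_in[OF zero_in] by simp

lemma add_in: "x \<in> D \<Longrightarrow> y \<in> D \<Longrightarrow> x + y \<in> D"
  using diff_in[of x "- y"] uminus_in by simp

lemma sum_in: "(\<And>x. x \<in> A \<Longrightarrow> f x \<in> D) \<Longrightarrow> sum f A \<in> D"
  by (induction A rule: infinite_finite_induct) (simp_all add: zero_in add_in)

lemma prod_in: "(\<And>x. x \<in> A \<Longrightarrow> f x \<in> D) \<Longrightarrow> prod f A \<in> D"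
  by (induction A rule: infinite_finite_induct) (simp_all add: one_in mult_in)

lemma power_in: "x \<in> D \<Longrightarrow> x ^ n \<in> D"
  by (induction n) (simp_all add: one_in mult_in)

lemmas closed = zero_in one_in uminus_in add_in diff_in mult_in sum_in prod_in power_in

end

lemma (in ring_map) usubring_vimage:
  assumes "usubring D"
  shows "usubring {x. h x \<in> D}"
proof -
  interpret usubring D by fact
  show ?thesis by standard (auto simp: map_one map_minus map_mult intro: closed)
qed

lemma (in ring_map) usubring_image:
  assumes "usubring D"
  shows "usubring (h ` D)"
proof -
  interpret usubring D by fact
  show ?thesis
  proof
    show "1 \<in> h ` D" using imageI[OF one_in, of h] by (simp add: map_one)
    fix x y assume "x \<in> h ` D" "y \<in> h ` D"
    then obtain a b where ab: "a \<in> D" "b \<in> D" "x = h a" "y = h b" by auto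
    show "x - y \<in> h ` D" using imageI[OF diff_in[OF ab(1,2)], of h] ab by (simp add: map_minus)
    show "x * y \<in> h ` D" using imageI[OF mult_in[OF ab(1,2)], of h] ab by (simp add: map_mult)
  qed
qed

locale uideal = usubring +
  fixes I
  assumes ideal_sub: "x \<in> I \<Longrightarrow> x \<in> D"
    and ideal_zero: "0 \<in> I"
    and ideal_add: "x \<in> I \<Longrightarrow> y \<in> I \<Longrightarrow> x + y \<in> I"
    and ideal_mult: "x \<in> D \<Longrightarrow> y \<in> I \<Longrightarrow> x * y \<in> I"
begin

lemma ideal_mult_right: "y \<in> I \<Longrightarrow> x \<in> D \<Longrightarrow> y * x \<in> I"
  using ideal_mult[of x y] by (simp add: mult.commute)

lemma ideal_uminus: "x \<in> I \<Longrightarrow> - x \<in> I"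
  using ideal_mult[of "-1" x] uminus_in[OF one_in] by simp

lemma ideal_diff: "x \<in> I \<Longrightarrow> y \<in> I \<Longrightarrow> x - y \<in> I"
  using ideal_add[of x "- y"] ideal_uminus by simp

lemma ideal_sum: "(\<And>x. x \<in> A \<Longrightarrow> f x \<in> I) \<Longrightarrow> sum f A \<in> I"
  by (induction A rule: infinite_finite_induct) (simp_all add: ideal_zero ideal_add)

lemma ideal_power_le: "x \<in> D \<Longrightarrow> x ^ M \<in> I \<Longrightarrow> M \<le> N \<Longrightarrow> x ^ N \<in> I"
  using ideal_mult_right[of "x ^ M" "x ^ (N - M)"] power_in[of x "N - M"]
  by (simp flip: power_add)

lemma ideal_prod:
  assumes "finite A" "a \<in> A" "f a \<in> I" "\<And>x. x \<in> A \<Longrightarrow> f x \<in> D"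
  shows "prod f A \<in> I"
  using assms by (auto simp: prod.remove[of A a] intro: ideal_mult_right prod_in)

lemma ideal_cong: "x \<in> I \<Longrightarrow> x - y \<in> I \<Longrightarrow> y \<in> I"
  using ideal_diff[of x "x - y"] by simp

lemma ideal_cong': "y \<in> I \<Longrightarrow> x - y \<in> I \<Longrightarrow> x \<in> I"
  using ideal_add[of y "x - y"] by simp

text \<open>This set is \<open>B + I\<close>. That it is a subring allows a claim "every element is
  congruent to one of \<open>B\<close>" to be checked on generators only.\<close>

lemma congruent_subring: "usubring {x \<in> D. \<exists>y\<in>B. x - y \<in> I}" if "usubring B" "B \<subseteq> D"
proof -
  interpret B: usubring B by fact
  show ?thesis
  proof
    show "1 \<in> {x \<in> D. \<exists>y\<in>B. x - y \<in> I}"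
      using one_in B.one_in ideal_zero by (auto intro!: bexI[of _ 1])
  next
    fix x y assume "x \<in> {x \<in> D. \<exists>y\<in>B. x - y \<in> I}" "y \<in> {x \<in> D. \<exists>y\<in>B. x - y \<in> I}"
    then obtain x' y' where *: "x \<in> D" "y \<in> D" "x' \<in> B" "y' \<in> B" "x - x' \<in> I" "y - y' \<in> I"
      by auto
    have "(x - y) - (x' - y') = (x - x') - (y - y')" by simp
    then have "(x - y) - (x' - y') \<in> I" using *(5,6) ideal_diff by metis
    then show "x - y \<in> {x \<in> D. \<exists>y\<in>B. x - y \<in> I}"
      using * by (auto intro: diff_in B.diff_in)
    have "x * y - x' * y' = (x - x') * y + x' * (y - y')" by (simp add: algebra_simps)
    moreover have "(x - x') * y + x' * (y - y') \<in> I"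
      using * \<open>B \<subseteq> D\<close> by (intro ideal_add ideal_mult ideal_mult_right) auto
    ultimately have "x * y - x' * y' \<in> I" by simp
    then show "x * y \<in> {x \<in> D. \<exists>y\<in>B. x - y \<in> I}"
      using * by (auto intro: mult_in B.mult_in)
  qed
qed

end

lemma (in uideal) ideal_prod_cong:
  assumes "\<And>i. i \<in> A \<Longrightarrow> f i \<in> D" "\<And>i. i \<in> A \<Longrightarrow> g i \<in> D" "\<And>i. i \<in> A \<Longrightarrow> f i - g i \<in> I"
  shows "prod f A - prod g A \<in> I"
  using assms
proof (induction A rule: infinite_finite_induct)
  case (insert x A)
  have "f x * prod f A - g x * prod g A = (f x - g x) * prod f A + g x * (prod f A - prod g A)"
    by (simp add: algebra_simps)
  also have "\<dots> \<in> I"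
    using insert by (intro ideal_add ideal_mult ideal_mult_right) (auto intro: prod_in)
  finally show ?case using insert.hyps by simp
qed (simp_all add: ideal_zero)

text \<open>For finite \<open>A\<close> and \<open>g\<close> with values in \<open>D\<close>, this
  is the ideal of \<open>D\<close> generated by the family. The explicit coefficients matter: they
  are later averaged and lifted along a ring map.\<close>

definition lin_span :: "'a::comm_ring_1 set \<Rightarrow> 'i set \<Rightarrow> ('i \<Rightarrow> 'a) \<Rightarrow> 'a set" where
  "lin_span D A g = {\<Sum>k\<in>A. h k * g k | h. \<forall>k\<in>A. h k \<in> D}"

lemma lin_spanI: "(\<And>k. k \<in> A \<Longrightarrow> h k \<in> D) \<Longrightarrow> (\<Sum>k\<in>A. h k * g k) \<in> lin_span D A g"
  by (auto simp: lin_span_def)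

lemma (in usubring) uideal_lin_span:
  assumes "\<And>k. k \<in> A \<Longrightarrow> g k \<in> D"
  shows "uideal D (lin_span D A g)"
proof
  show "x \<in> D" if "x \<in> lin_span D A g" for x
    using that assms by (auto simp: lin_span_def intro!: sum_in mult_in)
  show "0 \<in> lin_span D A g"
    using lin_spanI[of A "\<lambda>_. 0" D g] zero_in by simp
  show "x + y \<in> lin_span D A g" if xy: "x \<in> lin_span D A g" "y \<in> lin_span D A g" for x y
  proof -
    obtain h h' where "x = (\<Sum>k\<in>A. h k * g k)" "y = (\<Sum>k\<in>A. h' k * g k)"
      "\<forall>k\<in>A. h k \<in> D" "\<forall>k\<in>A. h' k \<in> D" using xy by (auto simp: lin_span_def)
    then show ?thesis
      using lin_spanI[of A "\<lambda>k. h k + h' k" D g] add_in by (simp add: distrib_right sum.distrib)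
  qed
  show "x * y \<in> lin_span D A g" if xy: "x \<in> D" "y \<in> lin_span D A g" for x y
  proof -
    obtain h where "y = (\<Sum>k\<in>A. h k * g k)" "\<forall>k\<in>A. h k \<in> D" using xy by (auto simp: lin_span_def)
    then show ?thesis
      using lin_spanI[of A "\<lambda>k. x * h k" D g] mult_in xy by (simp add: sum_distrib_left mult.assoc)
  qed
qed

lemma lin_span_generator:
  assumes "usubring D" "finite A" "k \<in> A"
  shows "g k \<in> lin_span D A g"
proof -
  interpret usubring D by fact
  have "(\<Sum>j\<in>A. (if j = k then 1 else 0) * g j) = (\<Sum>j\<in>A. if j = k then g k else 0)"
    by (intro sum.cong) auto
  then show ?thesis
    using lin_spanI[of A "\<lambda>j. if j = k then 1 else 0" D g] assms by (simp add: one_in zero_in)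
qed

lemma lin_span_minimal:
  assumes "uideal D I" "\<And>k. k \<in> A \<Longrightarrow> g k \<in> I"
  shows "lin_span D A g \<subseteq> I"
proof -
  interpret uideal D I by fact
  show ?thesis using assms(2) by (auto simp: lin_span_def intro!: ideal_sum ideal_mult)
qed

section \<open>Subrings generated by a set\<close>

inductive_set ring_gen :: "'a::comm_ring_1 set \<Rightarrow> 'a set" for S where
  gen_one: "1 \<in> ring_gen S"
| gen_incl: "x \<in> S \<Longrightarrow> x \<in> ring_gen S"
| gen_diff: "x \<in> ring_gen S \<Longrightarrow> y \<in> ring_gen S \<Longrightarrow> x - y \<in> ring_gen S"
| gen_mult: "x \<in> ring_gen S \<Longrightarrow> y \<in> ring_gen S \<Longrightarrow> x * y \<in> ring_gen S"

lemma usubring_ring_gen: "usubring (ring_gen S)"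
  by standard (auto intro: ring_gen.intros)

lemma ring_gen_minimal:
  assumes "usubring D" "S \<subseteq> D"
  shows "ring_gen S \<subseteq> D"
proof
  interpret usubring D by fact
  show "x \<in> D" if "x \<in> ring_gen S" for x
    using that assms(2) by induction (auto intro: closed)
qed

lemma ring_gen_mono: "S \<subseteq> T \<Longrightarrow> ring_gen S \<subseteq> ring_gen T"
  by (rule ring_gen_minimal[OF usubring_ring_gen]) (auto intro: gen_incl)

lemma (in ring_map) ring_gen_image: "ring_gen (h ` S) = h ` ring_gen S"
proof (intro equalityI ring_gen_minimal subsetI)
  interpret g: usubring "ring_gen S" by (rule usubring_ring_gen)
  show "usubring (h ` ring_gen S)"
    by standard (auto simp flip: map_one map_minus map_mult intro: gen_one gen_diff gen_mult)
  show "x \<in> h ` ring_gen S" if "x \<in> h ` S" for x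
    using that by (auto intro: gen_incl)
next
  show "y \<in> ring_gen (h ` S)" if "y \<in> h ` ring_gen S" for y
  proof -
    from that obtain x where x: "x \<in> ring_gen S" "y = h x" by auto
    from x(1) have "h x \<in> ring_gen (h ` S)"
      by induction (auto simp: map_one map_minus map_mult intro: ring_gen.intros)
    then show ?thesis using x by simp
  qed
qed

lemma (in ring_map) ring_gen_fixed:
  assumes "\<And>x. x \<in> S \<Longrightarrow> h x = g x" "ring_map g" "x \<in> ring_gen S"
  shows "h x = g x"
proof -
  interpret g: ring_map g by fact
  show ?thesis using assms(3)
    by induction (auto simp: assms(1) map_one map_minus map_mult g.map_one g.map_minus g.map_mult)
qed

section \<open>Univariate polynomials with coefficients in a subring or an ideal\<close>

definition cpoly :: "'a::zero set \<Rightarrow> 'a poly set" where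
  "cpoly S = {p. \<forall>i. coeff p i \<in> S}"

lemma cpolyI: "(\<And>i. coeff p i \<in> S) \<Longrightarrow> p \<in> cpoly S"
  by (simp add: cpoly_def)

lemma cpolyD: "p \<in> cpoly S \<Longrightarrow> coeff p i \<in> S"
  by (simp add: cpoly_def)

lemma (in usubring) usubring_cpoly: "usubring (cpoly D)"
  by standard (auto intro!: cpolyI closed simp: coeff_mult coeff_1 dest: cpolyD)

lemma (in uideal) uideal_cpoly: "uideal (cpoly D) (cpoly I)"
proof -
  interpret c: usubring "cpoly D" by (rule usubring_cpoly)
  show ?thesis
    by standard
      (auto intro!: cpolyI closed ideal_zero ideal_add ideal_sum ideal_mult
        simp: coeff_mult dest: cpolyD ideal_sub)
qed

lemma cpoly_monom: "0 \<in> S \<Longrightarrow> c \<in> S \<Longrightarrow> Polynomial.monom c j \<in> cpoly S"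
  by (rule cpolyI) simp

lemma cpoly_shift: "p \<in> cpoly S \<Longrightarrow> poly_shift k p \<in> cpoly S"
  by (rule cpolyI) (simp add: coeff_poly_shift cpolyD)

lemma cpoly_cutoff: "0 \<in> S \<Longrightarrow> p \<in> cpoly S \<Longrightarrow> poly_cutoff k p \<in> cpoly S"
  by (rule cpolyI) (simp add: coeff_poly_cutoff cpolyD)

lemma cutoff_plus_shift:
  "p = poly_cutoff k p + Polynomial.monom 1 k * poly_shift k (p :: 'a::comm_ring_1 poly)"
  by (rule poly_eqI) (simp add: coeff_poly_cutoff coeff_poly_shift coeff_monom_mult)

section \<open>Division by monic polynomials and inversion modulo powers of t\<close>

definition monic_of :: "nat \<Rightarrow> 'a::comm_ring_1 poly \<Rightarrow> bool" where
  "monic_of d q \<longleftrightarrow> coeff q d = 1 \<and> (\<forall>i>d. coeff q i = 0)"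

text \<open>Isolates \<open>coeff s i\<close>: all other terms contain coefficients of
  \<open>s\<close> of larger index, so \<open>s\<close> can be recovered from \<open>q * s\<close>
  by descending induction.\<close>

lemma coeff_monic_mult:
  assumes "monic_of d q"
  shows "coeff (q * s) (d + i) = coeff s i + (\<Sum>a<d. coeff q a * coeff s (d + i - a))"
proof -
  have "coeff (q * s) (d + i) = (\<Sum>a\<le>d + i. coeff q a * coeff s (d + i - a))"
    by (simp add: coeff_mult)
  also have "\<dots> = (\<Sum>a\<in>insert d {..<d}. coeff q a * coeff s (d + i - a))"
    using assms by (intro sum.mono_neutral_right) (auto simp: monic_of_def)
  also have "\<dots> = coeff s i + (\<Sum>a<d. coeff q a * coeff s (d + i - a))"
    using assms by (simp add: monic_of_def)
  finally show ?thesis .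
qed

text \<open>A monic divisor requires no inverses, so quotient and remainder keep their coefficients
  in \<open>D\<close>. The induction is on the excess \<open>N\<close> of a degree bound of
  \<open>f\<close> over \<open>d\<close>.\<close>

lemma (in usubring) monic_division:
  assumes q: "monic_of d q" "q \<in> cpoly D" and f: "f \<in> cpoly D"
  shows "\<exists>s\<in>cpoly D. \<exists>r\<in>cpoly D. f = q * s + r \<and> (\<forall>i\<ge>d. coeff r i = 0)"
proof -
  interpret c: usubring "cpoly D" by (rule usubring_cpoly)
  have "\<exists>s\<in>cpoly D. \<exists>r\<in>cpoly D. f = q * s + r \<and> (\<forall>i\<ge>d. coeff r i = 0)"
    if "f \<in> cpoly D" "\<forall>i\<ge>d + N. coeff f i = 0" for N f
    using that
  proof (induction N arbitrary: f)
    case 0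
    then show ?case using c.zero_in by (intro bexI[of _ 0] bexI[of _ f]) auto
  next
    case (Suc N)
    \<comment> \<open>Subtracting \<open>q * m\<close> cancels the coefficient of index
      \<open>d + N\<close>, the largest one that may be nonzero.\<close>
    define m where "m = Polynomial.monom (coeff f (d + N)) N"
    have m: "m \<in> cpoly D" unfolding m_def
      by (rule cpoly_monom) (use Suc zero_in in \<open>auto dest: cpolyD\<close>)
    have "coeff (f - q * m) i = 0" if "d + N \<le> i" for i
    proof -
      have "coeff (q * m) i = coeff q (i - N) * coeff f (d + N)"
        using that coeff_monom_mult[of "coeff f (d + N)" N q i]
        by (simp add: m_def mult.commute[of q] mult.commute[of "coeff q _"])
      then show ?thesis
        using that Suc.prems(2) q(1) by (cases "i = d + N") (auto simp: monic_of_def)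
    qed
    moreover have "f - q * m \<in> cpoly D" using Suc.prems m q by (auto intro: c.closed)
    ultimately obtain s r where sr: "s \<in> cpoly D" "r \<in> cpoly D" "f - q * m = q * s + r"
      "\<forall>i\<ge>d. coeff r i = 0"
      using Suc.IH[of "f - q * m"] by blast
    then have "f = q * (s + m) + r" by (simp add: algebra_simps)
    then show ?case using sr m by (blast intro: c.add_in)
  qed
  from this[of f "Suc (degree f)"] f show ?thesis by (simp add: coeff_eq_0)
qed

text \<open>Uniqueness of quotient and remainder over \<open>D\<close> modulo \<open>I\<close>: the
  coefficients of \<open>q * s\<close> of index at least \<open>d\<close> vanish modulo
  \<open>I\<close>, and \<open>coeff_monic_mult\<close> then kills those of \<open>s\<close> from
  the top down.\<close>

lemma (in uideal) monic_mult_mod: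
  assumes q: "monic_of d q" "q \<in> cpoly D" and s: "s \<in> cpoly D"
    and r: "\<And>i. i \<ge> d \<Longrightarrow> coeff r i = 0" and qsr: "q * s - r \<in> cpoly I"
  shows "s \<in> cpoly I" "r \<in> cpoly I"
proof -
  interpret c: uideal "cpoly D" "cpoly I" by (rule uideal_cpoly)
  have "coeff s i \<in> I" for i
  proof (induction "Suc (degree s) - i" arbitrary: i rule: less_induct)
    case less
    show ?case
    proof (cases "i > degree s")
      case True
      then show ?thesis by (simp add: coeff_eq_0 ideal_zero)
    next
      case False
      have *: "coeff s j \<in> I" if "j > i" for j using less[of j] that False by auto
      have "coeff (q * s) (d + i) \<in> I" using cpolyD[OF qsr, of "d + i"] r by simp
      moreover have "(\<Sum>a<d. coeff q a * coeff s (d + i - a)) \<in> I"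
        using q by (intro ideal_sum ideal_mult *) (auto dest: cpolyD)
      ultimately show ?thesis
        unfolding coeff_monic_mult[OF q(1)] using ideal_diff by fastforce
    qed
  qed
  then show "s \<in> cpoly I" by (rule cpolyI)
  then have "q * s \<in> cpoly I" using q by (auto intro: c.ideal_mult)
  then show "r \<in> cpoly I" using qsr c.ideal_cong by blast
qed

text \<open>Modulo \<open>I\<close> and t^(m+1), \<open>v\<close> is a unit because its constant
  term is one. Comparing coefficients in ascending order cancels it without constructing its
  inverse.\<close>

lemma (in uideal) low_coeffs_cancel_unit:
  assumes q: "q \<in> cpoly D" and v: "v \<in> cpoly D" and w: "w \<in> D" "w * coeff v 0 - 1 \<in> I"
    and qv: "\<And>s. s \<le> m \<Longrightarrow> coeff (q * v) s \<in> I" and "s \<le> m"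
  shows "coeff q s \<in> I"
  using \<open>s \<le> m\<close>
proof (induction s rule: less_induct)
  case (less s)
  have "coeff (q * v) s = (\<Sum>a<s. coeff q a * coeff v (s - a)) + coeff q s * coeff v 0"
    by (simp add: coeff_mult lessThan_Suc_atMost[symmetric])
  moreover have "(\<Sum>a<s. coeff q a * coeff v (s - a)) \<in> I"
    using less v by (intro ideal_sum ideal_mult_right) (auto dest: cpolyD)
  ultimately have "coeff q s * coeff v 0 \<in> I" using ideal_diff[OF qv[OF less.prems]] by fastforce
  then have "w * (coeff q s * coeff v 0) - coeff q s * (w * coeff v 0 - 1) \<in> I"
    using w q by (auto intro!: ideal_diff ideal_mult dest: cpolyD)
  moreover have "w * (coeff q s * coeff v 0) - coeff q s * (w * coeff v 0 - 1) = coeff q s"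
    by (simp add: algebra_simps)
  ultimately show ?case by simp
qed

lemma (in usubring) truncated_inverse:
  assumes v: "v \<in> cpoly D" and w0: "w0 \<in> D" "coeff v 0 * w0 = 1"
  shows "\<exists>w\<in>cpoly D. \<forall>i<d. coeff (v * w) i = (if i = 0 then 1 else 0)"
proof (induction d)
  case 0
  then show ?case using usubring.zero_in[OF usubring_cpoly] by auto
next
  case (Suc d)
  interpret c: usubring "cpoly D" by (rule usubring_cpoly)
  from Suc obtain w where w: "w \<in> cpoly D" "\<forall>i<d. coeff (v * w) i = (if i = 0 then 1 else 0)"
    by blast
  \<comment> \<open>The defect of \<open>v * w\<close> in the coefficient of t^d; since
    \<open>w0\<close> inverts the constant term of \<open>v\<close>, adding \<open>w0 * c\<close> to
    \<open>w\<close> in degree \<open>d\<close> removes it.\<close>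
  define c where "c = (if d = 0 then 1 else 0) - coeff (v * w) d"
  have c: "c \<in> D"
    unfolding c_def using v w by (auto intro!: closed dest: cpolyD[OF c.mult_in])
  define w' where "w' = w + Polynomial.monom (w0 * c) d"
  have "w' \<in> cpoly D"
    unfolding w'_def using w w0 c by (auto intro!: c.add_in cpoly_monom closed)
  moreover have "coeff (v * w') i = (if i = 0 then 1 else 0)" if "i < Suc d" for i
  proof -
    have "coeff (v * w') i = coeff (v * w) i + (if d \<le> i then w0 * c * coeff v (i - d) else 0)"
      unfolding w'_def by (simp add: distrib_left mult.commute[of v "Polynomial.monom _ _"] coeff_monom_mult)
    moreover have "w0 * c * coeff v 0 = c" using w0(2) by (simp add: ac_simps)
    ultimately show ?thesis using w(2) that unfolding c_def by (cases "i = d") auto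
  qed
  ultimately show ?case by blast
qed

lemma coeff_prod_cong_low:
  fixes f g :: "'i \<Rightarrow> 'a::comm_ring_1 poly"
  assumes "\<And>i s. i \<in> A \<Longrightarrow> s \<le> m \<Longrightarrow> coeff (f i) s = coeff (g i) s" "s \<le> m"
  shows "coeff (prod f A) s = coeff (prod g A) s"
  using assms
proof (induction A arbitrary: s rule: infinite_finite_induct)
  case (insert x A)
  then show ?case by (auto simp: coeff_mult intro!: sum.cong)
qed simp_all

subsection \<open>Radical ideals\<close>

definition radical_of :: "'a::comm_ring_1 set \<Rightarrow> 'a set \<Rightarrow> 'a set" where
  "radical_of D I = {x \<in> D. \<exists>M. x ^ M \<in> I}"

lemma (in uideal) uideal_radical: "uideal D (radical_of D I)"
proof
  show "x \<in> radical_of D I \<Longrightarrow> x \<in> D" for x by (simp add: radical_of_def)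
  show "0 \<in> radical_of D I"
    unfolding radical_of_def using zero_in ideal_zero by (auto intro!: exI[of _ 1])
  show "x * y \<in> radical_of D I" if xy: "x \<in> D" "y \<in> radical_of D I" for x y
  proof -
    from xy obtain M where "y \<in> D" "y ^ M \<in> I" by (auto simp: radical_of_def)
    then have "x * y \<in> D" "(x * y) ^ M \<in> I" using xy(1)
      by (auto simp: power_mult_distrib intro: ideal_mult closed)
    then show ?thesis by (auto simp: radical_of_def)
  qed
  show "x + y \<in> radical_of D I" if xy: "x \<in> radical_of D I" "y \<in> radical_of D I" for x y
  proof -
    from xy obtain M N where *: "x \<in> D" "x ^ M \<in> I" "y \<in> D" "y ^ N \<in> I"
      by (auto simp: radical_of_def)
    have "of_nat k \<in> D" for k by (induction k) (auto intro: closed)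
    moreover have "x ^ k * y ^ (M + N - k) \<in> I" for k
    proof (cases "M \<le> k")
      case True
      then have "x ^ k \<in> I" using * ideal_power_le by blast
      then show ?thesis using * by (auto intro: ideal_mult_right closed)
    next
      case False
      then have "y ^ (M + N - k) \<in> I" using *(3,4) ideal_power_le[of y N "M + N - k"] by simp
      then show ?thesis using * by (auto intro: ideal_mult closed)
    qed
    ultimately have "(x + y) ^ (M + N) \<in> I"
      unfolding binomial_ring mult.assoc by (intro ideal_sum) (rule ideal_mult, auto)
    then show ?thesis using * by (auto simp: radical_of_def intro: closed)
  qed
qed

lemma radical_of_square: "x \<in> D \<Longrightarrow> x * x \<in> radical_of D I \<Longrightarrow> x \<in> radical_of D I"
  by (auto simp: radical_of_def power_mult[symmetric] simp flip: power2_eq_square)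

locale radical_uideal = uideal +
  assumes square_radical: "x \<in> D \<Longrightarrow> x * x \<in> I \<Longrightarrow> x \<in> I"
begin

text \<open>Armendariz' argument: multiplying the coefficient of index \<open>i + j\<close> of the product by the
  product of the coefficients of index \<open>i\<close> and \<open>j\<close> leaves, modulo the ideal, only the square of
  the latter, by induction on \<open>i + j\<close> and then on \<open>i\<close>.\<close>

lemma coeff_products_in_radical:
  assumes f: "f \<in> cpoly D" and g: "g \<in> cpoly D"
    and fg: "\<And>s. s \<le> m \<Longrightarrow> coeff (f * g) s \<in> I" and "i + j \<le> m"
  shows "coeff f i * coeff g j \<in> I"
  using \<open>i + j \<le> m\<close>
proof (induction "i + j" arbitrary: i j rule: less_induct)
  case less
  define s where "s = i + j"
  have fD: "coeff f a \<in> D" and gD: "coeff g a \<in> D" for a using f g by (auto dest: cpolyD)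
  have smaller: "coeff f a * coeff g b \<in> I" if "a + b < s" for a b
    using less that by (auto simp: s_def)
  have "coeff f a * coeff g (s - a) \<in> I" if "a \<le> s" for a
    using that
  proof (induction a rule: less_induct)
    case (less a)
    have "coeff f a * coeff g (s - a) * coeff (f * g) s \<in> I"
      using fg[of s] \<open>i + j \<le> m\<close> fD gD by (auto simp: s_def intro!: ideal_mult mult_in)
    moreover have "coeff f a * coeff g (s - a) * coeff (f * g) s =
        (\<Sum>b\<in>{..s} - {a}. coeff f a * coeff g (s - a) * (coeff f b * coeff g (s - b))) +
        coeff f a * coeff g (s - a) * (coeff f a * coeff g (s - a))"
      using less.prems
      by (simp add: coeff_mult sum.remove[of "{..s}" a] add.commute distrib_left)
         (simp add: sum_distrib_left)
    moreover have "coeff f a * coeff g (s - a) * (coeff f b * coeff g (s - b)) \<in> I"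
      if "b \<in> {..s} - {a}" for b
    proof (cases "b < a")
      case True
      then have "coeff f b * coeff g (s - b) \<in> I" using less by simp
      then show ?thesis using fD gD by (intro ideal_mult[OF mult_in])
    next
      case False
      \<comment> \<open>For b > a the indices \<open>a\<close> and \<open>s - b\<close> add up to
        less than \<open>s\<close>, so the outer induction applies once the second factors of the
        two pairs are exchanged.\<close>
      then have "coeff f a * coeff g (s - b) \<in> I" using that by (intro smaller) auto
      then have "coeff f a * coeff g (s - b) * (coeff f b * coeff g (s - a)) \<in> I"
        using fD gD by (auto intro!: ideal_mult_right mult_in)
      then show ?thesis by (simp add: ac_simps)
    qed
    ultimately have "coeff f a * coeff g (s - a) * (coeff f a * coeff g (s - a)) \<in> I"
      by (metis (no_types, lifting) ideal_sum ideal_diff add_diff_cancel_left')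
    then show ?case using fD gD by (auto intro!: square_radical mult_in)
  qed
  from this[of i] show ?case by (simp add: s_def)
qed

text \<open>Splits off one factor at a time with \<open>coeff_products_in_radical\<close>. The
  multiplier \<open>c\<close> collects the coefficients already taken: only after multiplication by
  it do the low coefficients of the remaining product lie in \<open>I\<close>.\<close>

lemma coeff_prod_in_radical:
  assumes "finite A" "\<And>i. i \<in> A \<Longrightarrow> f i \<in> cpoly D" "c \<in> D"
    and "\<And>s. s \<le> m \<Longrightarrow> c * coeff (\<Prod>i\<in>A. f i) s \<in> I" "(\<Sum>i\<in>A. j i) \<le> m"
  shows "c * (\<Prod>i\<in>A. coeff (f i) (j i)) \<in> I"
  using assms
proof (induction A arbitrary: c m rule: finite_induct)
  case empty
  from empty(3)[of 0] show ?case by simp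
next
  case (insert x A)
  interpret c: usubring "cpoly D" by (rule usubring_cpoly)
  let ?P = "\<Prod>i\<in>A. f i"
  have fx: "f x \<in> cpoly D" and P: "?P \<in> cpoly D" using insert.prems by (auto intro: c.prod_in)
  have "[:c:] \<in> cpoly D"
    using insert.prems(2) zero_in by (intro cpolyI) (simp add: coeff_pCons split: nat.split)
  from c.mult_in[OF this P] have cP: "smult c ?P \<in> cpoly D" by simp
  have "c * coeff (f x) (j x) * coeff ?P s \<in> I" if "s \<le> m - j x" for s
  proof -
    have "coeff (f x) (j x) * coeff (smult c ?P) s \<in> I"
    proof (rule coeff_products_in_radical[OF fx cP])
      show "coeff (f x * smult c ?P) s \<in> I" if "s \<le> m" for s
        using insert.prems(3)[OF that] insert.hyps by simp
      show "j x + s \<le> m" using that insert.prems(4) insert.hyps by simp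
    qed
    then show ?thesis by (simp add: ac_simps)
  qed
  then have "c * coeff (f x) (j x) * (\<Prod>i\<in>A. coeff (f i) (j i)) \<in> I"
    using insert.prems insert.hyps fx
    by (intro insert.IH[of _ "m - j x"]) (auto intro!: mult_in dest: cpolyD)
  then show ?case using insert.hyps by (simp add: ac_simps)
qed

end

subsection \<open>Weierstrass factorization modulo powers of an ideal\<close>

text \<open>Models the powers of an ideal; the instance used later is given by order of vanishing,
  where membership can be read off from monomials.\<close>

locale ideal_filtration = usubring +
  fixes N :: "nat \<Rightarrow> 'a::comm_ring_1 set"
  assumes filtration_ideal: "uideal D (N k)"
    and filtration_Suc: "x \<in> N (Suc k) \<Longrightarrow> x \<in> N k"
    and filtration_mult: "x \<in> N j \<Longrightarrow> y \<in> N k \<Longrightarrow> x * y \<in> N (j + k)"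
begin

lemma filtration_mono: "j \<le> k \<Longrightarrow> x \<in> N k \<Longrightarrow> x \<in> N j"
  by (induction k rule: dec_induct) (auto intro: filtration_Suc)

lemma cpoly_filtration_mult: "p \<in> cpoly (N j) \<Longrightarrow> q \<in> cpoly (N k) \<Longrightarrow> p * q \<in> cpoly (N (j + k))"
  by (intro cpolyI) (auto simp: coeff_mult intro!: uideal.ideal_sum[OF filtration_ideal]
      filtration_mult dest: cpolyD)

text \<open>Hensel-type lifting, gaining one order per step. Every element congruent to
  \<open>coeff f d\<close> is assumed to be a unit because the constant term of \<open>v\<close>
  changes from step to step within that class.\<close>

lemma weierstrass_factorization:
  assumes f: "f \<in> cpoly D" and low: "\<And>i. i < d \<Longrightarrow> coeff f i \<in> N 1"
    and unit: "\<And>u. u - coeff f d \<in> N 1 \<Longrightarrow> \<exists>w\<in>D. u * w = 1"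
  shows "\<exists>q\<in>cpoly D. \<exists>v\<in>cpoly D. monic_of d q \<and> (\<forall>i<d. coeff q i \<in> N 1) \<and>
           coeff v 0 - coeff f d \<in> N 1 \<and> f - q * v \<in> cpoly (N (Suc k))"
proof (induction k)
  case 0
  interpret N1: uideal D "N 1" by (rule filtration_ideal)
  interpret c: usubring "cpoly D" by (rule usubring_cpoly)
  \<comment> \<open>The start: \<open>q\<close> is t^d and \<open>v\<close> is the part of
    \<open>f\<close> of order at least \<open>d\<close>, divided by t^d.\<close>
  have "f - Polynomial.monom 1 d * poly_shift d f = poly_cutoff d f"
    using cutoff_plus_shift[of f d] by (simp add: algebra_simps)
  moreover have "poly_cutoff d f \<in> cpoly (N 1)"
    using low by (intro cpolyI) (simp add: coeff_poly_cutoff N1.ideal_zero[simplified])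
  ultimately show ?case
    using f N1.ideal_zero zero_in one_in
    by (intro bexI[of _ "Polynomial.monom 1 d"] bexI[of _ "poly_shift d f"])
      (auto simp: monic_of_def coeff_poly_shift intro: cpoly_shift cpoly_monom)
next
  case (Suc k)
  interpret N1: uideal D "N 1" by (rule filtration_ideal)
  interpret Nk: uideal D "N (Suc k)" by (rule filtration_ideal)
  interpret Nk': uideal D "N (Suc (Suc k))" by (rule filtration_ideal)
  interpret c: usubring "cpoly D" by (rule usubring_cpoly)
  interpret ck: uideal "cpoly D" "cpoly (N (Suc k))" by (rule Nk.uideal_cpoly)
  interpret ck': uideal "cpoly D" "cpoly (N (Suc (Suc k)))" by (rule Nk'.uideal_cpoly)
  from Suc obtain q v where q: "q \<in> cpoly D" "monic_of d q" "\<forall>i<d. coeff q i \<in> N 1"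
    and v: "v \<in> cpoly D" "coeff v 0 - coeff f d \<in> N 1"
    and r: "f - q * v \<in> cpoly (N (Suc k))" by blast
  define r where "r = f - q * v"
  obtain w0 where "w0 \<in> D" "coeff v 0 * w0 = 1" using unit v by blast
  then obtain w where w: "w \<in> cpoly D" "\<forall>i<d. coeff (v * w) i = (if i = 0 then 1 else 0)"
    using truncated_inverse[OF v(1)] by blast
  \<comment> \<open>The error \<open>r\<close> is to be written as \<open>e * v + T * h\<close> with
    \<open>e\<close> of degree below \<open>d\<close>. So \<open>e\<close> has to be
    \<open>r / v\<close> modulo t^d, where \<open>w\<close> serves as the inverse of
    \<open>v\<close>.\<close>
  define T where "T = (Polynomial.monom 1 d :: 'a poly)"
  define g where "g = poly_shift d (v * w - 1)"
  define e where "e = poly_cutoff d (r * w)"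
  define g' where "g' = poly_shift d (r * w)"
  define h where "h = v * g' - g * r"
  have "poly_cutoff d (v * w - 1) = 0"
    using w(2) by (intro poly_eqI) (auto simp: coeff_poly_cutoff coeff_1)
  then have vw: "v * w = 1 + T * g"
    using cutoff_plus_shift[of "v * w - 1" d] by (simp add: T_def g_def algebra_simps)
  have rw: "r * w = e + T * g'"
    using cutoff_plus_shift[of "r * w" d] by (simp add: T_def e_def g'_def)
  have "r * (v * w) = v * (r * w)" by (simp add: ac_simps)
  then have r_ev: "r = e * v + T * h"
    unfolding vw rw h_def by (simp add: algebra_simps)
  have rk: "r \<in> cpoly (N (Suc k))" using r by (simp add: r_def)
  then have rwk: "r * w \<in> cpoly (N (Suc k))" using w by (auto intro: ck.ideal_mult_right)
  have ek: "e \<in> cpoly (N (Suc k))"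
    unfolding e_def by (rule cpoly_cutoff[OF Nk.ideal_zero rwk])
  have "g \<in> cpoly D" unfolding g_def using v w by (auto intro!: cpoly_shift c.closed)
  moreover have "g' \<in> cpoly (N (Suc k))" unfolding g'_def by (rule cpoly_shift[OF rwk])
  ultimately have hk: "h \<in> cpoly (N (Suc k))"
    unfolding h_def using v rk by (auto intro!: ck.ideal_diff ck.ideal_mult)
  have N1k: "N (Suc k) \<subseteq> N 1" using filtration_mono[of 1 "Suc k"] by auto
  have qT: "q - T \<in> cpoly (N 1)"
  proof (rule cpolyI)
    show "coeff (q - T) i \<in> N 1" for i
      using q(2,3) N1.ideal_zero by (cases i d rule: linorder_cases) (auto simp: T_def monic_of_def)
  qed
  \<comment> \<open>The linear corrections are \<open>e * v\<close> and \<open>q * h\<close>,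
    whereas \<open>h\<close> was chosen for \<open>T\<close> in place of \<open>q\<close>. The
    discrepancy \<open>q - T\<close> lies in \<open>N 1\<close>, so it gains one order, as does the
    product \<open>e * h\<close>.\<close>
  have "f - (q + e) * (v + h) = - ((q - T) * h + e * h)"
    using r_ev by (simp add: r_def algebra_simps)
  moreover have "(q - T) * h \<in> cpoly (N (Suc (Suc k)))"
    using cpoly_filtration_mult[OF qT hk] by simp
  moreover have "e * h \<in> cpoly (N (Suc (Suc k)))"
    using cpoly_filtration_mult[OF _ hk, of e 1] ek N1k by (auto simp: cpoly_def)
  ultimately have "f - (q + e) * (v + h) \<in> cpoly (N (Suc (Suc k)))"
    by (simp add: ck'.ideal_add ck'.ideal_uminus ck'.ideal_diff)
  moreover have "monic_of d (q + e)"
    using q(2) by (simp add: monic_of_def e_def coeff_poly_cutoff)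
  moreover have "coeff (q + e) i \<in> N 1" if "i < d" for i
    using that q(3) cpolyD[OF ek, of i] N1k N1.ideal_add[of "coeff q i" "coeff e i"] by auto
  moreover have "coeff (v + h) 0 - coeff f d \<in> N 1"
    using N1.ideal_add[OF v(2), of "coeff h 0"] cpolyD[OF hk, of 0] N1k by (auto simp: algebra_simps)
  moreover have "q + e \<in> cpoly D" "v + h \<in> cpoly D"
    using q v ek hk by (auto intro!: c.add_in dest: ck.ideal_sub)
  ultimately show ?case by blast
qed

end

section \<open>Multivariate polynomials\<close>

abbreviation keys where "keys \<equiv> Poly_Mapping.keys"
abbreviation lookup where "lookup \<equiv> Poly_Mapping.lookup"

lemma poly_mapping_sum_singles:
  assumes "finite A" "keys (p :: 'a \<Rightarrow>\<^sub>0 'b::comm_monoid_add) \<subseteq> A"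
  shows "p = (\<Sum>k\<in>A. Poly_Mapping.single k (lookup p k))"
proof (rule poly_mapping_eqI)
  show "lookup p k = lookup (\<Sum>k\<in>A. Poly_Mapping.single k (lookup p k)) k" for k
    using assms by (auto simp: lookup_sum lookup_single when_def in_keys_iff)
qed

lemma poly_mapping_mult_singles:
  fixes p q :: "'a::comm_monoid_add \<Rightarrow>\<^sub>0 'b::comm_ring_1"
  shows "p * q = (\<Sum>a\<in>keys p. \<Sum>b\<in>keys q. Poly_Mapping.single (a + b) (lookup p a * lookup q b))"
proof -
  have "p * q = (\<Sum>a\<in>keys p. Poly_Mapping.single a (lookup p a)) *
      (\<Sum>b\<in>keys q. Poly_Mapping.single b (lookup q b))"
    using poly_mapping_sum_singles[of "keys p" p] poly_mapping_sum_singles[of "keys q" q] by simp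
  then show ?thesis by (simp add: sum_product mult_single)
qed

lemma mvar_power: "mvar v ^ k = Poly_Mapping.single (Poly_Mapping.single v k) (1 :: 'a::comm_ring_1)"
proof (induction k)
  case (Suc k)
  then show ?case by (simp add: mvar_def mult_single single_add[symmetric])
qed simp

lemma prod_mvar_power:
  assumes "finite A"
  shows "(\<Prod>v\<in>A. mvar v ^ g v) =
    Poly_Mapping.single (\<Sum>v\<in>A. Poly_Mapping.single v (g v)) (1 :: 'a::comm_ring_1)"
  using assms by (induction A rule: finite_induct) (simp_all add: mvar_power mult_single)

lemma single_eq_mconst_mult:
  "Poly_Mapping.single e c = mconst c * (\<Prod>v\<in>keys e. mvar v ^ lookup e v :: ('v, 'a::comm_ring_1) mpoly)"
  using poly_mapping_sum_singles[of "keys e" e]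
  by (simp add: prod_mvar_power mconst_def mult_single)

lemma mpoly_eq_sum_monomials:
  "p = (\<Sum>e\<in>keys p. mconst (lookup p e) * (\<Prod>v\<in>keys e. mvar v ^ lookup e v :: ('v, 'a::comm_ring_1) mpoly))"
  using poly_mapping_sum_singles[of "keys p" p] by (simp flip: single_eq_mconst_mult)

lemma ring_map_mconst: "ring_map (mconst :: 'a::comm_ring_1 \<Rightarrow> ('v, 'a) mpoly)"
  by standard (simp_all add: mconst_def single_add mult_single)

lemma mvar_neq_0: "(mvar v :: ('v, 'a::comm_ring_1) mpoly) \<noteq> 0"
  unfolding mvar_def by (metis lookup_single_eq lookup_zero one_neq_zero)

section \<open>Evaluation homomorphisms\<close>

definition exp_eval :: "('v \<Rightarrow> 'b::comm_ring_1) \<Rightarrow> ('v \<Rightarrow>\<^sub>0 nat) \<Rightarrow> 'b" where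
  "exp_eval g e = (\<Prod>v\<in>keys e. g v ^ lookup e v)"

lemma exp_eval_superset:
  "finite A \<Longrightarrow> keys e \<subseteq> A \<Longrightarrow> exp_eval g e = (\<Prod>v\<in>A. g v ^ lookup e v)"
  unfolding exp_eval_def by (rule prod.mono_neutral_left) (auto simp: in_keys_iff)

lemma exp_eval_add: "exp_eval g (e + e') = exp_eval g e * exp_eval g e'"
proof -
  have "keys (e + e') \<subseteq> keys e \<union> keys e'" by (rule keys_add)
  then show ?thesis
    using exp_eval_superset[of "keys e \<union> keys e'" e g] exp_eval_superset[of "keys e \<union> keys e'" e' g]
      exp_eval_superset[of "keys e \<union> keys e'" "e + e'" g]
    by (simp add: lookup_add power_add prod.distrib)
qed

definition meval :: "('a::comm_ring_1 \<Rightarrow> 'b::comm_ring_1) \<Rightarrow> ('v \<Rightarrow> 'b) \<Rightarrow> ('v, 'a) mpoly \<Rightarrow> 'b" where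
  "meval h g p = (\<Sum>e\<in>keys p. h (lookup p e) * exp_eval g e)"

context ring_map
begin

lemma meval_superset:
  "finite A \<Longrightarrow> keys p \<subseteq> A \<Longrightarrow> meval h g p = (\<Sum>e\<in>A. h (lookup p e) * exp_eval g e)"
  unfolding meval_def by (rule sum.mono_neutral_left) (auto simp: in_keys_iff map_zero)

lemma meval_add: "meval h g (p + q) = meval h g p + meval h g q"
proof -
  have "keys (p + q) \<subseteq> keys p \<union> keys q" by (rule keys_add)
  then show ?thesis
    using meval_superset[of "keys p \<union> keys q" p g] meval_superset[of "keys p \<union> keys q" q g]
      meval_superset[of "keys p \<union> keys q" "p + q" g]
    by (simp add: lookup_add map_add distrib_right sum.distrib)
qed

lemma meval_zero: "meval h g 0 = 0"
  by (simp add: meval_def)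

lemma meval_sum: "meval h g (sum f A) = (\<Sum>x\<in>A. meval h g (f x))"
  by (induction A rule: infinite_finite_induct) (simp_all add: meval_zero meval_add)

lemma meval_single: "meval h g (Poly_Mapping.single e c) = h c * exp_eval g e"
  by (simp add: meval_def map_zero)

lemma ring_map_meval: "ring_map (meval h g)"
proof
  have "meval h g (Poly_Mapping.single 0 1) = 1"
    by (simp only: meval_single) (simp add: exp_eval_def map_one)
  then show "meval h g 1 = 1" by simp
  show "meval h g (p + q) = meval h g p + meval h g q" for p q by (rule meval_add)
  show "meval h g (p * q) = meval h g p * meval h g q" for p q
  proof -
    have "meval h g (p * q) = (\<Sum>a\<in>keys p. \<Sum>b\<in>keys q.
        (h (lookup p a) * exp_eval g a) * (h (lookup q b) * exp_eval g b))"
      by (simp add: poly_mapping_mult_singles[of p q] meval_sum meval_single exp_eval_add map_mult ac_simps)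
    then show ?thesis by (simp add: meval_def sum_product)
  qed
qed

lemma meval_mconst: "meval h g (mconst c) = h c"
  by (simp add: mconst_def meval_single exp_eval_def)

lemma meval_mvar: "meval h g (mvar v) = g v"
  by (simp add: mvar_def meval_single exp_eval_def map_one)

end

lemma ring_map_id: "ring_map (\<lambda>x. x)"
  by standard simp_all

text \<open>The constant term is evaluation at the origin, which makes its multiplicativity
  immediate.\<close>

lemma lookup_zero_eq_meval: "lookup p 0 = meval (\<lambda>x. x) (\<lambda>_. 0) p"
proof -
  have "exp_eval (\<lambda>_. 0) e = (if e = 0 then 1 else 0 :: 'a)" for e :: "'b \<Rightarrow>\<^sub>0 nat"
  proof -
    show ?thesis
    proof (cases "e = 0")
      case False
      then obtain v where "v \<in> keys e" by (metis keys_eq_empty equals0I)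
      then have "\<exists>v\<in>keys e. (0 :: 'a) ^ lookup e v = 0" by (auto simp: in_keys_iff zero_power intro!: bexI[of _ v])
      then show ?thesis using False by (simp add: exp_eval_def prod_zero)
    qed (simp add: exp_eval_def)
  qed
  then have "meval (\<lambda>x. x) (\<lambda>_. 0) p = (\<Sum>e\<in>keys p. if e = 0 then lookup p e else 0)"
    unfolding meval_def by (intro sum.cong) auto
  then show ?thesis by (simp add: in_keys_iff)
qed

lemma ring_map_lookup_zero: "ring_map (\<lambda>p :: ('v, 'a::comm_ring_1) mpoly. lookup p 0)"
proof -
  have "(\<lambda>p :: ('v, 'a) mpoly. lookup p 0) = meval (\<lambda>x. x) (\<lambda>_. 0)"
    by (rule ext) (rule lookup_zero_eq_meval)
  then show ?thesis by (simp add: ring_map.ring_map_meval ring_map_id)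
qed

lemma lookup_zero_mconst [simp]: "lookup (mconst c) 0 = c"
  by (simp add: mconst_def)

lemma lookup_zero_mvar [simp]: "lookup (mvar v) 0 = 0"
proof -
  have "Poly_Mapping.single v (1::nat) \<noteq> 0"
    by (metis lookup_single_eq lookup_zero one_neq_zero)
  then show ?thesis unfolding mvar_def by (intro lookup_single_not_eq)
qed

section \<open>Polynomial rings over a subring of the coefficients\<close>

lemma usubring_mpoly_over:
  assumes "usubring K"
  shows "usubring (mpoly_over K V :: ('v, 'a::comm_ring_1) mpoly set)"
proof -
  interpret K: usubring K by fact
  show ?thesis
  proof
    show "1 \<in> mpoly_over K V"
      by (auto simp: mpoly_over_def lookup_one when_def K.closed)
  next
    fix p q :: "('v, 'a) mpoly" assume pq: "p \<in> mpoly_over K V" "q \<in> mpoly_over K V"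
    show "p - q \<in> mpoly_over K V"
      using pq subsetD[OF keys_diff[of p q]]
      by (auto simp: mpoly_over_def lookup_minus K.closed) blast
    have "lookup (p * q) e \<in> K" for e
      using pq unfolding poly_mapping_mult_singles lookup_sum
      by (auto intro!: K.sum_in simp: mpoly_over_def lookup_single when_def K.closed)
    moreover have "keys e \<subseteq> V" if e: "e \<in> keys (p * q)" for e
    proof -
      obtain a b where "a \<in> keys p" "b \<in> keys q" "e = a + b"
        using e subsetD[OF keys_mult[of p q], of e] by auto
      then have "keys a \<subseteq> V" "keys b \<subseteq> V" "keys e \<subseteq> keys a \<union> keys b"
        using pq keys_add[of a b] by (auto simp: mpoly_over_def)
      then show ?thesis by blast
    qed
    ultimately show "p * q \<in> mpoly_over K V" by (auto simp: mpoly_over_def)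
  qed
qed

lemma mconst_in_mpoly_over: "usubring K \<Longrightarrow> c \<in> K \<Longrightarrow> mconst c \<in> mpoly_over K V"
  by (auto simp: mpoly_over_def mconst_def lookup_single when_def usubring.zero_in)

lemma mvar_in_mpoly_over: "usubring K \<Longrightarrow> v \<in> V \<Longrightarrow> mvar v \<in> mpoly_over K V"
  by (auto simp: mpoly_over_def mvar_def lookup_single when_def usubring.zero_in usubring.one_in)

lemma mpoly_over_eq_ring_gen:
  assumes "usubring K"
  shows "mpoly_over K V = ring_gen (mconst ` K \<union> mvar ` V :: ('v, 'a::comm_ring_1) mpoly set)"
proof
  interpret g: usubring "ring_gen (mconst ` K \<union> mvar ` V :: ('v, 'a) mpoly set)"
    by (rule usubring_ring_gen)
  show "mpoly_over K V \<subseteq> ring_gen (mconst ` K \<union> mvar ` V :: ('v, 'a) mpoly set)"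
  proof
    fix p :: "('v, 'a) mpoly" assume p: "p \<in> mpoly_over K V"
    have "(\<Sum>e\<in>keys p. mconst (lookup p e) * (\<Prod>v\<in>keys e. mvar v ^ lookup e v)) \<in>
        ring_gen (mconst ` K \<union> mvar ` V :: ('v, 'a) mpoly set)"
      using p by (intro g.sum_in g.mult_in g.prod_in g.power_in)
        (auto intro!: gen_incl imageI simp: mpoly_over_def subset_iff)
    then show "p \<in> ring_gen (mconst ` K \<union> mvar ` V)" using mpoly_eq_sum_monomials[of p] by simp
  qed
  show "ring_gen (mconst ` K \<union> mvar ` V) \<subseteq> (mpoly_over K V :: ('v, 'a) mpoly set)"
    using assms by (intro ring_gen_minimal usubring_mpoly_over)
      (auto intro: mconst_in_mpoly_over mvar_in_mpoly_over)
qed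

lemma mpoly_over_mono: "V \<subseteq> V' \<Longrightarrow> mpoly_over K V \<subseteq> mpoly_over K V'"
  by (auto simp: mpoly_over_def)

lemma ring_map_eq_on_mpoly_over:
  assumes "usubring K" "ring_map f" "ring_map g"
    "\<And>c. c \<in> K \<Longrightarrow> f (mconst c) = g (mconst c)" "\<And>v. v \<in> V \<Longrightarrow> f (mvar v) = g (mvar v)"
    "p \<in> mpoly_over K V"
  shows "f p = g p"
proof -
  have p: "p \<in> ring_gen (mconst ` K \<union> mvar ` V)"
    using assms(6) by (simp add: mpoly_over_eq_ring_gen[OF assms(1)])
  show ?thesis
    by (rule ring_map.ring_gen_fixed[OF assms(2) _ assms(3) p]) (use assms in auto)
qed

text \<open>The arguments at which both maps take values in \<open>D\<close> that agree modulo
  \<open>I\<close> form a subring, so constants and variables suffice.\<close>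

lemma ring_maps_congruent_on_mpoly_over:
  assumes K: "usubring K" and fg: "ring_map f" "ring_map g" and I: "uideal D I"
    and const: "\<And>c. c \<in> K \<Longrightarrow> f (mconst c) \<in> D \<and> g (mconst c) \<in> D \<and> f (mconst c) - g (mconst c) \<in> I"
    and var: "\<And>v. v \<in> V \<Longrightarrow> f (mvar v) \<in> D \<and> g (mvar v) \<in> D \<and> f (mvar v) - g (mvar v) \<in> I"
    and p: "p \<in> mpoly_over K V"
  shows "f p - g p \<in> I"
proof -
  interpret f: ring_map f by fact
  interpret g: ring_map g by fact
  interpret uideal D I by fact
  have "usubring {p. f p \<in> D \<and> g p \<in> D \<and> f p - g p \<in> I}" (is "usubring ?A")
  proof
    show "1 \<in> ?A" by (simp add: f.map_one g.map_one one_in ideal_zero)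
    fix x y assume xy: "x \<in> ?A" "y \<in> ?A"
    then have "(f x - g x) - (f y - g y) \<in> I" by (intro ideal_diff[of "f x - g x"]) auto
    then show "x - y \<in> ?A" using xy by (simp add: f.map_minus g.map_minus diff_in algebra_simps)
    have "(f x - g x) * f y + g x * (f y - g y) \<in> I"
      using xy by (intro ideal_add ideal_mult ideal_mult_right[of "f x - g x"]) auto
    then show "x * y \<in> ?A" using xy by (simp add: f.map_mult g.map_mult mult_in algebra_simps)
  qed
  then have "mpoly_over K V \<subseteq> ?A"
    unfolding mpoly_over_eq_ring_gen[OF K] using const var by (intro ring_gen_minimal) auto
  then show ?thesis using p by auto
qed

lemma mpoly_over_UNIV: "p \<in> mpoly_over UNIV UNIV"
  by (simp add: mpoly_over_def)

lemma usubring_UNIV: "usubring UNIV"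
  by standard auto

lemma ring_map_mpoly_ext:
  assumes "ring_map f" "ring_map g" "\<And>c. f (mconst c) = g (mconst c)" "\<And>v. f (mvar v) = g (mvar v)"
  shows "f p = g p"
  by (rule ring_map_eq_on_mpoly_over[OF usubring_UNIV assms(1,2) _ _ mpoly_over_UNIV]) (rule assms)+

lemma ring_map_mpoly_over_into:
  assumes "usubring K" "ring_map f" "usubring D"
    "\<And>c. c \<in> K \<Longrightarrow> f (mconst c) \<in> D" "\<And>v. v \<in> V \<Longrightarrow> f (mvar v) \<in> D" "p \<in> mpoly_over K V"
  shows "f p \<in> D"
proof -
  have "mpoly_over K V \<subseteq> {p. f p \<in> D}"
    unfolding mpoly_over_eq_ring_gen[OF assms(1)]
    using assms(4,5) by (intro ring_gen_minimal ring_map.usubring_vimage assms) auto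
  then show ?thesis using assms(6) by auto
qed

subsection \<open>Order of vanishing\<close>

definition part_degree :: "'v set \<Rightarrow> ('v \<Rightarrow>\<^sub>0 nat) \<Rightarrow> nat" where
  "part_degree W e = (\<Sum>v\<in>keys e \<inter> W. lookup e v)"

lemma part_degree_superset:
  "finite A \<Longrightarrow> keys e \<subseteq> A \<Longrightarrow> part_degree W e = (\<Sum>v\<in>A \<inter> W. lookup e v)"
  unfolding part_degree_def by (rule sum.mono_neutral_left) (auto simp: in_keys_iff)

lemma part_degree_add: "part_degree W (e + e') = part_degree W e + part_degree W e'"
proof -
  have "keys (e + e') \<subseteq> keys e \<union> keys e'" by (rule keys_add)
  then show ?thesis
    using part_degree_superset[of "keys e \<union> keys e'" e W]
      part_degree_superset[of "keys e \<union> keys e'" e' W]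
      part_degree_superset[of "keys e \<union> keys e'" "e + e'" W]
    by (simp add: lookup_add sum.distrib)
qed

text \<open>For polynomials over a ring this is the k-th power of the ideal generated by the
  variables in \<open>W\<close>, described by monomials.\<close>

definition order_ge :: "'v set \<Rightarrow> nat \<Rightarrow> ('v, 'a::zero) mpoly set" where
  "order_ge W k = {p. \<forall>e\<in>keys p. k \<le> part_degree W e}"

lemma order_ge_zero: "0 \<in> order_ge W k"
  by (simp add: order_ge_def)

lemma order_ge_0: "p \<in> order_ge W 0"
  by (simp add: order_ge_def)

lemma order_ge_add: "p \<in> order_ge W k \<Longrightarrow> q \<in> order_ge W k \<Longrightarrow> p + q \<in> order_ge W k"
  using keys_add[of p q] by (auto simp: order_ge_def)

lemma order_ge_antimono: "p \<in> order_ge W k \<Longrightarrow> j \<le> k \<Longrightarrow> p \<in> order_ge W j"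
  by (auto simp: order_ge_def)

lemma order_ge_mult:
  fixes p q :: "('v, 'a::comm_ring_1) mpoly"
  assumes "p \<in> order_ge W j" "q \<in> order_ge W k"
  shows "p * q \<in> order_ge W (j + k)"
  unfolding order_ge_def
proof safe
  fix e assume "e \<in> keys (p * q)"
  then obtain a b where "a \<in> keys p" "b \<in> keys q" "e = a + b"
    using subsetD[OF keys_mult[of p q], of e] by auto
  then show "j + k \<le> part_degree W e"
    using assms by (auto simp: order_ge_def part_degree_add add_mono)
qed

lemma order_ge_mvar: "v \<in> W \<Longrightarrow> (mvar v :: ('v, 'a::comm_ring_1) mpoly) \<in> order_ge W 1"
  by (simp add: order_ge_def mvar_def part_degree_def)

lemma uideal_order_ge: "uideal UNIV (order_ge W k :: ('v, 'a::comm_ring_1) mpoly set)"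
  by standard (auto simp: order_ge_zero intro: order_ge_add order_ge_mult[OF order_ge_0, simplified])

lemma order_ge_power: "p \<in> order_ge W k \<Longrightarrow> (p :: ('v, 'a::comm_ring_1) mpoly) ^ j \<in> order_ge W (j * k)"
  by (induction j) (auto simp: order_ge_0 intro: order_ge_mult)

lemma order_ge_1_iff:
  assumes "keys p \<subseteq> {e. keys e \<subseteq> W}"
  shows "p \<in> order_ge W 1 \<longleftrightarrow> lookup p 0 = 0"
proof -
  have "part_degree W e = 0 \<longleftrightarrow> e = 0" if "e \<in> keys p" for e
  proof -
    have "part_degree W e = (\<Sum>v\<in>keys e. lookup e v)"
      using that assms by (auto simp: part_degree_def Int_absorb2)
    then show ?thesis by (auto simp: in_keys_iff intro!: poly_mapping_eqI)
  qed
  then have "p \<in> order_ge W 1 \<longleftrightarrow> (\<forall>e\<in>keys p. e \<noteq> 0)"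
    by (simp add: order_ge_def Suc_le_eq flip: neq0_conv)
  also have "\<dots> \<longleftrightarrow> lookup p 0 = 0" by (auto simp: in_keys_iff)
  finally show ?thesis .
qed

text \<open>Pigeonhole: a monomial whose degree in \<open>W\<close> exceeds
  \<open>M * card W\<close> contains some variable of \<open>W\<close> to a power of at least
  \<open>M\<close>, and that power is mapped into \<open>I\<close>.\<close>

lemma high_order_in_ideal:
  assumes "ring_map h" "uideal D I" "p \<in> mpoly_over K V"
    and "\<And>c. c \<in> K \<Longrightarrow> h (mconst c) \<in> D" "\<And>v. v \<in> V \<Longrightarrow> h (mvar v) \<in> D"
    and W: "finite W" "\<And>v. v \<in> W \<Longrightarrow> h (mvar v) ^ M \<in> I"
    and p: "p \<in> order_ge W (Suc (M * card W))"
  shows "h p \<in> I"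
proof -
  interpret ring_map h by fact
  interpret uideal D I by fact
  have "h (mconst (lookup p e)) * (\<Prod>v\<in>keys e. h (mvar v) ^ lookup e v) \<in> I" if e: "e \<in> keys p" for e
  proof -
    have "\<exists>v\<in>keys e \<inter> W. M \<le> lookup e v"
    proof (rule ccontr)
      assume "\<not> (\<exists>v\<in>keys e \<inter> W. M \<le> lookup e v)"
      then have "part_degree W e \<le> (\<Sum>v\<in>keys e \<inter> W. M)"
        unfolding part_degree_def by (intro sum_mono) (auto simp: not_le less_imp_le)
      also have "\<dots> \<le> M * card W" using W(1) by (simp add: card_mono)
      finally show False using p e by (auto simp: order_ge_def)
    qed
    then obtain v where v: "v \<in> keys e" "v \<in> W" "M \<le> lookup e v" by auto
    have hD: "h (mvar u) \<in> D" if "u \<in> keys e" for u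
      using that e assms(3,5) by (auto simp: mpoly_over_def)
    have "h (mvar v) ^ lookup e v \<in> I" using v hD W(2) ideal_power_le by blast
    then have "(\<Prod>v\<in>keys e. h (mvar v) ^ lookup e v) \<in> I"
      using v hD by (intro ideal_prod[of _ v]) (auto intro: power_in)
    then show ?thesis using assms(3,4) by (auto simp: mpoly_over_def intro: ideal_mult)
  qed
  then have "h (\<Sum>e\<in>keys p. mconst (lookup p e) * (\<Prod>v\<in>keys e. mvar v ^ lookup e v)) \<in> I"
    by (auto simp: map_sum map_mult map_prod map_power intro: ideal_sum)
  then show ?thesis using mpoly_eq_sum_monomials[of p] by simp
qed

subsection \<open>Permuting variables\<close>

text \<open>\<open>map_key\<close> is contravariant and occurs twice, so the action is covariant:
  for bijective \<open>s\<close> the variable v goes to \<open>s v\<close>.\<close>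

definition perm_vars :: "('v \<Rightarrow> 'v) \<Rightarrow> ('v, 'a::zero) mpoly \<Rightarrow> ('v, 'a) mpoly" where
  "perm_vars s p = Poly_Mapping.map_key (Poly_Mapping.map_key s) p"

lemma symmetric_in_iff: "symmetric_in B p \<longleftrightarrow> (\<forall>s. s permutes B \<longrightarrow> perm_vars s p = p)"
  by (simp add: symmetric_in_def perm_vars_def)

context
  fixes s :: "'v \<Rightarrow> 'v"
  assumes bij_s: "bij s"
begin

lemma inj_s: "inj s" and inj_inv_s: "inj (Hilbert_Choice.inv s)" and s_inv: "s (Hilbert_Choice.inv s v) = v" "Hilbert_Choice.inv s (s v) = v"
  using bij_s bij_imp_bij_inv[OF bij_s] by (auto simp: bij_is_inj bij_is_surj surj_f_inv_f)

lemma map_key_inverse: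
  "Poly_Mapping.map_key s (Poly_Mapping.map_key (Hilbert_Choice.inv s) e) = e"
  "Poly_Mapping.map_key (Hilbert_Choice.inv s) (Poly_Mapping.map_key s e) = e"
  using inj_s inj_inv_s by (auto intro!: poly_mapping_eqI simp: map_key.rep_eq s_inv)

lemma inj_map_key: "inj (Poly_Mapping.map_key s :: ('v \<Rightarrow>\<^sub>0 'c::zero) \<Rightarrow> _)"
  by (metis injI map_key_inverse(2))

lemma perm_vars_single:
  "perm_vars s (Poly_Mapping.single e c) = Poly_Mapping.single (Poly_Mapping.map_key (Hilbert_Choice.inv s) e) c"
proof -
  have "(e = Poly_Mapping.map_key s e') = (Poly_Mapping.map_key (Hilbert_Choice.inv s) e = e')" for e'
    using map_key_inverse by metis
  then show ?thesis
    unfolding perm_vars_def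
    by (intro poly_mapping_eqI) (simp add: map_key.rep_eq[OF inj_map_key] lookup_single)
qed

lemma perm_vars_add: "perm_vars s (p + q) = perm_vars s p + perm_vars s (q :: ('v, 'a::comm_ring_1) mpoly)"
  unfolding perm_vars_def by (rule map_key_plus[OF inj_map_key])

lemma ring_map_perm_vars: "ring_map (perm_vars s :: ('v, 'a::comm_ring_1) mpoly \<Rightarrow> _)"
proof
  have "perm_vars s (Poly_Mapping.single 0 1) = (Poly_Mapping.single 0 1 :: ('v, 'a) mpoly)"
    by (simp only: perm_vars_single map_key_zero[OF inj_inv_s])
  then show "perm_vars s 1 = (1 :: ('v, 'a) mpoly)" by simp
  fix p q :: "('v, 'a) mpoly"
  show "perm_vars s (p + q) = perm_vars s p + perm_vars s q" by (rule perm_vars_add)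
  have zero: "perm_vars s 0 = (0 :: ('v, 'a) mpoly)"
    unfolding perm_vars_def by (rule map_key_zero[OF inj_map_key])
  have sum: "perm_vars s (sum f A) = (\<Sum>x\<in>A. perm_vars s (f x))" for f :: "'x \<Rightarrow> ('v, 'a) mpoly" and A
    by (induction A rule: infinite_finite_induct) (simp_all add: zero perm_vars_add)
  have single: "perm_vars s p = (\<Sum>e\<in>keys p. Poly_Mapping.single (Poly_Mapping.map_key (Hilbert_Choice.inv s) e) (lookup p e))"
    for p :: "('v, 'a) mpoly"
    using arg_cong[OF poly_mapping_sum_singles[of "keys p" p], of "perm_vars s"]
    by (simp add: sum perm_vars_single)
  show "perm_vars s (p * q) = perm_vars s p * perm_vars s q"
    unfolding poly_mapping_mult_singles[of p q] single[of p] single[of q]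
    by (simp add: sum perm_vars_single map_key_plus[OF inj_inv_s] sum_product mult_single)
qed

lemma perm_vars_mconst: "perm_vars s (mconst c) = mconst c"
  by (simp add: mconst_def perm_vars_single map_key_zero[OF inj_inv_s])

lemma perm_vars_mvar: "perm_vars s (mvar v :: ('v, 'a::comm_ring_1) mpoly) = mvar (s v)"
  using map_key_single[OF inj_inv_s, of "s v" "1::nat"]
  by (simp add: mvar_def perm_vars_single s_inv)

end

lemma perm_vars_comp:
  assumes "bij s" "bij t"
  shows "perm_vars s (perm_vars t p) = perm_vars (s \<circ> t) (p :: ('v, 'a::comm_ring_1) mpoly)"
proof (rule ring_map_mpoly_ext[of "\<lambda>p. perm_vars s (perm_vars t p)"])
  show "ring_map (\<lambda>p :: ('v, 'a) mpoly. perm_vars s (perm_vars t p))"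
    using ring_map_comp[OF ring_map_perm_vars[OF assms(1)] ring_map_perm_vars[OF assms(2)]]
    by (simp add: comp_def)
  show "ring_map (perm_vars (s \<circ> t) :: ('v, 'a) mpoly \<Rightarrow> _)"
    using assms by (intro ring_map_perm_vars bij_comp)
  show "perm_vars s (perm_vars t (mconst c)) = (perm_vars (s \<circ> t) (mconst c) :: ('v, 'a) mpoly)" for c
    using assms by (simp add: perm_vars_mconst perm_vars_mconst[OF bij_comp[OF assms(2,1)]])
  show "perm_vars s (perm_vars t (mvar v)) = (perm_vars (s \<circ> t) (mvar v) :: ('v, 'a) mpoly)" for v
    using assms by (simp add: perm_vars_mvar perm_vars_mvar[OF bij_comp[OF assms(2,1)]])
qed

lemma perm_vars_mpoly_over:
  assumes "s permutes B" "B \<subseteq> V" "usubring K" "p \<in> mpoly_over K V"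
  shows "perm_vars s (p :: ('v, 'a::comm_ring_1) mpoly) \<in> mpoly_over K V"
proof -
  have s: "bij s" "s permutes V" using assms permutes_bij permutes_subset by blast+
  show ?thesis
  proof (rule ring_map_mpoly_over_into[OF assms(3) ring_map_perm_vars[OF s(1)] _ _ _ assms(4)])
    show "perm_vars s (mvar v) \<in> (mpoly_over K V :: ('v, 'a) mpoly set)" if "v \<in> V" for v
      using that s permutes_in_image[OF s(2)] assms(3)
      by (simp add: perm_vars_mvar mvar_in_mpoly_over)
  qed (use s assms in \<open>simp_all add: usubring_mpoly_over perm_vars_mconst mconst_in_mpoly_over\<close>)
qed

section \<open>Block-symmetric polynomials\<close>

text \<open>Its coefficients are, up to sign, the elementary symmetric polynomials in the variables
  of \<open>B\<close>. Working with them as coefficients replaces combinatorial identities by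
  polynomial division.\<close>

definition root_poly :: "'v set \<Rightarrow> ('v, 'a::comm_ring_1) mpoly poly" where
  "root_poly B = (\<Prod>b\<in>B. [:- mvar b, 1:])"

lemma (in ring_map) map_poly_linear: "map_poly h [:- c, 1:] = [:- h c, 1:]"
  by (rule poly_eqI) (simp add: coeff_pCons map_uminus map_one map_zero split: nat.split)

lemma map_root_poly:
  assumes "ring_map h"
  shows "map_poly h (root_poly B) = (\<Prod>b\<in>B. [:- h (mvar b), 1:])"
proof -
  interpret ring_map h by fact
  interpret mp: ring_map "map_poly h" by (rule ring_map_map_poly)
  show ?thesis by (simp add: root_poly_def mp.map_prod map_poly_linear)
qed

lemma monic_of_prod_linear:
  assumes "finite B"
  shows "monic_of (card B) (\<Prod>b\<in>B. [:- f b, 1:] :: 'a::comm_ring_1 poly)"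
  using assms
proof (induction B rule: finite_induct)
  case empty
  then show ?case by (simp add: monic_of_def coeff_1)
next
  case (insert b B)
  then show ?case by (auto simp: monic_of_def coeff_pCons split: nat.split)
qed

lemma monic_of_root_poly: "finite B \<Longrightarrow> monic_of (card B) (root_poly B)"
  unfolding root_poly_def by (rule monic_of_prod_linear)

lemma root_poly_insert:
  "finite B \<Longrightarrow> b \<notin> B \<Longrightarrow> root_poly (insert b B) = [:- mvar b, 1:] * root_poly B"
  by (simp add: root_poly_def)

text \<open>Comparison of coefficients in the product with the linear factor of \<open>b\<close>.
  Read downwards in \<open>k\<close>, it expresses the coefficients for \<open>B\<close> through
  \<open>mvar b\<close> and those for \<open>insert b B\<close>.\<close>

lemma coeff_root_poly_rec:
  assumes "finite B" "b \<notin> B"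
  shows "coeff (root_poly B) k =
    coeff (root_poly (insert b B)) (Suc k) + mvar b * coeff (root_poly B) (Suc k)"
  using assms by (simp add: root_poly_insert)

lemma poly_root_poly: "finite B \<Longrightarrow> b \<in> B \<Longrightarrow> poly (root_poly B) (mvar b) = 0"
  by (auto simp: root_poly_def poly_prod intro!: prod_zero)

text \<open>At the origin every linear factor becomes t.\<close>

lemma lookup_zero_coeff_root_poly:
  assumes "finite B"
  shows "lookup (coeff (root_poly B) k :: ('v, 'a::comm_ring_1) mpoly) 0 = (if k = card B then 1 else 0)"
proof -
  interpret ring_map "\<lambda>p :: ('v, 'a) mpoly. lookup p 0" by (rule ring_map_lookup_zero)
  have "map_poly (\<lambda>p. lookup p 0) (root_poly B :: ('v, 'a) mpoly poly) = Polynomial.monom 1 (card B)"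
    unfolding map_root_poly[OF ring_map_axioms] by (simp add: monom_altdef)
  from arg_cong[OF this, of "\<lambda>p. coeff p k"] show ?thesis by (simp add: eq_commute)
qed

lemma perm_root_poly:
  assumes "bij s"
  shows "map_poly (perm_vars s) (root_poly B) = root_poly (s ` B :: 'v set)"
proof -
  interpret ring_map "perm_vars s :: ('v, 'a::comm_ring_1) mpoly \<Rightarrow> _" by (rule ring_map_perm_vars[OF assms])
  have "inj_on s B" using assms by (auto simp: bij_def inj_on_def)
  then show ?thesis
    unfolding map_root_poly[OF ring_map_axioms] by (simp add: perm_vars_mvar[OF assms] root_poly_def prod.reindex)
qed

lemma perm_coeff_root_poly:
  assumes "s permutes A" "B \<subseteq> A \<and> A \<subseteq> B \<or> A \<inter> B = {}"
  shows "perm_vars s (coeff (root_poly B) k) = (coeff (root_poly B) k :: ('v, 'a::comm_ring_1) mpoly)"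
proof -
  have s: "bij s" using assms(1) by (rule permutes_bij)
  interpret ring_map "perm_vars s :: ('v, 'a) mpoly \<Rightarrow> _" by (rule ring_map_perm_vars[OF s])
  have "s ` B = B"
  proof (cases "A = B")
    case True
    then show ?thesis using assms(1) permutes_image by blast
  next
    case False
    then have "A \<inter> B = {}" using assms(2) by auto
    then have "s x = x" if "x \<in> B" for x using that assms(1) by (auto simp: permutes_def)
    then show ?thesis by (auto simp: image_iff)
  qed
  then have "map_poly (perm_vars s) (root_poly B) = (root_poly B :: ('v, 'a) mpoly poly)"
    by (simp add: perm_root_poly[OF s])
  then show ?thesis using coeff_map[of "root_poly B" k] by simp
qed

abbreviation root_coeffs :: "'v set \<Rightarrow> ('v, 'a::comm_ring_1) mpoly set" where
  "root_coeffs B \<equiv> {coeff (root_poly B) k | k. True}"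

lemma ring_gen_insert_eq_poly:
  assumes "x \<in> ring_gen (insert z E)" "usubring E"
  shows "\<exists>f\<in>cpoly E. x = poly f z"
proof -
  interpret E: usubring E by fact
  interpret c: usubring "cpoly E" by (rule E.usubring_cpoly)
  show ?thesis using assms(1)
  proof induction
    case gen_one
    show ?case using c.one_in by (intro bexI[of _ 1]) auto
  next
    case (gen_incl x)
    have "[:x:] \<in> cpoly E" if "x \<in> E"
      using that E.zero_in by (intro cpolyI) (simp add: coeff_pCons split: nat.split)
    moreover have "[:0, 1:] \<in> cpoly E"
      using E.zero_in E.one_in by (intro cpolyI) (simp add: coeff_pCons split: nat.split)
    ultimately show ?case
      using gen_incl by (auto intro: bexI[of _ "[:0, 1:]"] bexI[of _ "[:x:]"])
  next
    case (gen_diff x y)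
    then obtain f g where "f \<in> cpoly E" "g \<in> cpoly E" "x = poly f z" "y = poly g z" by auto
    then show ?case by (intro bexI[of _ "f - g"]) (auto intro: c.diff_in)
  next
    case (gen_mult x y)
    then obtain f g where "f \<in> cpoly E" "g \<in> cpoly E" "x = poly f z" "y = poly g z" by auto
    then show ?case by (intro bexI[of _ "f * g"]) (auto intro: c.mult_in)
  qed
qed

text \<open>Otherwise \<open>r - [:p:]\<close> would be a nonzero polynomial of degree below
  \<open>card Z\<close> with \<open>card Z\<close> roots. Since \<open>Z\<close> is nonempty,
  subtracting the constant does not raise the degree to \<open>card Z\<close>.\<close>

lemma poly_constant_of_many_roots:
  fixes r :: "'a::idom poly"
  assumes "\<And>i. i \<ge> card Z \<Longrightarrow> coeff r i = 0" "finite Z" "Z \<noteq> {}" "\<And>z. z \<in> Z \<Longrightarrow> poly r z = p"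
  shows "p = coeff r 0"
proof -
  have "r - [:p:] = 0"
  proof (rule ccontr)
    assume ne: "r - [:p:] \<noteq> 0"
    have "Z \<subseteq> {x. poly (r - [:p:]) x = 0}" using assms(4) by auto
    then have "card Z \<le> degree (r - [:p:])"
      using ne card_mono[OF poly_roots_finite[OF ne]] card_poly_roots_bound[OF ne] le_trans by blast
    moreover have "degree (r - [:p:]) < card Z"
    proof -
      have "coeff (r - [:p:]) i = 0" if "i \<ge> card Z" for i
        using that assms(1-3) by (cases i) (auto simp: coeff_pCons)
      then show ?thesis
        using ne by (metis leading_coeff_0_iff not_le)
    qed
    ultimately show False by simp
  qed
  then show ?thesis by (metis coeff_pCons_0 eq_iff_diff_eq_0)
qed

text \<open>Writing \<open>p\<close> as a polynomial \<open>r\<close> of degree less than \<open>card B\<close> in one variable of the block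
  with symmetric coefficients, all variables of the block are roots of \<open>r - p\<close>, so \<open>r\<close> is constant.\<close>

lemma symmetric_in_ring_gen_root_coeffs:
  fixes p :: "('v::linorder, 'a::idom) mpoly"
  assumes "finite B" "p \<in> ring_gen (C \<union> mvar ` B)"
    and "\<And>s c. s permutes B \<Longrightarrow> c \<in> C \<Longrightarrow> perm_vars s c = c"
    and "\<And>s. s permutes B \<Longrightarrow> perm_vars s p = p"
  shows "p \<in> ring_gen (C \<union> root_coeffs B)"
  using assms
proof (induction B arbitrary: C p rule: finite_induct)
  case empty
  then show ?case using ring_gen_mono[of "C \<union> mvar ` {}" "C \<union> root_coeffs {}"] by auto
next
  case (insert b B)
  define Q where "Q = (root_poly (insert b B) :: ('v, 'a) mpoly poly)"
  define E where "E = ring_gen (C \<union> root_coeffs (insert b B))"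
  define E' where "E' = ring_gen (insert (mvar b) E)"
  interpret E: usubring E unfolding E_def by (rule usubring_ring_gen)
  interpret E': usubring E' unfolding E'_def by (rule usubring_ring_gen)
  have bE': "mvar b \<in> E'" and EE': "E \<subseteq> E'" by (auto simp: E'_def intro: gen_incl)
  have CE: "C \<subseteq> E" and QE: "coeff Q k \<in> E" for k by (auto simp: E_def Q_def intro: gen_incl)
  \<comment> \<open>The induction hypothesis is used with \<open>mvar b\<close> adjoined to the
    constants, which is legitimate because permutations of \<open>B\<close> fix
    \<open>b\<close>.\<close>
  have "p \<in> ring_gen (ring_gen (insert (mvar b) C) \<union> root_coeffs B)"
  proof (rule insert.IH)
    have "C \<union> mvar ` insert b B \<subseteq> ring_gen (insert (mvar b) C) \<union> mvar ` B"
      by (auto intro: gen_incl)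
    then show "p \<in> ring_gen (ring_gen (insert (mvar b) C) \<union> mvar ` B)"
      using ring_gen_mono insert.prems(1) by blast
  next
    fix s c assume s: "s permutes B" and c: "c \<in> ring_gen (insert (mvar b) C)"
    have s': "s permutes insert b B" using s permutes_subset by blast
    have "s b = b" using s insert.hyps by (auto simp: permutes_def)
    then show "perm_vars s c = c"
      using insert.prems(2)[OF s'] permutes_bij[OF s]
      by (intro ring_map.ring_gen_fixed[OF ring_map_perm_vars _ ring_map_id c])
        (auto simp: perm_vars_mvar)
  next
    show "perm_vars s p = p" if "s permutes B" for s
      using that permutes_subset[of s B "insert b B"] insert.prems(3) by blast
  qed
  moreover have "root_coeffs B \<subseteq> E'"
  proof -
    \<comment> \<open>Descending induction on \<open>k\<close> along
      \<open>coeff_root_poly_rec\<close>, starting above the degree.\<close>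
    have "coeff (root_poly B) k \<in> E'" for k
    proof (induction "Suc (degree (root_poly B :: ('v, 'a) mpoly poly)) - k" arbitrary: k rule: less_induct)
      case less
      show ?case
      proof (cases "k > degree (root_poly B :: ('v, 'a) mpoly poly)")
        case True
        then show ?thesis by (simp add: coeff_eq_0 E'.zero_in)
      next
        case False
        then have "coeff (root_poly B) (Suc k) \<in> E'" using less by simp
        then show ?thesis
          using QE[of "Suc k"] EE' bE' unfolding Q_def
          by (subst coeff_root_poly_rec[OF insert.hyps]) (auto intro!: E'.add_in E'.mult_in)
      qed
    qed
    then show ?thesis by auto
  qed
  moreover have "ring_gen (insert (mvar b) C) \<subseteq> E'"
    using CE EE' bE' by (intro ring_gen_minimal E'.usubring_axioms) auto
  ultimately have "p \<in> E'"
    using ring_gen_minimal[OF E'.usubring_axioms] by blast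
  then obtain f where f: "f \<in> cpoly E" "p = poly f (mvar b)"
    using ring_gen_insert_eq_poly[OF _ E.usubring_axioms] E'_def by blast
  have fin: "finite (insert b B)" using insert.hyps by simp
  have "Q \<in> cpoly E" using QE by (rule cpolyI)
  then obtain g r where gr: "r \<in> cpoly E" "f = Q * g + r" "\<forall>i\<ge>card (insert b B). coeff r i = 0"
    using E.monic_division[of "card (insert b B)" Q f] monic_of_root_poly[OF fin] f(1)
    unfolding Q_def by blast
  then have pr: "p = poly r (mvar b)" using f(2) by (simp add: Q_def poly_root_poly[OF fin])
  have roots: "poly r (mvar c) = p" if c: "c \<in> insert b B" for c
  proof -
    \<comment> \<open>The transposition fixes \<open>p\<close> and the coefficients of
      \<open>r\<close>, so it carries \<open>p = poly r (mvar b)\<close> to the same equation at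
      \<open>c\<close>.\<close>
    define s where "s = transpose b c"
    have s: "s permutes insert b B" unfolding s_def using c by (intro permutes_swap_id) auto
    interpret ring_map "perm_vars s :: ('v, 'a) mpoly \<Rightarrow> _"
      by (rule ring_map_perm_vars[OF permutes_bij[OF s]])
    have fixed: "perm_vars s x = x" if "x \<in> E" for x
      using that unfolding E_def
      by (rule ring_gen_fixed[OF _ ring_map_id, rotated])
        (auto simp: insert.prems(2)[OF s] intro: perm_coeff_root_poly[OF s])
    have "perm_vars s (poly r x) = poly r (perm_vars s x)" for x
      using gr(1) by (simp add: poly_altdef map_sum map_mult map_power fixed cpolyD)
    then have "perm_vars s p = poly r (mvar (s b))"
      unfolding pr by (simp add: perm_vars_mvar[OF permutes_bij[OF s]])
    then show ?thesis using insert.prems(3)[OF s] by (simp add: s_def)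
  qed
  have inj: "inj_on (mvar :: 'v \<Rightarrow> ('v, 'a) mpoly) (insert b B)"
    by (intro inj_onI) (metis mvar_def keys_single one_neq_zero singleton_inject)
  have "p = coeff r 0"
    using gr(3) fin roots card_image[OF inj]
    by (intro poly_constant_of_many_roots[of "mvar ` insert b B"]) auto
  then show ?case using gr(1) cpolyD E_def by metis
qed

text \<open>One block at a time: the permutations of a block fix both the variables and the root
  coefficients of all other blocks, which can therefore be counted among the constants
  \<open>C\<close>.\<close>

lemma block_symmetric_in_ring_gen:
  fixes p :: "('v::linorder, 'a::idom) mpoly"
  assumes "finite J" "\<And>i. i \<in> J \<Longrightarrow> finite (B i)" "disjoint_family_on B J"
    and "p \<in> ring_gen (C \<union> mvar ` (\<Union>i\<in>J. B i))"
    and "\<And>i s c. i \<in> J \<Longrightarrow> s permutes B i \<Longrightarrow> c \<in> C \<Longrightarrow> perm_vars s c = c"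
    and "\<And>i s. i \<in> J \<Longrightarrow> s permutes B i \<Longrightarrow> perm_vars s p = p"
  shows "p \<in> ring_gen (C \<union> (\<Union>i\<in>J. root_coeffs (B i)))"
  using assms
proof (induction J arbitrary: C rule: finite_induct)
  case (insert i J)
  have disj: "B i \<inter> B j = {}" if "j \<in> J" for j
    using insert.prems(2) insert.hyps that by (auto simp: disjoint_family_on_def)
  have "p \<in> ring_gen ((C \<union> mvar ` B i) \<union> (\<Union>i\<in>J. root_coeffs (B i)))"
  proof (rule insert.IH)
    show "disjoint_family_on B J" using insert.prems(2) by (auto simp: disjoint_family_on_def)
    have "C \<union> mvar ` (\<Union> (B ` insert i J)) = C \<union> mvar ` B i \<union> mvar ` (\<Union> (B ` J))" by auto
    then show "p \<in> ring_gen (C \<union> mvar ` B i \<union> mvar ` (\<Union> (B ` J)))" using insert.prems(3) by simp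
    show "perm_vars s c = c" if "j \<in> J" "s permutes B j" "c \<in> C \<union> mvar ` B i" for j s c
    proof -
      have "s x = x" if "x \<in> B i" for x
        using disj[OF \<open>j \<in> J\<close>] that \<open>s permutes B j\<close> by (auto simp: permutes_def)
      then show ?thesis
        using that insert.prems(4) by (auto simp: perm_vars_mvar[OF permutes_bij])
    qed
    show "perm_vars s p = p" if "j \<in> J" "s permutes B j" for j s
      using that insert.prems(5) by blast
  qed (use insert.prems(1) in auto)
  then have "p \<in> ring_gen ((C \<union> (\<Union>i\<in>J. root_coeffs (B i))) \<union> mvar ` B i)"
    by (simp add: ac_simps)
  then have "p \<in> ring_gen ((C \<union> (\<Union>i\<in>J. root_coeffs (B i))) \<union> root_coeffs (B i))"
  proof (rule symmetric_in_ring_gen_root_coeffs[rotated])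
    show "perm_vars s c = c" if s: "s permutes B i" and c: "c \<in> C \<union> (\<Union>i\<in>J. root_coeffs (B i))" for s c
    proof (cases "c \<in> C")
      case True
      then show ?thesis using s insert.prems(4) by blast
    next
      case False
      then obtain j k where "j \<in> J" "c = coeff (root_poly (B j)) k" using c by auto
      then show ?thesis using perm_coeff_root_poly[OF s disjI2[OF disj]] by simp
    qed
    show "perm_vars s p = p" if "s permutes B i" for s
      using that insert.prems(5) by blast
  qed (use insert.prems(1) in auto)
  moreover have "(C \<union> (\<Union>i\<in>J. root_coeffs (B i))) \<union> root_coeffs (B i) =
      C \<union> (\<Union>i\<in>insert i J. root_coeffs (B i))" by auto
  ultimately show ?case by simp
qed simp

subsection \<open>Averaging over permutations\<close>

text \<open>The sum is not normalized, so that it makes sense over any commutative ring; division by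
  the factorial is deferred to \<open>block_symmetric_coefficients\<close>.\<close>

definition reynolds :: "'v set \<Rightarrow> ('v, 'a::comm_ring_1) mpoly \<Rightarrow> ('v, 'a) mpoly" where
  "reynolds B p = (\<Sum>s | s permutes B. perm_vars s p)"

lemma perm_reynolds:
  assumes "finite B" "t permutes B"
  shows "perm_vars t (reynolds B p) = reynolds B (p :: ('v, 'a::comm_ring_1) mpoly)"
proof -
  interpret ring_map "perm_vars t :: ('v, 'a) mpoly \<Rightarrow> _"
    by (rule ring_map_perm_vars[OF permutes_bij[OF assms(2)]])
  have "perm_vars t (reynolds B p) = (\<Sum>s | s permutes B. perm_vars (t \<circ> s) p)"
    unfolding reynolds_def map_sum
    by (intro sum.cong) (auto simp: perm_vars_comp[OF permutes_bij[OF assms(2)] permutes_bij])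
  also have "\<dots> = reynolds B p"
    unfolding reynolds_def by (rule setum_permutations_compose_left[OF assms(2), symmetric])
  finally show ?thesis .
qed

text \<open>Permutations of disjoint sets commute, so averaging over one block preserves the
  symmetry already achieved in another.\<close>

lemma perm_reynolds_disjoint:
  assumes "A \<inter> B = {}" "t permutes A" "perm_vars t p = p"
  shows "perm_vars t (reynolds B p) = reynolds B (p :: ('v, 'a::comm_ring_1) mpoly)"
proof -
  interpret ring_map "perm_vars t :: ('v, 'a) mpoly \<Rightarrow> _"
    by (rule ring_map_perm_vars[OF permutes_bij[OF assms(2)]])
  have "perm_vars t (perm_vars s p) = perm_vars s p" if s: "s permutes B" for s
  proof -
    have "t \<circ> s = s \<circ> t"
    proof
      fix x
      show "(t \<circ> s) x = (s \<circ> t) x"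
      proof (cases "x \<in> A")
        case True
        then have "s x = x" "s (t x) = t x"
          using assms(1) s permutes_in_image[OF assms(2)] by (auto simp: permutes_def)
        then show ?thesis by simp
      next
        case False
        then have "t x = x" "t (s x) = s x"
          using assms(1,2) s permutes_in_image[OF s] by (auto simp: permutes_def) (metis disjoint_iff)+
        then show ?thesis by simp
      qed
    qed
    then show ?thesis
      using perm_vars_comp[OF permutes_bij[OF assms(2)] permutes_bij[OF s], of p]
        perm_vars_comp[OF permutes_bij[OF s] permutes_bij[OF assms(2)], of p] assms(3) by simp
  qed
  then show ?thesis by (simp add: reynolds_def map_sum)
qed

lemma reynolds_mult:
  assumes "\<And>s. s permutes B \<Longrightarrow> perm_vars s g = g"
  shows "reynolds B (h * g) = reynolds B h * (g :: ('v, 'a::comm_ring_1) mpoly)"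
  unfolding reynolds_def sum_distrib_right
  by (intro sum.cong) (auto simp: assms ring_map.map_mult[OF ring_map_perm_vars[OF permutes_bij]])

lemma reynolds_sum: "reynolds B (sum f A) = (\<Sum>x\<in>A. reynolds B (f x :: ('v, 'a::comm_ring_1) mpoly))"
  unfolding reynolds_def
  by (subst sum.swap) (intro sum.cong; simp add: ring_map.map_sum[OF ring_map_perm_vars[OF permutes_bij]])

lemma reynolds_fixed:
  assumes "\<And>s. s permutes B \<Longrightarrow> perm_vars s p = p" "finite B"
  shows "reynolds B p = mconst (of_nat (fact (card B))) * (p :: ('v, 'a::comm_ring_1) mpoly)"
proof -
  have "reynolds B p = (\<Sum>s | s permutes B. p)"
    unfolding reynolds_def by (intro sum.cong) (auto simp: assms)
  also have "\<dots> = of_nat (fact (card B)) * p"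
    using card_permutations[OF refl assms(2)] by simp
  also have "of_nat (fact (card B)) = (mconst (of_nat (fact (card B))) :: ('v, 'a) mpoly)"
    by (simp add: mconst_def)
  finally show ?thesis .
qed

text \<open>Averaging is linear over invariants: applied to the relation it fixes \<open>p\<close>
  and every \<open>E k\<close> and makes the coefficients invariant. It is carried out block by
  block, and dividing by the factorial of the block size is where characteristic zero
  enters.\<close>

lemma block_symmetric_coefficients:
  fixes p :: "('v, 'a::field) mpoly"
  assumes K: "usubring K" "\<And>d :: nat. d > 0 \<Longrightarrow> (of_nat d :: 'a) \<noteq> 0"
      "\<And>d :: nat. inverse (of_nat d) \<in> K"
    and J: "finite J" "\<And>i. i \<in> J \<Longrightarrow> finite (B i)" "disjoint_family_on B J"
      "\<And>i. i \<in> J \<Longrightarrow> B i \<subseteq> V"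
    and sym: "\<And>i s. i \<in> J \<Longrightarrow> s permutes B i \<Longrightarrow> perm_vars s p = p"
      "\<And>i s k. i \<in> J \<Longrightarrow> s permutes B i \<Longrightarrow> k \<in> A \<Longrightarrow> perm_vars s (E k) = E k"
    and p: "p = (\<Sum>k\<in>A. h k * E k)" "\<And>k. k \<in> A \<Longrightarrow> h k \<in> mpoly_over K V"
  shows "\<exists>h. p = (\<Sum>k\<in>A. h k * E k) \<and> (\<forall>k\<in>A. h k \<in> mpoly_over K V \<and>
           (\<forall>i\<in>J. \<forall>s. s permutes B i \<longrightarrow> perm_vars s (h k) = h k))"
  using J sym
proof (induction J rule: finite_induct)
  case empty
  then show ?case using p by auto
next
  case (insert i J)
  have disj: "B j \<inter> B i = {}" if "j \<in> J" for j
    using insert.prems(2) insert.hyps that by (auto simp: disjoint_family_on_def)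
  have fin: "finite (B i)" "B i \<subseteq> V" using insert.prems by auto
  obtain h where h: "p = (\<Sum>k\<in>A. h k * E k)" "\<forall>k\<in>A. h k \<in> mpoly_over K V"
      "\<forall>k\<in>A. \<forall>i\<in>J. \<forall>s. s permutes B i \<longrightarrow> perm_vars s (h k) = h k"
  proof -
    have "disjoint_family_on B J" using insert.prems(2) by (auto simp: disjoint_family_on_def)
    then have "\<exists>h. p = (\<Sum>k\<in>A. h k * E k) \<and> (\<forall>k\<in>A. h k \<in> mpoly_over K V \<and>
        (\<forall>i\<in>J. \<forall>s. s permutes B i \<longrightarrow> perm_vars s (h k) = h k))"
      by (rule insert.IH[rotated]) (use insert.prems in blast)+
    then show ?thesis using that by blast
  qed
  define c where "c = (of_nat (fact (card (B i))) :: 'a)"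
  have c: "c \<noteq> 0" unfolding c_def by (rule K(2)) simp
  have cK: "inverse c \<in> K" unfolding c_def by (rule K(3))
  define h' where "h' k = mconst (inverse c) * reynolds (B i) (h k)" for k
  interpret mc: ring_map "mconst :: 'a \<Rightarrow> ('v, 'a) mpoly" by (rule ring_map_mconst)
  interpret P: usubring "mpoly_over K V :: ('v, 'a) mpoly set" by (rule usubring_mpoly_over[OF K(1)])
  have cc: "mconst (inverse c) * mconst c = (1 :: ('v, 'a) mpoly)"
    using c by (simp flip: mc.map_mult mc.map_one)
  have "reynolds (B i) p = mconst c * p"
    unfolding c_def by (rule reynolds_fixed) (use insert.prems(4) fin in blast)+
  then have "mconst (inverse c) * reynolds (B i) p = p"
    using cc by (simp flip: mult.assoc)
  moreover have "reynolds (B i) p = (\<Sum>k\<in>A. reynolds (B i) (h k) * E k)"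
    unfolding h(1) reynolds_sum by (intro sum.cong) (auto intro: reynolds_mult insert.prems(5))
  ultimately have "p = (\<Sum>k\<in>A. h' k * E k)"
    by (simp add: h'_def sum_distrib_left mult.assoc)
  moreover have "h' k \<in> mpoly_over K V" if "k \<in> A" for k
    unfolding h'_def reynolds_def using that h(2) fin K cK
    by (auto intro!: P.mult_in P.sum_in perm_vars_mpoly_over mconst_in_mpoly_over)
  moreover have "perm_vars s (h' k) = h' k" if "k \<in> A" "j \<in> insert i J" "s permutes B j" for k j s
  proof -
    have "perm_vars s (reynolds (B i) (h k)) = reynolds (B i) (h k)"
    proof (cases "j = i")
      case True
      then show ?thesis using that fin by (auto intro: perm_reynolds)
    next
      case False
      then have "j \<in> J" using that by simp
      then show ?thesis using that(1,3) h(3) by (intro perm_reynolds_disjoint[OF disj]) auto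
    qed
    then show ?thesis
      unfolding h'_def
      by (simp add: ring_map.map_mult[OF ring_map_perm_vars] permutes_bij[OF that(3)] perm_vars_mconst)
  qed
  ultimately show ?case by blast
qed

subsection \<open>Algebraic independence of the coefficients of the block polynomials\<close>

definition generic_poly :: "('i \<Rightarrow> nat) \<Rightarrow> 'i \<Rightarrow> ('i \<times> nat, 'a::comm_ring_1) mpoly poly" where
  "generic_poly d i = Polynomial.monom 1 (d i) + (\<Sum>k<d i. Polynomial.monom (mvar (i, k)) k)"

lemma coeff_generic_poly:
  "coeff (generic_poly d i :: ('i \<times> nat, 'a::comm_ring_1) mpoly poly) k =
    (if k < d i then mvar (i, k) else if k = d i then 1 else 0)"
proof -
  have "coeff (\<Sum>k<d i. Polynomial.monom (mvar (i, k) :: ('i \<times> nat, 'a) mpoly) k) k =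
      (if k < d i then mvar (i, k) else 0)"
    by (simp add: coeff_sum)
  then show ?thesis by (simp add: generic_poly_def)
qed

lemma monic_of_generic_poly: "monic_of (d i) (generic_poly d i)"
  by (simp add: monic_of_def coeff_generic_poly)

definition block_subst :: "('i \<Rightarrow> 'v set) \<Rightarrow> ('i \<times> nat, 'a::comm_ring_1) mpoly \<Rightarrow> ('v, 'a) mpoly" where
  "block_subst B = meval mconst (\<lambda>(i, k). coeff (root_poly (B i)) k)"

lemma ring_map_block_subst: "ring_map (block_subst B)"
  unfolding block_subst_def by (rule ring_map.ring_map_meval[OF ring_map_mconst])

lemma block_subst_mconst [simp]: "block_subst B (mconst c) = mconst c"
  unfolding block_subst_def by (rule ring_map.meval_mconst[OF ring_map_mconst])

lemma block_subst_mvar [simp]: "block_subst B (mvar (i, k)) = coeff (root_poly (B i)) k"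
  unfolding block_subst_def by (subst ring_map.meval_mvar[OF ring_map_mconst]) simp

text \<open>The roots are indexed by \<open>B\<close> itself so that they can serve as values of the
  variables of a block.\<close>

lemma alg_closed_splits:
  fixes q :: "'a::alg_closed_field poly"
  assumes "finite B" "monic_of (card B) q"
  shows "\<exists>z. q = (\<Prod>b\<in>B. [:- z b, 1:])"
  using assms
proof (induction B arbitrary: q rule: finite_induct)
  case empty
  then have "q = 1" by (intro poly_eqI) (auto simp: monic_of_def coeff_1)
  then show ?case by simp
next
  case (insert b B)
  have "degree q = card (insert b B)"
    using insert.prems by (intro antisym degree_le le_degree) (auto simp: monic_of_def)
  then obtain x where "poly q x = 0"
    using alg_closed_imp_poly_has_root[of q] insert.hyps by auto
  then obtain r where r: "q = [:- x, 1:] * r" by (auto simp: poly_eq_0_iff_dvd dvd_def)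
  have q_r: "coeff q (Suc k) = coeff r k - x * coeff r (Suc k)" for k by (simp add: r)
  have high: "coeff r k = 0" if "k > card B" for k
    using that
  proof (induction "Suc (degree r) - k" arbitrary: k rule: less_induct)
    case less
    show ?case
    proof (cases "k > degree r")
      case False
      then have "coeff r (Suc k) = 0" using less by simp
      moreover have "coeff q (Suc k) = 0" using insert less.prems by (simp add: monic_of_def)
      ultimately show ?thesis using q_r[of k] by simp
    qed (simp add: coeff_eq_0)
  qed
  have "coeff r (card B) = 1"
    using q_r[of "card B"] high[of "Suc (card B)"] insert by (simp add: monic_of_def)
  then obtain z where z: "r = (\<Prod>b\<in>B. [:- z b, 1:])"
    using insert.IH[of r] high by (auto simp: monic_of_def)
  have "(\<Prod>c\<in>insert b B. [:- (z(b := x)) c, 1:]) = [:- x, 1:] * (\<Prod>c\<in>B. [:- (z(b := x)) c, 1:])"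
    using insert.hyps by simp
  also have "(\<Prod>c\<in>B. [:- (z(b := x)) c, 1:]) = r"
    unfolding z using insert.hyps by (intro prod.cong) auto
  finally show ?case using r by metis
qed

lemma ring_map_Fract: "ring_map (\<lambda>p. Fract p 1)"
  by standard (simp_all add: One_fract_def)

lemma ring_map_to_ac: "ring_map to_ac"
  by standard simp_all

text \<open>Over an algebraic closure of the field of fractions of \<open>K[a]\<close>, the generic polynomials split;
  sending the variables of each block to the roots is a left inverse of the substitution.\<close>

lemma block_subst_injective:
  fixes p :: "(nat \<times> nat, 'a::field) mpoly" and B :: "nat \<Rightarrow> 'v set"
  assumes B: "\<And>i. i \<in> J \<Longrightarrow> finite (B i)" "disjoint_family_on B J"
    and p: "p \<in> mpoly_over UNIV {(i, k). i \<in> J \<and> k < card (B i)}" "block_subst B p = 0"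
  shows "p = 0"
proof -
  define emb where "emb = to_ac \<circ> (\<lambda>p :: (nat \<times> nat, 'a) mpoly. Fract p 1)"
  interpret emb: ring_map emb
    unfolding emb_def by (rule ring_map_comp[OF ring_map_to_ac ring_map_Fract])
  let ?G = "generic_poly (\<lambda>i. card (B i)) :: nat \<Rightarrow> (nat \<times> nat, 'a) mpoly poly"
  have "\<forall>i\<in>J. \<exists>z. map_poly emb (?G i) = (\<Prod>b\<in>B i. [:- z b, 1:])"
    using B(1) by (intro ballI alg_closed_splits)
      (auto simp: monic_of_def coeff_generic_poly emb.map_one emb.map_zero)
  then obtain Z where Z: "\<And>i. i \<in> J \<Longrightarrow> map_poly emb (?G i) = (\<Prod>b\<in>B i. [:- Z i b, 1:])"
    by metis
  \<comment> \<open>Glues the root assignments of the single blocks into one substitution; the block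
    containing \<open>b\<close> is unique by disjointness.\<close>
  define z where "z b = Z (THE i. i \<in> J \<and> b \<in> B i) b" for b
  have z: "z b = Z i b" if "i \<in> J" "b \<in> B i" for i b
  proof -
    have "(THE i. i \<in> J \<and> b \<in> B i) = i"
      using that B(2) by (intro the_equality) (auto simp: disjoint_family_on_def)
    then show ?thesis by (simp add: z_def)
  qed
  have hm: "ring_map (emb \<circ> mconst)" by (rule ring_map_comp[OF emb.ring_map_axioms ring_map_mconst])
  define chi where "chi = meval (emb \<circ> mconst) z"
  interpret chi: ring_map chi unfolding chi_def by (rule ring_map.ring_map_meval[OF hm])
  have chi: "map_poly chi (root_poly (B i)) = map_poly emb (?G i)" if "i \<in> J" for i
    unfolding Z[OF that] map_root_poly[OF chi.ring_map_axioms]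
    by (intro prod.cong) (auto simp: z[OF that] chi_def ring_map.meval_mvar[OF hm])
  have "(chi \<circ> block_subst B) p = emb p"
  proof (rule ring_map_eq_on_mpoly_over[OF usubring_UNIV _ emb.ring_map_axioms _ _ p(1)])
    show "ring_map (chi \<circ> block_subst B)"
      by (rule ring_map_comp[OF chi.ring_map_axioms ring_map_block_subst])
    show "(chi \<circ> block_subst B) (mconst c) = emb (mconst c)" for c
      by (simp add: chi_def ring_map.meval_mconst[OF hm])
    show "(chi \<circ> block_subst B) (mvar v) = emb (mvar v)" if v: "v \<in> {(i, k). i \<in> J \<and> k < card (B i)}" for v
    proof -
      obtain i k where ik: "v = (i, k)" "i \<in> J" "k < card (B i)" using v by auto
      have "chi (coeff (root_poly (B i)) k) = emb (coeff (?G i) k)"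
        using chi[OF ik(2)] by (metis chi.coeff_map emb.coeff_map)
      then show ?thesis using ik by (simp add: coeff_generic_poly)
    qed
  qed
  then have "emb p = 0" using p(2) by (simp add: chi.map_zero)
  then show ?thesis by (simp add: emb_def Zero_fract_def eq_fract)
qed

section \<open>Quotients and localizations of subrings of a type\<close>

abbreviation subring_rec :: "'a::comm_ring_1 set \<Rightarrow> 'a ring" where
  "subring_rec D \<equiv> ring_of_type_algebra\<lparr>carrier := D\<rparr>"

lemma ring_of_type_algebra_simps [simp]:
  "x \<otimes>\<^bsub>ring_of_type_algebra\<^esub> y = x * y" "x \<oplus>\<^bsub>ring_of_type_algebra\<^esub> y = x + y"
  "\<one>\<^bsub>ring_of_type_algebra\<^esub> = 1" "\<zero>\<^bsub>ring_of_type_algebra\<^esub> = 0"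
  "carrier ring_of_type_algebra = UNIV"
  by (simp_all add: ring_of_type_algebra_def)

lemma (in usubring) cring_subring_rec: "cring (subring_rec D)"
  by (intro cringI abelian_groupI comm_monoidI)
    (auto simp: closed algebra_simps intro: exI[of _ "- _"] bexI[of _ "- _"])

text \<open>Connects set-based ideals with ideals of records, so that the ideals defined through
  \<open>genideal\<close> can be handled by the former.\<close>

lemma (in usubring) ideal_subring_rec_iff: "ideal I (subring_rec D) \<longleftrightarrow> uideal D I"
proof
  interpret R: cring "subring_rec D" by (rule cring_subring_rec)
  assume "ideal I (subring_rec D)"
  then interpret I: ideal I "subring_rec D" .
  show "uideal D I"
    using I.a_subset I.zero_closed I.a_closed I.I_l_closed by unfold_locales auto
next
  assume "uideal D I"
  then interpret uideal D I .
  interpret R: cring "subring_rec D" by (rule cring_subring_rec)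
  have inv: "inv\<^bsub>add_monoid (subring_rec D)\<^esub> x = - x" if "x \<in> I" for x
    unfolding a_inv_def[symmetric]
    by (rule R.minus_equality) (use ideal_sub[OF that] uminus_in in auto)
  show "ideal I (subring_rec D)"
  proof (rule idealI[OF R.ring_axioms])
    show "subgroup I (add_monoid (subring_rec D))"
    proof (rule subgroup.intro)
      show "inv\<^bsub>add_monoid (subring_rec D)\<^esub> x \<in> I" if "x \<in> I" for x
        using inv[OF that] ideal_uminus[OF that] by (simp only:)
    qed (auto simp: ideal_sub ideal_zero ideal_add)
  qed (auto intro: ideal_mult ideal_mult_right)
qed

lemma (in usubring) genideal_subring_rec:
  assumes "S \<subseteq> D"
  shows "uideal D (genideal (subring_rec D) S)" "S \<subseteq> genideal (subring_rec D) S"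
    "\<And>I. uideal D I \<Longrightarrow> S \<subseteq> I \<Longrightarrow> genideal (subring_rec D) S \<subseteq> I"
proof -
  interpret R: cring "subring_rec D" by (rule cring_subring_rec)
  show "uideal D (genideal (subring_rec D) S)"
    using R.genideal_ideal[of S] assms ideal_subring_rec_iff by simp
  show "S \<subseteq> genideal (subring_rec D) S" using R.genideal_self[of S] assms by simp
  show "uideal D I \<Longrightarrow> S \<subseteq> I \<Longrightarrow> genideal (subring_rec D) S \<subseteq> I" for I
    using R.genideal_minimal[of I S] ideal_subring_rec_iff by simp
qed

lemma (in uideal) ideal_subring_rec: "ideal I (subring_rec D)"
  using ideal_subring_rec_iff uideal_axioms by simp

abbreviation qclass :: "'a::comm_ring_1 set \<Rightarrow> 'a set \<Rightarrow> 'a \<Rightarrow> 'a set" where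
  "qclass D I x \<equiv> I +>\<^bsub>subring_rec D\<^esub> x"

context uideal
begin

lemma mem_qclass: "z \<in> qclass D I x \<longleftrightarrow> z - x \<in> I"
  by (auto simp: a_r_coset_def' intro!: bexI[of _ "z - x"])

lemma qclass_eq_iff: "qclass D I x = qclass D I y \<longleftrightarrow> x - y \<in> I"
proof
  assume "qclass D I x = qclass D I y"
  moreover have "x \<in> qclass D I x" using ideal_zero by (simp add: mem_qclass)
  ultimately show "x - y \<in> I" by (simp add: mem_qclass)
next
  assume *: "x - y \<in> I"
  have "z - x \<in> I \<longleftrightarrow> z - y \<in> I" for z
    using ideal_add[OF _ *, of "z - x"] ideal_diff[OF _ *, of "z - y"] by auto
  then show "qclass D I x = qclass D I y" by (simp add: set_eq_iff mem_qclass)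
qed

lemma quot_simps:
  "x \<in> D \<Longrightarrow> y \<in> D \<Longrightarrow> qclass D I x \<otimes>\<^bsub>subring_rec D Quot I\<^esub> qclass D I y = qclass D I (x * y)"
  "x \<in> D \<Longrightarrow> y \<in> D \<Longrightarrow> qclass D I x \<oplus>\<^bsub>subring_rec D Quot I\<^esub> qclass D I y = qclass D I (x + y)"
  "\<one>\<^bsub>subring_rec D Quot I\<^esub> = qclass D I 1"
  "\<zero>\<^bsub>subring_rec D Quot I\<^esub> = qclass D I 0"
proof -
  interpret J: ideal I "subring_rec D" by (rule ideal_subring_rec)
  show "x \<in> D \<Longrightarrow> y \<in> D \<Longrightarrow> qclass D I x \<otimes>\<^bsub>subring_rec D Quot I\<^esub> qclass D I y = qclass D I (x * y)"
    using J.rcoset_mult_add[of x y] by (simp add: FactRing_def)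
  show "x \<in> D \<Longrightarrow> y \<in> D \<Longrightarrow> qclass D I x \<oplus>\<^bsub>subring_rec D Quot I\<^esub> qclass D I y = qclass D I (x + y)"
    using J.a_rcos_sum[of x y] by (simp add: FactRing_def)
  show "\<one>\<^bsub>subring_rec D Quot I\<^esub> = qclass D I 1" by (simp add: FactRing_def)
  show "\<zero>\<^bsub>subring_rec D Quot I\<^esub> = qclass D I 0"
    by (auto simp: FactRing_def a_r_coset_def')
qed

lemma quot_carrier: "carrier (subring_rec D Quot I) = qclass D I ` D"
  by (auto simp: FactRing_def A_RCOSETS_def' a_r_coset_def')

text \<open>The image of \<open>B\<close> in the quotient, presented as a restricted carrier, which
  is the form in which \<open>A_lam\<close> is defined.\<close>

lemma cring_quot_subring:
  assumes "usubring B" "B \<subseteq> D"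
  shows "cring ((subring_rec D Quot I)\<lparr>carrier := qclass D I ` B\<rparr>)"
proof -
  interpret B: usubring B by fact
  have BD: "x \<in> B \<Longrightarrow> x \<in> D" for x using assms(2) by auto
  show ?thesis
    by (intro cringI abelian_groupI comm_monoidI)
      (auto simp: quot_simps B.closed BD algebra_simps intro!: imageI bexI[of _ "- _"] B.closed)
qed

end

section \<open>Localization of a quotient ring, in terms of representatives\<close>

lemma loc_frac_iff:
  "x \<in> loc_frac Q S a s \<longleftrightarrow> ((a, s), x) \<in> loc_rel Q S"
  by (simp add: loc_frac_def)

text \<open>The quotient of \<open>D\<close> by \<open>J\<close> is localized at the image of
  \<open>S\<close>. Every equality of fractions is reduced to membership in \<open>J\<close> of an
  element of \<open>D\<close>.\<close>

locale subring_localization = uideal D J for D J :: "'a::comm_ring_1 set" +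
  fixes S :: "'a set"
  assumes denoms_sub: "x \<in> S \<Longrightarrow> x \<in> D"
    and denoms_one: "1 \<in> S"
    and denoms_mult: "x \<in> S \<Longrightarrow> y \<in> S \<Longrightarrow> x * y \<in> S"
begin

definition frac :: "'a \<Rightarrow> 'a \<Rightarrow> ('a set \<times> 'a set) set" where
  "frac a s = loc_frac (subring_rec D Quot J) (qclass D J ` S) (qclass D J a) (qclass D J s)"

lemma loc_rel_qclass_iff:
  assumes "a \<in> D" "b \<in> D" "s \<in> S" "t \<in> S"
  shows "((qclass D J a, qclass D J s), (qclass D J b, qclass D J t)) \<in>
      loc_rel (subring_rec D Quot J) (qclass D J ` S) \<longleftrightarrow>
    (\<exists>u\<in>S. u * (a * t) - u * (b * s) \<in> J)"
proof -
  have "qclass D J u \<otimes>\<^bsub>subring_rec D Quot J\<^esub> (qclass D J a \<otimes>\<^bsub>subring_rec D Quot J\<^esub> qclass D J t) =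
      qclass D J u \<otimes>\<^bsub>subring_rec D Quot J\<^esub> (qclass D J b \<otimes>\<^bsub>subring_rec D Quot J\<^esub> qclass D J s) \<longleftrightarrow>
      u * (a * t) - u * (b * s) \<in> J" if "u \<in> S" for u
    using that assms denoms_sub by (simp only: quot_simps mult_in qclass_eq_iff)
  then show ?thesis
    using assms by (simp add: loc_rel_def quot_carrier)
qed

lemma loc_relE:
  assumes "(x, y) \<in> loc_rel (subring_rec D Quot J) (qclass D J ` S)"
  obtains a s b t where "a \<in> D" "b \<in> D" "s \<in> S" "t \<in> S"
    "x = (qclass D J a, qclass D J s)" "y = (qclass D J b, qclass D J t)"
    "\<exists>u\<in>S. u * (a * t) - u * (b * s) \<in> J"
proof -
  have "fst x \<in> qclass D J ` D" "fst y \<in> qclass D J ` D" "snd x \<in> qclass D J ` S" "snd y \<in> qclass D J ` S"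
    using assms unfolding loc_rel_def quot_carrier by auto
  then obtain a b s t where abst: "a \<in> D" "b \<in> D" "s \<in> S" "t \<in> S"
    "fst x = qclass D J a" "fst y = qclass D J b" "snd x = qclass D J s" "snd y = qclass D J t"
    by (elim imageE) metis
  then have xy: "x = (qclass D J a, qclass D J s)" "y = (qclass D J b, qclass D J t)"
    by (simp_all add: prod_eq_iff)
  show ?thesis
    by (rule that[OF abst(1-4) xy]) (use assms loc_rel_qclass_iff[OF abst(1-4)] xy in simp)
qed

text \<open>The middle denominator \<open>t\<close> may be a zero divisor modulo \<open>J\<close>,
  so it has to be absorbed in the multiplier \<open>u * v * t\<close>.\<close>

lemma fraction_eq_trans:
  assumes "a \<in> D" "b \<in> D" "c \<in> D" "s \<in> S" "t \<in> S" "r \<in> S"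
    and "\<exists>u\<in>S. u * (a * t) - u * (b * s) \<in> J" "\<exists>u\<in>S. u * (b * r) - u * (c * t) \<in> J"
  shows "\<exists>u\<in>S. u * (a * r) - u * (c * s) \<in> J"
proof -
  obtain u v where u: "u \<in> S" "u * (a * t) - u * (b * s) \<in> J"
    and v: "v \<in> S" "v * (b * r) - v * (c * t) \<in> J" using assms by blast
  have "v * r * (u * (a * t) - u * (b * s)) + u * s * (v * (b * r) - v * (c * t)) \<in> J"
    using assms u v denoms_sub by (intro ideal_add ideal_mult mult_in) auto
  moreover have "v * r * (u * (a * t) - u * (b * s)) + u * s * (v * (b * r) - v * (c * t)) =
      (u * v * t) * (a * r) - (u * v * t) * (c * s)" by (simp add: algebra_simps)
  ultimately show ?thesis using u v assms by (intro bexI[of _ "u * v * t"] denoms_mult) auto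
qed

lemma frac_eq_iff:
  assumes "a \<in> D" "b \<in> D" "s \<in> S" "t \<in> S"
  shows "frac a s = frac b t \<longleftrightarrow> (\<exists>u\<in>S. u * (a * t) - u * (b * s) \<in> J)"
proof
  assume "frac a s = frac b t"
  moreover have "(qclass D J b, qclass D J t) \<in> frac b t"
    using assms denoms_one ideal_zero
    by (auto simp: frac_def loc_frac_iff loc_rel_qclass_iff intro: bexI[of _ 1])
  ultimately have "(qclass D J b, qclass D J t) \<in> frac a s" by simp
  then show "\<exists>u\<in>S. u * (a * t) - u * (b * s) \<in> J"
    using assms by (simp add: frac_def loc_frac_iff loc_rel_qclass_iff)
next
  have sub: "frac b t \<subseteq> frac a s"
    if eq: "\<exists>u\<in>S. u * (a * t) - u * (b * s) \<in> J" and abst: "a \<in> D" "b \<in> D" "s \<in> S" "t \<in> S" for a b s t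
  proof
    fix x assume "x \<in> frac b t"
    then have "((qclass D J b, qclass D J t), x) \<in> loc_rel (subring_rec D Quot J) (qclass D J ` S)"
      by (simp add: frac_def loc_frac_iff)
    moreover from this obtain c r where x: "c \<in> D" "r \<in> S" "x = (qclass D J c, qclass D J r)"
      by (auto elim: loc_relE)
    ultimately have "\<exists>u\<in>S. u * (b * r) - u * (c * t) \<in> J" using abst loc_rel_qclass_iff by blast
    then have "\<exists>u\<in>S. u * (a * r) - u * (c * s) \<in> J"
      using fraction_eq_trans[of a b c s t r] eq abst x by blast
    then show "x \<in> frac a s" using x abst by (simp add: frac_def loc_frac_iff loc_rel_qclass_iff)
  qed
  assume eq: "\<exists>u\<in>S. u * (a * t) - u * (b * s) \<in> J"
  then obtain u where u: "u \<in> S" "u * (a * t) - u * (b * s) \<in> J" by blast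
  then have "u * (b * s) - u * (a * t) \<in> J" using ideal_uminus[OF u(2)] by simp
  then have "\<exists>u\<in>S. u * (b * s) - u * (a * t) \<in> J" using u by blast
  then show "frac a s = frac b t" using sub eq assms by (intro equalityI) blast+
qed

lemma mem_frac:
  assumes "a \<in> D" "s \<in> S" "x \<in> frac a s"
  obtains b t where "b \<in> D" "t \<in> S" "x = (qclass D J b, qclass D J t)"
    "\<exists>u\<in>S. u * (a * t) - u * (b * s) \<in> J"
proof -
  have x: "((qclass D J a, qclass D J s), x) \<in> loc_rel (subring_rec D Quot J) (qclass D J ` S)"
    using assms(3) by (simp add: frac_def loc_frac_iff)
  then obtain b t where bt: "b \<in> D" "t \<in> S" "x = (qclass D J b, qclass D J t)"
    by (auto elim: loc_relE)
  then show ?thesis using x assms that loc_rel_qclass_iff by blast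
qed

lemma frac_nonempty: "a \<in> D \<Longrightarrow> s \<in> S \<Longrightarrow> (qclass D J a, qclass D J s) \<in> frac a s"
  using denoms_one ideal_zero
  by (auto simp: frac_def loc_frac_iff loc_rel_qclass_iff intro: bexI[of _ 1])

abbreviation L where "L \<equiv> localization (subring_rec D Quot J) (qclass D J ` S)"

lemma loc_carrier: "carrier L = {frac a s | a s. a \<in> D \<and> s \<in> S}"
  by (auto simp: localization_def quotient_def quot_carrier frac_def loc_frac_def)

lemma loc_one: "\<one>\<^bsub>L\<^esub> = frac 1 1"
  by (simp add: localization_def frac_def quot_simps)

lemma loc_zero: "\<zero>\<^bsub>L\<^esub> = frac 0 1"
  by (simp add: localization_def frac_def quot_simps)

text \<open>The union in the definition collapses: any choice of representatives gives the same
  class, and the classes are nonempty.\<close>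

lemma loc_mult:
  assumes "a \<in> D" "b \<in> D" "s \<in> S" "t \<in> S"
  shows "frac a s \<otimes>\<^bsub>L\<^esub> frac b t = frac (a * b) (s * t)"
proof -
  let ?m = "\<lambda>x y. loc_frac (subring_rec D Quot J) (qclass D J ` S)
      (fst x \<otimes>\<^bsub>subring_rec D Quot J\<^esub> fst y) (snd x \<otimes>\<^bsub>subring_rec D Quot J\<^esub> snd y)"
  have "?m x y = frac (a * b) (s * t)" if xy: "x \<in> frac a s" "y \<in> frac b t" for x y
  proof -
    obtain a' s' where x: "a' \<in> D" "s' \<in> S" "x = (qclass D J a', qclass D J s')"
      "\<exists>u\<in>S. u * (a * s') - u * (a' * s) \<in> J" using mem_frac assms xy by metis
    then obtain u where u: "u \<in> S" "u * (a * s') - u * (a' * s) \<in> J" by blast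
    obtain b' t' where y: "b' \<in> D" "t' \<in> S" "y = (qclass D J b', qclass D J t')"
      "\<exists>u\<in>S. u * (b * t') - u * (b' * t) \<in> J" using mem_frac assms xy by metis
    then obtain v where v: "v \<in> S" "v * (b * t') - v * (b' * t) \<in> J" by blast
    have "v * b * t' * (u * (a * s') - u * (a' * s)) + u * a' * s * (v * (b * t') - v * (b' * t)) \<in> J"
      using assms x y u v denoms_sub by (intro ideal_add ideal_mult mult_in) auto
    moreover have "v * b * t' * (u * (a * s') - u * (a' * s)) + u * a' * s * (v * (b * t') - v * (b' * t)) =
      (u * v) * ((a * b) * (s' * t')) - (u * v) * ((a' * b') * (s * t))" by (simp add: algebra_simps)
    ultimately have "frac (a * b) (s * t) = frac (a' * b') (s' * t')"
      using assms x y u v by (subst frac_eq_iff) (auto intro: mult_in denoms_mult)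
    then show ?thesis using x y denoms_sub by (simp add: quot_simps frac_def)
  qed
  then have "(\<Union>x\<in>frac a s. \<Union>y\<in>frac b t. ?m x y) = frac (a * b) (s * t)"
    using frac_nonempty[OF assms(1,3)] frac_nonempty[OF assms(2,4)] by auto
  then show ?thesis by (simp add: localization_def)
qed

lemma loc_add:
  assumes "a \<in> D" "b \<in> D" "s \<in> S" "t \<in> S"
  shows "frac a s \<oplus>\<^bsub>L\<^esub> frac b t = frac (a * t + b * s) (s * t)"
proof -
  let ?m = "\<lambda>x y. loc_frac (subring_rec D Quot J) (qclass D J ` S)
      (fst x \<otimes>\<^bsub>subring_rec D Quot J\<^esub> snd y \<oplus>\<^bsub>subring_rec D Quot J\<^esub> fst y \<otimes>\<^bsub>subring_rec D Quot J\<^esub> snd x)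
      (snd x \<otimes>\<^bsub>subring_rec D Quot J\<^esub> snd y)"
  have "?m x y = frac (a * t + b * s) (s * t)" if xy: "x \<in> frac a s" "y \<in> frac b t" for x y
  proof -
    obtain a' s' where x: "a' \<in> D" "s' \<in> S" "x = (qclass D J a', qclass D J s')"
      "\<exists>u\<in>S. u * (a * s') - u * (a' * s) \<in> J" using mem_frac assms xy by metis
    then obtain u where u: "u \<in> S" "u * (a * s') - u * (a' * s) \<in> J" by blast
    obtain b' t' where y: "b' \<in> D" "t' \<in> S" "y = (qclass D J b', qclass D J t')"
      "\<exists>u\<in>S. u * (b * t') - u * (b' * t) \<in> J" using mem_frac assms xy by metis
    then obtain v where v: "v \<in> S" "v * (b * t') - v * (b' * t) \<in> J" by blast
    have "v * t * t' * (u * (a * s') - u * (a' * s)) + u * s * s' * (v * (b * t') - v * (b' * t)) \<in> J"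
      using assms x y u v denoms_sub by (intro ideal_add ideal_mult mult_in) auto
    moreover have "v * t * t' * (u * (a * s') - u * (a' * s)) + u * s * s' * (v * (b * t') - v * (b' * t)) =
      (u * v) * ((a * t + b * s) * (s' * t')) - (u * v) * ((a' * t' + b' * s') * (s * t))"
      by (simp add: algebra_simps)
    ultimately have "frac (a * t + b * s) (s * t) = frac (a' * t' + b' * s') (s' * t')"
      using assms x y u v denoms_sub by (subst frac_eq_iff) (auto intro!: add_in mult_in denoms_mult)
    then show ?thesis using x y denoms_sub by (simp add: quot_simps mult_in frac_def)
  qed
  then have "(\<Union>x\<in>frac a s. \<Union>y\<in>frac b t. ?m x y) = frac (a * t + b * s) (s * t)"
    using frac_nonempty[OF assms(1,3)] frac_nonempty[OF assms(2,4)] by auto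
  then show ?thesis by (simp add: localization_def)
qed

end

subsection \<open>Algebra isomorphisms given by a relation\<close>

lemma algebra_algebra_via:
  assumes "cring K" "cring A" "h \<in> ring_hom K A"
  shows "algebra K (algebra_via A h)"
proof -
  interpret K: cring K by fact
  interpret A: cring A by fact
  interpret h: ring_hom_cring K A h by (intro ring_hom_cring.intro ring_hom_cring_axioms.intro assms)
  have c: "cring (algebra_via A h)"
    by (intro cringI abelian_groupI comm_monoidI)
      (auto simp: algebra_via_def A.a_ac A.m_ac A.l_distr A.r_distr intro: A.add.m_assoc A.l_neg bexI[of _ "\<ominus>\<^bsub>A\<^esub> _"])
  show ?thesis
    by (rule algebraI[OF assms(1) c])
      (auto simp: algebra_via_def A.l_distr A.r_distr A.m_assoc)
qed

text \<open>The isomorphism is given by its graph, so no representatives have to be chosen. Only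
  \<open>B\<close> is assumed to be a ring with a structure homomorphism; the ring axioms for
  \<open>A\<close> and the homomorphism property of \<open>hA\<close> are transported along the
  inverse map \<open>g\<close>.\<close>

lemma algebra_isomorphic_of_relation:
  fixes A :: "'a ring" and B :: "'b ring" and rel :: "'a \<Rightarrow> 'b \<Rightarrow> bool"
  assumes K: "cring K" and B: "cring B" and hB: "hB \<in> ring_hom K B"
    and total: "\<And>x. x \<in> carrier A \<Longrightarrow> \<exists>y\<in>carrier B. rel x y"
    and surj: "\<And>y. y \<in> carrier B \<Longrightarrow> \<exists>x\<in>carrier A. rel x y"
    and inj: "\<And>x x' y y'. x \<in> carrier A \<Longrightarrow> x' \<in> carrier A \<Longrightarrow> y \<in> carrier B \<Longrightarrow> y' \<in> carrier B \<Longrightarrow>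
      rel x y \<Longrightarrow> rel x' y' \<Longrightarrow> x = x' \<longleftrightarrow> y = y'"
    and one: "\<one>\<^bsub>A\<^esub> \<in> carrier A" "rel \<one>\<^bsub>A\<^esub> \<one>\<^bsub>B\<^esub>"
    and zero: "\<zero>\<^bsub>A\<^esub> \<in> carrier A" "rel \<zero>\<^bsub>A\<^esub> \<zero>\<^bsub>B\<^esub>"
    and add: "\<And>x x' y y'. x \<in> carrier A \<Longrightarrow> x' \<in> carrier A \<Longrightarrow> y \<in> carrier B \<Longrightarrow> y' \<in> carrier B \<Longrightarrow>
      rel x y \<Longrightarrow> rel x' y' \<Longrightarrow> x \<oplus>\<^bsub>A\<^esub> x' \<in> carrier A \<and> rel (x \<oplus>\<^bsub>A\<^esub> x') (y \<oplus>\<^bsub>B\<^esub> y')"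
    and mult: "\<And>x x' y y'. x \<in> carrier A \<Longrightarrow> x' \<in> carrier A \<Longrightarrow> y \<in> carrier B \<Longrightarrow> y' \<in> carrier B \<Longrightarrow>
      rel x y \<Longrightarrow> rel x' y' \<Longrightarrow> x \<otimes>\<^bsub>A\<^esub> x' \<in> carrier A \<and> rel (x \<otimes>\<^bsub>A\<^esub> x') (y \<otimes>\<^bsub>B\<^esub> y')"
    and struct: "\<And>c. c \<in> carrier K \<Longrightarrow> hA c \<in> carrier A \<and> rel (hA c) (hB c)"
  shows "algebra_isomorphic K (algebra_via A hA) (algebra_via B hB)"
proof -
  interpret B: cring B by fact
  define f where "f x = (THE y. y \<in> carrier B \<and> rel x y)" for x
  define g where "g y = (THE x. x \<in> carrier A \<and> rel x y)" for y
  have f: "f x = y" if "x \<in> carrier A" "y \<in> carrier B" "rel x y" for x y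
    unfolding f_def using that inj by (intro the_equality) blast+
  have g: "g y = x" if "x \<in> carrier A" "y \<in> carrier B" "rel x y" for x y
    unfolding g_def using that inj by (intro the_equality) blast+
  have f_in: "f x \<in> carrier B" "rel x (f x)" if "x \<in> carrier A" for x
    using total[OF that] f[OF that] by auto
  have g_in: "g y \<in> carrier A" "rel (g y) y" if "y \<in> carrier B" for y
    using surj[OF that] g[OF _ that] by auto
  have fg: "f (g y) = y" if "y \<in> carrier B" for y
    using f[OF g_in(1) that g_in(2)] that by simp
  have gf: "g (f x) = x" if "x \<in> carrier A" for x
    using g[OF that f_in(1) f_in(2)] that by simp
  have bij_g: "bij_betw g (carrier B) (carrier A)"
    by (rule bij_betw_byWitness[of _ f]) (simp_all add: fg gf f_in g_in image_subset_iff)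
  have bij_f: "bij_betw f (carrier A) (carrier B)"
    by (rule bij_betw_byWitness[of _ g]) (simp_all add: fg gf f_in g_in image_subset_iff)
  have iso_g: "g \<in> ring_iso B A"
  proof (rule ring_iso_memI)
    show "g (x \<otimes>\<^bsub>B\<^esub> y) = g x \<otimes>\<^bsub>A\<^esub> g y" if "x \<in> carrier B" "y \<in> carrier B" for x y
      using mult[OF g_in(1)[OF that(1)] g_in(1)[OF that(2)] that g_in(2)[OF that(1)] g_in(2)[OF that(2)]] that
      by (intro g) simp_all
    show "g (x \<oplus>\<^bsub>B\<^esub> y) = g x \<oplus>\<^bsub>A\<^esub> g y" if "x \<in> carrier B" "y \<in> carrier B" for x y
      using add[OF g_in(1)[OF that(1)] g_in(1)[OF that(2)] that g_in(2)[OF that(1)] g_in(2)[OF that(2)]] that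
      by (intro g) simp_all
    show "g \<one>\<^bsub>B\<^esub> = \<one>\<^bsub>A\<^esub>" using g[OF one(1) B.one_closed one(2)] .
  qed (simp_all add: g_in bij_g)
  \<comment> \<open>Transport along \<open>g\<close> yields ring axioms for \<open>A\<close> with
    its zero replaced by the image of zero, so the two have to be identified.\<close>
  have g_zero: "g \<zero>\<^bsub>B\<^esub> = \<zero>\<^bsub>A\<^esub>" using g[OF zero(1) B.zero_closed zero(2)] .
  have A: "cring A" using B.ring_iso_imp_img_cring[OF iso_g] by (simp add: g_zero)
  have hB_in: "hB c \<in> carrier B" if "c \<in> carrier K" for c
    using ring_hom_closed[OF hB that] .
  have hA: "hA c = g (hB c)" if "c \<in> carrier K" for c
    using g[of "hA c" "hB c"] struct[OF that] hB_in[OF that] by simp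
  interpret K: cring K by fact
  have hA_hom: "hA \<in> ring_hom K A"
    by (intro ring_hom_memI)
      (simp_all add: hA hB_in ring_hom_mult[OF hB] ring_hom_add[OF hB] ring_hom_one[OF hB]
        ring_iso_memE[OF iso_g])
  have "f \<in> ring_iso (algebra_via A hA) (algebra_via B hB)"
  proof (rule ring_iso_memI)
    show "bij_betw f (carrier (algebra_via A hA)) (carrier (algebra_via B hB))"
      by (simp add: algebra_via_def bij_f)
    show "f (x \<otimes>\<^bsub>algebra_via A hA\<^esub> y) = f x \<otimes>\<^bsub>algebra_via B hB\<^esub> f y"
      if "x \<in> carrier (algebra_via A hA)" "y \<in> carrier (algebra_via A hA)" for x y
      using that mult[of x y "f x" "f y"] f[of "x \<otimes>\<^bsub>A\<^esub> y" "f x \<otimes>\<^bsub>B\<^esub> f y"]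
      by (simp add: algebra_via_def f_in)
    show "f (x \<oplus>\<^bsub>algebra_via A hA\<^esub> y) = f x \<oplus>\<^bsub>algebra_via B hB\<^esub> f y"
      if "x \<in> carrier (algebra_via A hA)" "y \<in> carrier (algebra_via A hA)" for x y
      using that add[of x y "f x" "f y"] f[of "x \<oplus>\<^bsub>A\<^esub> y" "f x \<oplus>\<^bsub>B\<^esub> f y"]
      by (simp add: algebra_via_def f_in)
    show "f \<one>\<^bsub>algebra_via A hA\<^esub> = \<one>\<^bsub>algebra_via B hB\<^esub>"
      using f[OF one(1) B.one_closed one(2)] by (simp add: algebra_via_def)
  qed (simp add: algebra_via_def f_in)
  moreover have "f (c \<odot>\<^bsub>algebra_via A hA\<^esub> x) = c \<odot>\<^bsub>algebra_via B hB\<^esub> f x"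
    if "c \<in> carrier K" "x \<in> carrier (algebra_via A hA)" for c x
    using that mult[of "hA c" x "hB c" "f x"] struct[of c] hB_in[of c] f_in[of x]
      f[of "hA c \<otimes>\<^bsub>A\<^esub> x" "hB c \<otimes>\<^bsub>B\<^esub> f x"]
    by (simp add: algebra_via_def)
  ultimately show ?thesis
    unfolding algebra_isomorphic_def
    using algebra_algebra_via[OF K A hA_hom] algebra_algebra_via[OF K B hB] by blast
qed

section \<open>The algebra of block-symmetric polynomials modulo the symmetric ones\<close>

text \<open>Characteristic zero is an assumption on the numerals of \<open>'f\<close>, in the form
  that is later verified for the field of fractions of the jet polynomials.\<close>

locale block_setting =
  fixes n l :: nat and lam :: "nat \<Rightarrow> nat" and K :: "'f::field set"
  assumes K_subring: "usubring K"
    and K_inverse: "c \<in> K \<Longrightarrow> inverse c \<in> K"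
    and char_zero: "d > 0 \<Longrightarrow> (of_nat d :: 'f) \<noteq> 0"
    and l_eq: "l = (\<Sum>i\<in>{1..n}. lam i)"
begin

sublocale K: usubring K by (rule K_subring)

definition block :: "nat \<Rightarrow> nat set" where
  "block i = {Lam lam i + 1..Lam lam (i + 1)}"

lemma Lam_Suc: "i \<ge> 1 \<Longrightarrow> Lam lam (Suc i) = Lam lam i + lam i"
  by (simp add: Lam_def)

lemma Lam_mono: "i \<le> j \<Longrightarrow> Lam lam i \<le> Lam lam j"
  unfolding Lam_def by (rule sum_mono2) auto

lemma card_block: "i \<ge> 1 \<Longrightarrow> card (block i) = lam i"
  by (simp add: block_def Lam_Suc)

lemma finite_block: "finite (block i)"
  by (simp add: block_def)

lemma disjoint_blocks: "disjoint_family_on block {1..n}"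
proof -
  have "block i \<inter> block j = {}" if "i < j" for i j
    using Lam_mono[of "Suc i" j] that by (auto simp: block_def)
  then show ?thesis unfolding disjoint_family_on_def by (metis Int_commute linorder_neqE_nat)
qed

lemma Union_blocks: "(\<Union>i\<in>{1..n}. block i) = {1..l}"
proof -
  have "(\<Union>i\<in>{1..N}. block i) = {1..Lam lam (N + 1)}" for N
  proof (induction N)
    case 0
    then show ?case by (simp add: Lam_def)
  next
    case (Suc N)
    have "{1..Suc N} = insert (Suc N) {1..N}" by auto
    then have "(\<Union>i\<in>{1..Suc N}. block i) = block (Suc N) \<union> {1..Lam lam (N + 1)}" using Suc by simp
    then show ?case using Lam_mono[of "Suc N" "Suc (Suc N)"] by (auto simp: block_def)
  qed
  moreover have "Lam lam (n + 1) = l" by (simp add: Lam_def l_eq atLeastLessThanSuc_atLeastAtMost)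
  ultimately show ?thesis by metis
qed

lemma block_subset: "i \<in> {1..n} \<Longrightarrow> block i \<subseteq> {1..l}"
  using Union_blocks by blast

definition P :: "(nat, 'f) mpoly set" where "P = mpoly_over K {1..l}"
definition D :: "(nat, 'f) mpoly set" where "D = {p \<in> P. lam_symmetric n lam p}"
definition SI :: "(nat, 'f) mpoly set" where "SI = sym_ideal K l"
definition low :: "(nat \<times> nat) set" where "low = {(i, k). i \<in> {1..n} \<and> k < lam i}"
definition Ka :: "(nat \<times> nat, 'f) mpoly set" where "Ka = mpoly_over K low"
definition G :: "nat \<Rightarrow> (nat \<times> nat, 'f) mpoly poly" where "G = generic_poly lam"
text \<open>For k at most \<open>l\<close>, up to sign, the elementary symmetric polynomial of
  degree \<open>l - k\<close> in all variables; \<open>Ec k\<close> below is its expression in the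
  block coefficients.\<close>

definition E :: "nat \<Rightarrow> (nat, 'f) mpoly" where "E k = coeff (root_poly {1..l}) k"
definition Ec :: "nat \<Rightarrow> (nat \<times> nat, 'f) mpoly" where "Ec k = coeff (\<Prod>i\<in>{1..n}. G i) k"
text \<open>The index \<open>l\<close> is left out because \<open>Ec l\<close> is the leading
  coefficient 1.\<close>

definition Ic :: "(nat \<times> nat, 'f) mpoly set" where "Ic = lin_span Ka {..<l} Ec"
definition e :: "(nat \<times> nat, 'f) mpoly \<Rightarrow> (nat, 'f) mpoly" where "e = block_subst block"

sublocale P: usubring P unfolding P_def by (rule usubring_mpoly_over[OF K_subring])
sublocale Ka: usubring Ka unfolding Ka_def by (rule usubring_mpoly_over[OF K_subring])
sublocale e: ring_map e unfolding e_def by (rule ring_map_block_subst)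

lemma mem_D_iff: "p \<in> D \<longleftrightarrow> p \<in> P \<and> (\<forall>i\<in>{1..n}. \<forall>s. s permutes block i \<longrightarrow> perm_vars s p = p)"
  by (simp add: D_def lam_symmetric_def symmetric_in_iff block_def)

sublocale D: usubring D
proof
  show "1 \<in> D"
    by (auto simp: mem_D_iff P.one_in ring_map.map_one[OF ring_map_perm_vars[OF permutes_bij]])
  show "x - y \<in> D" if "x \<in> D" "y \<in> D" for x y
    using that by (auto simp: mem_D_iff P.diff_in ring_map.map_minus[OF ring_map_perm_vars[OF permutes_bij]])
  show "x * y \<in> D" if "x \<in> D" "y \<in> D" for x y
    using that by (auto simp: mem_D_iff P.mult_in ring_map.map_mult[OF ring_map_perm_vars[OF permutes_bij]])
qed

lemma mconst_in_P: "c \<in> K \<Longrightarrow> mconst c \<in> P"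
  unfolding P_def by (rule mconst_in_mpoly_over[OF K_subring])

lemma mvar_in_P: "b \<in> {1..l} \<Longrightarrow> mvar b \<in> P"
  unfolding P_def by (rule mvar_in_mpoly_over[OF K_subring])

lemma mconst_in_D: "c \<in> K \<Longrightarrow> mconst c \<in> D"
  by (auto simp: mem_D_iff mconst_in_P perm_vars_mconst permutes_bij)

lemma mconst_in_Ka: "c \<in> K \<Longrightarrow> mconst c \<in> Ka"
  unfolding Ka_def by (rule mconst_in_mpoly_over[OF K_subring])

lemma mvar_in_Ka: "v \<in> low \<Longrightarrow> mvar v \<in> Ka"
  unfolding Ka_def by (rule mvar_in_mpoly_over[OF K_subring])

lemma root_poly_in_cpoly: "A \<subseteq> {1..l} \<Longrightarrow> root_poly A \<in> cpoly P"
proof -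
  interpret c: usubring "cpoly P" by (rule P.usubring_cpoly)
  have "[:- mvar b, 1:] \<in> cpoly P" if "b \<in> {1..l}" for b
    using mvar_in_P[OF that]
    by (intro cpolyI) (auto simp: coeff_pCons P.closed split: nat.split)
  then show "A \<subseteq> {1..l} \<Longrightarrow> root_poly A \<in> cpoly P"
    unfolding root_poly_def by (intro c.prod_in) auto
qed

lemma root_coeff_in_D: "i \<in> {1..n} \<Longrightarrow> coeff (root_poly (block i)) k \<in> D"
proof -
  assume i: "i \<in> {1..n}"
  have same: "block j = block i \<or> block j \<inter> block i = {}" if "j \<in> {1..n}" for j
    using disjoint_blocks i that by (cases "j = i") (auto simp: disjoint_family_on_def)
  then have "perm_vars s (coeff (root_poly (block i)) k) = (coeff (root_poly (block i)) k :: (nat, 'f) mpoly)"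
    if "j \<in> {1..n}" "s permutes block j" for j s
    using perm_coeff_root_poly[OF that(2), of "block i" k] same[OF that(1)]
    by auto
  then show ?thesis
    using cpolyD[OF root_poly_in_cpoly[OF block_subset[OF i]]] by (auto simp: mem_D_iff)
qed

lemma e_mconst [simp]: "e (mconst c) = mconst c"
  by (simp add: e_def)

lemma e_mvar [simp]: "e (mvar (i, k)) = coeff (root_poly (block i)) k"
  by (simp add: e_def)

lemma e_in_D: "p \<in> Ka \<Longrightarrow> e p \<in> D"
  unfolding Ka_def
  by (rule ring_map_mpoly_over_into[OF K_subring e.ring_map_axioms D.usubring_axioms])
    (auto simp: mconst_in_D low_def root_coeff_in_D)

lemma G_in_cpoly: "i \<in> {1..n} \<Longrightarrow> G i \<in> cpoly Ka"
  by (intro cpolyI) (auto simp: G_def coeff_generic_poly Ka.closed low_def intro!: mvar_in_Ka)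

lemma map_poly_e_G: "i \<in> {1..n} \<Longrightarrow> map_poly e (G i) = root_poly (block i)"
proof (rule poly_eqI)
  show "coeff (map_poly e (G i)) k = coeff (root_poly (block i)) k" if "i \<in> {1..n}" for k
    using monic_of_root_poly[OF finite_block, of i] that
    by (auto simp: G_def coeff_generic_poly e.map_one e.map_zero monic_of_def card_block)
qed

lemma D_eq_image: "D = e ` Ka"
proof
  show "e ` Ka \<subseteq> D" using e_in_D by auto
  show "D \<subseteq> e ` Ka"
  proof
    fix p assume p: "p \<in> D"
    have "p \<in> ring_gen (mconst ` K \<union> (\<Union>i\<in>{1..n}. root_coeffs (block i)))"
    proof (rule block_symmetric_in_ring_gen)
      show "p \<in> ring_gen (mconst ` K \<union> mvar ` (\<Union>i\<in>{1..n}. block i))"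
        using p unfolding Union_blocks by (simp add: mem_D_iff P_def mpoly_over_eq_ring_gen[OF K_subring])
    qed (use p disjoint_blocks finite_block in \<open>auto simp: mem_D_iff perm_vars_mconst permutes_bij\<close>)
    moreover have "ring_gen (mconst ` K \<union> (\<Union>i\<in>{1..n}. root_coeffs (block i))) \<subseteq> e ` Ka"
    proof (rule ring_gen_minimal)
      have Ka: "Ka = ring_gen (mconst ` K \<union> mvar ` low)"
        by (simp add: Ka_def mpoly_over_eq_ring_gen[OF K_subring])
      show "usubring (e ` Ka)"
        unfolding Ka e.ring_gen_image[symmetric] by (rule usubring_ring_gen)
      have "coeff (root_poly (block i)) k \<in> e ` Ka" if i: "i \<in> {1..n}" for i k
      proof -
        have "coeff (root_poly (block i)) k = e (coeff (G i) k)"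
          using e.coeff_map[of "G i" k] by (simp add: map_poly_e_G[OF i])
        then show ?thesis using cpolyD[OF G_in_cpoly[OF i], of k] by blast
      qed
      moreover have "mconst c \<in> e ` Ka" if "c \<in> K" for c
        using e_mconst[of c] mconst_in_Ka[OF that] by (metis imageI)
      ultimately show "mconst ` K \<union> (\<Union>i\<in>{1..n}. root_coeffs (block i)) \<subseteq> e ` Ka" by auto
    qed
    ultimately show "p \<in> e ` Ka" by auto
  qed
qed

text \<open>The blocks partition the variables, so the product of their root polynomials is the root
  polynomial of all variables.\<close>

lemma e_Ec: "e (Ec k) = E k"
proof -
  interpret mp: ring_map "map_poly e" by (rule e.ring_map_map_poly)
  have "map_poly e (\<Prod>i\<in>{1..n}. G i) = (\<Prod>i\<in>{1..n}. root_poly (block i))"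
    unfolding mp.map_prod by (intro prod.cong) (auto simp: map_poly_e_G)
  also have "\<dots> = root_poly (\<Union>i\<in>{1..n}. block i)"
    unfolding root_poly_def
    using disjoint_blocks finite_block by (subst prod.UNION_disjoint) (auto simp: disjoint_family_on_def)
  finally have "coeff (map_poly e (\<Prod>i\<in>{1..n}. G i)) k = coeff (root_poly {1..l}) k"
    by (simp only: Union_blocks)
  then show ?thesis by (simp add: Ec_def E_def)
qed

lemma Ec_in_Ka: "Ec k \<in> Ka"
proof -
  interpret c: usubring "cpoly Ka" by (rule Ka.usubring_cpoly)
  have "(\<Prod>i\<in>{1..n}. G i) \<in> cpoly Ka" by (intro c.prod_in G_in_cpoly)
  then show ?thesis unfolding Ec_def by (rule cpolyD)
qed

sublocale Ic: uideal Ka Ic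
  unfolding Ic_def by (rule Ka.uideal_lin_span) (rule Ec_in_Ka)

section \<open>Presentation of the algebra by generic coefficients, and nilpotency\<close>

lemma E_in_P: "E k \<in> P"
  unfolding E_def by (rule cpolyD[OF root_poly_in_cpoly]) simp

lemma perm_E: "s permutes A \<Longrightarrow> A \<subseteq> {1..l} \<Longrightarrow> perm_vars s (E k) = E k"
  unfolding E_def by (rule perm_coeff_root_poly[OF permutes_subset[of s A "{1..l}"]]) auto

lemma lookup_zero_E: "k < l \<Longrightarrow> lookup (E k) 0 = 0"
  by (simp add: E_def lookup_zero_coeff_root_poly)

definition sym_gens :: "(nat, 'f) mpoly set" where
  "sym_gens = {p \<in> P. symmetric_in {1..l} p \<and> lookup p 0 = 0}"

lemma z_ring_eq: "z_ring K l = subring_rec P"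
  by (simp add: z_ring_def mpoly_ring_def P_def)

lemma SI_eq: "SI = genideal (subring_rec P) sym_gens"
  by (simp add: SI_def sym_ideal_def z_ring_eq sym_gens_def)

sublocale SI: uideal P SI
  unfolding SI_eq by (rule P.genideal_subring_rec) (auto simp: sym_gens_def)

lemma E_in_SI: "k < l \<Longrightarrow> E k \<in> SI"
proof -
  have "sym_gens \<subseteq> SI" unfolding SI_eq by (rule P.genideal_subring_rec) (auto simp: sym_gens_def)
  then show "k < l \<Longrightarrow> E k \<in> SI"
    by (auto simp: sym_gens_def E_in_P lookup_zero_E symmetric_in_iff perm_E)
qed

text \<open>A symmetric polynomial is a polynomial over \<open>K\<close> in the \<open>E k\<close>,
  hence congruent to a constant modulo the span. Elements of the span vanish at the origin, so this
  constant is the constant term.\<close>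

lemma SI_eq_lin_span: "SI = lin_span P {..<l} E"
proof
  show "lin_span P {..<l} E \<subseteq> SI" by (rule lin_span_minimal[OF SI.uideal_axioms]) (simp add: E_in_SI)
  interpret S: uideal P "lin_span P {..<l} E" by (rule P.uideal_lin_span) (rule E_in_P)
  have const: "mconst ` K \<subseteq> P" "usubring (mconst ` K :: (nat, 'f) mpoly set)"
    using mconst_in_P ring_map.usubring_image[OF ring_map_mconst K_subring] by auto
  have lk: "lookup x 0 = 0" if "x \<in> lin_span P {..<l} E" for x
  proof -
    interpret r: ring_map "\<lambda>p :: (nat, 'f) mpoly. lookup p 0" by (rule ring_map_lookup_zero)
    from that obtain h where "x = (\<Sum>k<l. h k * E k)" by (auto simp: lin_span_def)
    then show ?thesis by (simp add: r.map_sum r.map_mult lookup_zero_E)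
  qed
  show "SI \<subseteq> lin_span P {..<l} E"
    unfolding SI_eq
  proof (rule P.genideal_subring_rec(3)[OF _ S.uideal_axioms])
    show "sym_gens \<subseteq> P" by (auto simp: sym_gens_def)
    show "sym_gens \<subseteq> lin_span P {..<l} E"
    proof
      fix g assume g: "g \<in> sym_gens"
      have "g \<in> ring_gen (mconst ` K \<union> root_coeffs {1..l})"
        using g by (intro symmetric_in_ring_gen_root_coeffs)
          (auto simp: sym_gens_def P_def mpoly_over_eq_ring_gen[OF K_subring] symmetric_in_iff
            perm_vars_mconst permutes_bij)
      moreover have "ring_gen (mconst ` K \<union> root_coeffs {1..l}) \<subseteq>
          {x \<in> P. \<exists>y\<in>mconst ` K. x - y \<in> lin_span P {..<l} E}"
      proof (rule ring_gen_minimal[OF S.congruent_subring[OF const(2,1)]])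
        have "\<exists>c\<in>K. E k - mconst c \<in> lin_span P {..<l} E" for k
        proof (cases "k < l")
          case True
          then show ?thesis
            using lin_span_generator[OF P.usubring_axioms, of "{..<l}" k E] K.zero_in
            by (intro bexI[of _ 0]) (auto simp: mconst_def)
        next
          case False
          then have "E k = mconst (if k = l then 1 else 0)"
            using monic_of_root_poly[of "{1..l}" , where ?'b = 'f] by (auto simp: E_def monic_of_def mconst_def)
          then show ?thesis using S.ideal_zero K.zero_in K.one_in
            by (intro bexI[of _ "if k = l then 1 else 0"]) auto
        qed
        then have "E k \<in> {x \<in> P. \<exists>y\<in>mconst ` K. x - y \<in> lin_span P {..<l} E}" for k
          using E_in_P by simp
        moreover have "mconst c \<in> {x \<in> P. \<exists>y\<in>mconst ` K. x - y \<in> lin_span P {..<l} E}" if "c \<in> K" for c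
          using that S.ideal_zero by (auto simp: mconst_in_P intro: bexI[of _ c])
        ultimately show "mconst ` K \<union> root_coeffs {1..l} \<subseteq> {x \<in> P. \<exists>y\<in>mconst ` K. x - y \<in> lin_span P {..<l} E}"
          unfolding E_def by blast
      qed
      ultimately obtain c where c: "c \<in> K" "g - mconst c \<in> lin_span P {..<l} E" by auto
      then have "c = 0"
        using lk[OF c(2)] g by (simp add: sym_gens_def lookup_minus)
      then show "g \<in> lin_span P {..<l} E" using c by (simp add: mconst_def)
    qed
  qed
qed

text \<open>Identifies the kernel of the map from \<open>Ka\<close> to the block-symmetric algebra.
  A relation over \<open>P\<close> is first averaged to have coefficients in \<open>D\<close>, then
  lifted along \<open>e\<close>.\<close>

lemma e_in_SI_iff:
  assumes p: "p \<in> Ka"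
  shows "e p \<in> SI \<longleftrightarrow> p \<in> Ic"
proof
  assume "p \<in> Ic"
  then obtain h where h: "p = (\<Sum>k<l. h k * Ec k)" "\<forall>k<l. h k \<in> Ka" by (auto simp: Ic_def lin_span_def)
  then have "e p = (\<Sum>k<l. e (h k) * E k)" by (simp add: e.map_sum e.map_mult e_Ec)
  also have "\<dots> \<in> SI"
    using h e_in_D E_in_SI by (intro SI.ideal_sum SI.ideal_mult) (auto simp: mem_D_iff)
  finally show "e p \<in> SI" .
next
  assume "e p \<in> SI"
  then obtain h where h: "e p = (\<Sum>k\<in>{..<l}. h k * E k)" "\<And>k. k \<in> {..<l} \<Longrightarrow> h k \<in> P"
    unfolding SI_eq_lin_span by (auto simp: lin_span_def)
  have of_nat_K: "of_nat d \<in> K" for d by (induction d) (auto intro: K.closed)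
  have "\<exists>h. e p = (\<Sum>k\<in>{..<l}. h k * E k) \<and> (\<forall>k\<in>{..<l}. h k \<in> mpoly_over K {1..l} \<and>
           (\<forall>i\<in>{1..n}. \<forall>s. s permutes block i \<longrightarrow> perm_vars s (h k) = h k))"
  proof (rule block_symmetric_coefficients[OF K_subring char_zero _ _ _ disjoint_blocks block_subset])
    show "e p = (\<Sum>k\<in>{..<l}. h k * E k)" by (rule h(1))
    show "\<And>k. k \<in> {..<l} \<Longrightarrow> h k \<in> mpoly_over K {1..l}" using h(2) by (simp add: P_def)
    show "perm_vars s (e p) = e p" if "i \<in> {1..n}" "s permutes block i" for i s
      using e_in_D[OF p] that by (simp add: mem_D_iff)
    show "perm_vars s (E k) = E k" if "i \<in> {1..n}" "s permutes block i" for i s k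
      using that block_subset perm_E by blast
  qed (use K_inverse of_nat_K finite_block in auto)
  then obtain h where h: "e p = (\<Sum>k<l. h k * E k)" "\<forall>k<l. h k \<in> D"
    by (auto simp: mem_D_iff P_def)
  then have "\<forall>k<l. \<exists>h'\<in>Ka. h k = e h'" using D_eq_image by auto
  then obtain h' where h': "\<forall>k<l. h' k \<in> Ka \<and> h k = e (h' k)" by metis
  have low_eq: "low = {(i, k). i \<in> {1..n} \<and> k < card (block i)}"
    by (auto simp: low_def card_block)
  \<comment> \<open>The difference between \<open>p\<close> and the lifted relation is killed by
    \<open>e\<close>, so it vanishes by algebraic independence of the root coefficients.\<close>
  define q where "q = p - (\<Sum>k<l. h' k * Ec k)"
  have sum: "(\<Sum>k<l. h' k * Ec k) \<in> Ic" unfolding Ic_def by (rule lin_spanI) (use h' in auto)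
  have "e q = 0"
    unfolding q_def using h(1) h' by (simp add: e.map_minus e.map_sum e.map_mult e_Ec)
  moreover have "q \<in> Ka" unfolding q_def by (intro Ka.diff_in p Ic.ideal_sub[OF sum])
  then have "q \<in> mpoly_over UNIV {(i, k). i \<in> {1..n} \<and> k < card (block i)}"
    unfolding low_eq[symmetric] by (simp add: Ka_def mpoly_over_def)
  ultimately have "q = 0"
    using disjoint_blocks finite_block unfolding e_def
    by (intro block_subst_injective[of "{1..n}" block]) auto
  then show "p \<in> Ic" using sum by (simp add: q_def)
qed

text \<open>Each variable is a root of a monic polynomial of degree \<open>l\<close> whose lower
  coefficients lie in \<open>SI\<close>.\<close>

lemma mvar_power_in_SI: "b \<in> {1..l} \<Longrightarrow> mvar b ^ l \<in> SI"
proof -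
  assume b: "b \<in> {1..l}"
  define Q where "Q = (root_poly {1..l} :: (nat, 'f) mpoly poly)"
  have mon: "monic_of l Q" using monic_of_root_poly[of "{1..l}"] by (simp add: Q_def)
  then have deg: "degree Q = l" by (intro antisym degree_le le_degree) (auto simp: monic_of_def)
  have "0 = poly Q (mvar b)" using poly_root_poly[of "{1..l}" b] b by (simp add: Q_def)
  also have "\<dots> = (\<Sum>k<l. coeff Q k * mvar b ^ k) + mvar b ^ l"
    using mon by (simp add: poly_altdef deg lessThan_Suc_atMost[symmetric] monic_of_def)
  finally have "mvar b ^ l = - (\<Sum>k<l. mvar b ^ k * E k)"
    by (simp add: eq_neg_iff_add_eq_0 Q_def E_def ac_simps)
  also have "\<dots> \<in> SI"
    using b by (intro SI.ideal_uminus SI.ideal_sum SI.ideal_mult E_in_SI P.power_in mvar_in_P) auto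
  finally show ?thesis .
qed

text \<open>The pigeonhole bound for \<open>l\<close> variables whose \<open>l\<close>-th powers lie
  in \<open>SI\<close>.\<close>

definition order_bound :: nat where "order_bound = Suc (l * l)"

lemma high_order_in_SI:
  assumes "p \<in> P" "p \<in> order_ge {1..l} order_bound"
  shows "p \<in> SI"
proof (rule high_order_in_ideal[OF ring_map_id SI.uideal_axioms])
  show "p \<in> mpoly_over K {1..l}" using assms(1) by (simp add: P_def)
  show "p \<in> order_ge {1..l} (Suc (l * card {1..l}))" using assms(2) by (simp add: order_bound_def)
qed (simp_all add: mconst_in_P mvar_in_P mvar_power_in_SI)

lemma order_ge_1_P_iff: "p \<in> P \<Longrightarrow> p \<in> order_ge {1..l} 1 \<longleftrightarrow> lookup p 0 = 0"
proof -
  assume "p \<in> P"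
  then have "keys p \<subseteq> {e. keys e \<subseteq> {1..l}}" unfolding P_def mpoly_over_def by blast
  then show ?thesis by (rule order_ge_1_iff)
qed

text \<open>Every variable in \<open>low\<close> is sent to a nonleading root coefficient, which
  vanishes at the origin; so \<open>e\<close> cannot lower the order.\<close>

lemma e_order_ge:
  assumes p: "p \<in> Ka" "p \<in> order_ge low k"
  shows "e p \<in> order_ge {1..l} k"
proof -
  interpret O: uideal UNIV "order_ge {1..l} k :: (nat, 'f) mpoly set" by (rule uideal_order_ge)
  have "e (\<Sum>x\<in>keys p. mconst (lookup p x) * (\<Prod>v\<in>keys x. mvar v ^ lookup x v)) \<in> order_ge {1..l} k"
    unfolding e.map_sum
  proof (rule O.ideal_sum)
    fix x assume x: "x \<in> keys p"
    have prod_order: "(\<Prod>v\<in>A. e (mvar v) ^ lookup x v) \<in> order_ge {1..l} (\<Sum>v\<in>A. lookup x v)"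
      if "finite A" "A \<subseteq> low" for A
      using that
    proof (induction A rule: finite_induct)
      case (insert v A)
      have "e (mvar v) \<in> order_ge {1..l} 1"
      proof -
        obtain i j where v: "v = (i, j)" "i \<in> {1..n}" "j < lam i" using insert.prems by (auto simp: low_def)
        then show ?thesis
          using order_ge_1_P_iff[of "coeff (root_poly (block i)) j"] root_coeff_in_D[OF v(2), of j]
          by (simp add: mem_D_iff lookup_zero_coeff_root_poly finite_block card_block)
      qed
      then have "e (mvar v) ^ lookup x v \<in> order_ge {1..l} (lookup x v)"
        using order_ge_power[of "e (mvar v)" "{1..l}" 1 "lookup x v"] by simp
      from order_ge_mult[OF this insert.IH] insert show ?case by simp
    qed (simp add: order_ge_0)
    have low_x: "keys x \<subseteq> low" using x p(1) by (simp add: Ka_def mpoly_over_def)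
    then have "k \<le> (\<Sum>v\<in>keys x. lookup x v)"
      using x p(2) by (auto simp: order_ge_def part_degree_def Int_absorb2)
    with prod_order[OF finite_keys low_x]
    have "(\<Prod>v\<in>keys x. e (mvar v) ^ lookup x v) \<in> order_ge {1..l} k"
      by (rule order_ge_antimono)
    then show "e (mconst (lookup p x) * (\<Prod>v\<in>keys x. mvar v ^ lookup x v)) \<in> order_ge {1..l} k"
      unfolding e.map_mult e.map_prod e.map_power by (intro O.ideal_mult) auto
  qed
  then show ?thesis using mpoly_eq_sum_monomials[of p] by simp
qed

text \<open>The block-symmetric algebra is local: divided by its constant term, \<open>p\<close>
  becomes \<open>1 - x\<close> with \<open>x\<close> nilpotent modulo \<open>SI\<close>.\<close>

lemma unit_mod_SI:
  assumes p: "p \<in> D" "lookup p 0 \<noteq> 0"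
  shows "\<exists>d\<in>D. p * d - 1 \<in> SI"
proof -
  define c where "c = lookup p 0"
  have c: "c \<in> K" "inverse c \<in> K" "c \<noteq> 0"
    using p K_inverse by (auto simp: c_def mem_D_iff P_def mpoly_over_def)
  define x where "x = 1 - p * mconst (inverse c)"
  have xD: "x \<in> D" unfolding x_def using p c by (intro D.closed mconst_in_D) auto
  interpret r: ring_map "\<lambda>p :: (nat, 'f) mpoly. lookup p 0" by (rule ring_map_lookup_zero)
  have "lookup x 0 = 0" unfolding x_def using c by (simp add: r.map_minus r.map_mult r.map_one c_def)
  then have "x \<in> order_ge {1..l} 1" using order_ge_1_P_iff xD by (simp add: mem_D_iff)
  then have "x ^ order_bound \<in> order_ge {1..l} order_bound"
    using order_ge_power[of x "{1..l}" 1 order_bound] by simp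
  then have xSI: "x ^ order_bound \<in> SI"
    using xD by (intro high_order_in_SI P.power_in) (auto simp: mem_D_iff)
  \<comment> \<open>The geometric series, cut off at the order where the powers of \<open>x\<close>
    fall into \<open>SI\<close>.\<close>
  define d where "d = mconst (inverse c) * (\<Sum>i<order_bound. x ^ i)"
  have "p * d - 1 = (1 - x) * (\<Sum>i<order_bound. x ^ i) - 1"
    by (simp add: d_def x_def mult.assoc)
  also have "\<dots> = - (x ^ order_bound)" by (simp flip: one_diff_power_eq)
  also have "\<dots> \<in> SI" using xSI by (rule SI.ideal_uminus)
  finally have "p * d - 1 \<in> SI" .
  moreover have "d \<in> D" unfolding d_def using xD c by (intro D.closed mconst_in_D) auto
  ultimately show ?thesis by blast
qed

lemma A_lam_eq:
  "A_lam K n lam = algebra_via ((subring_rec P Quot SI)\<lparr>carrier := qclass P SI ` D\<rparr>)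
     (\<lambda>c. qclass P SI (mconst c))"
  unfolding A_lam_def Let_def l_eq[symmetric] SI_def[symmetric] z_ring_eq by (simp add: D_def)

end

text \<open>Serves three purposes: \<open>A\<close> may be a subring (giving a localization), an
  ideal (giving its extension to the localization), or \<open>Kf\<close> with its nonzero elements
  as \<open>T\<close> (giving the field \<open>K\<close>).\<close>

definition fractions :: "'a::idom set \<Rightarrow> 'a set \<Rightarrow> 'a fract set" where
  "fractions A T = {Fract f g | f g. f \<in> A \<and> g \<in> T}"

lemma usubring_fractions:
  assumes "usubring A" and T: "T \<subseteq> A" "1 \<in> T" "\<And>g h. g \<in> T \<Longrightarrow> h \<in> T \<Longrightarrow> g * h \<in> T" "0 \<notin> T"
  shows "usubring (fractions A T)"
proof -
  interpret usubring A by fact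
  show ?thesis
  proof
    show "1 \<in> fractions A T" using one_in T(2) by (auto simp: fractions_def One_fract_def)
    fix x y assume "x \<in> fractions A T" "y \<in> fractions A T"
    then obtain f g f' g' where fg: "f \<in> A" "g \<in> T" "x = Fract f g" "f' \<in> A" "g' \<in> T" "y = Fract f' g'"
      by (auto simp: fractions_def)
    then have ne: "g \<noteq> 0" "g' \<noteq> 0" and gA: "g \<in> A" "g' \<in> A" using T by auto
    have "f * g' - f' * g \<in> A" "f * f' \<in> A" using fg gA by (auto intro: diff_in mult_in)
    then show "x - y \<in> fractions A T" "x * y \<in> fractions A T"
      using fg ne T(3)[OF fg(2,5)] by (auto simp: fractions_def)
  qed
qed

section \<open>The jet ring localized at a minimal prime\<close>

text \<open>The parameter \<open>ty\<close> fixes the base field type \<open>'k\<close>, which does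
  not occur in the numerical data.\<close>

locale jet_setting =
  fixes n m :: nat and lam :: "nat \<Rightarrow> nat" and ty :: "'k::field_char_0 itself"
  assumes sum_lam: "(\<Sum>i\<in>{1..n}. lam i) = m + 1"
begin

definition emb :: "'k jet_poly \<Rightarrow> 'k jet_poly fract" where "emb f = Fract f 1"
definition K :: "'k jet_poly fract set" where "K = K_lam n m lam"
definition V :: "(nat \<times> nat) set" where "V = {1..n} \<times> {0..m}"
definition R :: "'k jet_poly set" where "R = mpoly_over UNIV V"
definition J :: "'k jet_poly set" where "J = jet_ideal n m"
definition S :: "'k jet_poly set" where "S = R - p_lam n m lam"
abbreviation free where "free \<equiv> free_vars n m lam"
abbreviation Kf :: "'k jet_poly set" where "Kf \<equiv> mpoly_over UNIV free"

sublocale emb: ring_map emb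
  unfolding emb_def by (rule ring_map_Fract)

lemma emb_eq_0_iff [simp]: "emb f = 0 \<longleftrightarrow> f = 0"
  by (simp add: emb_def Zero_fract_def eq_fract)

lemma Fract_eq_emb: "Fract f g = emb f / emb g"
  by (cases "g = 0") (simp_all add: emb_def fract_collapse)

section \<open>The coefficient field as a subring closed under inverses\<close>

lemma K_one: "1 \<in> K"
  using generate_field.one[of ring_of_type_algebra] by (simp add: K_def K_lam_def)

lemma K_gen: "x \<in> range (\<lambda>c. emb (mconst c)) \<union> (\<lambda>v. emb (mvar v)) ` free \<Longrightarrow> x \<in> K"
  unfolding K_def K_lam_def emb_def by (rule generate_field.incl)

lemma a_inv_type [simp]: "\<ominus>\<^bsub>ring_of_type_algebra\<^esub> (x :: 'a::comm_ring_1) = - x"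
proof -
  interpret cring "ring_of_type_algebra :: 'a ring" by (rule cring_from_type_algebra)
  show ?thesis by (rule minus_equality) simp_all
qed

lemma m_inv_type: "x \<noteq> 0 \<Longrightarrow> inv\<^bsub>ring_of_type_algebra\<^esub> (x :: 'a::field) = inverse x"
proof -
  interpret cring "ring_of_type_algebra :: 'a ring" by (rule cring_from_type_algebra)
  show "x \<noteq> 0 \<Longrightarrow> inv\<^bsub>ring_of_type_algebra\<^esub> x = inverse x"
    by (rule comm_inv_char) simp_all
qed

lemma K_uminus: "x \<in> K \<Longrightarrow> - x \<in> K"
  using generate_field.a_inv[of x ring_of_type_algebra] unfolding K_def K_lam_def by simp

lemma K_add: "x \<in> K \<Longrightarrow> y \<in> K \<Longrightarrow> x + y \<in> K"
  using generate_field.eng_add[of x ring_of_type_algebra _ y] unfolding K_def K_lam_def by simp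

lemma K_mult: "x \<in> K \<Longrightarrow> y \<in> K \<Longrightarrow> x * y \<in> K"
  using generate_field.eng_mult[of x ring_of_type_algebra _ y] unfolding K_def K_lam_def by simp

lemma K_inverse: "x \<in> K \<Longrightarrow> inverse x \<in> K"
  using generate_field.m_inv[of x ring_of_type_algebra] unfolding K_def K_lam_def
  by (cases "x = 0") (simp_all add: m_inv_type)

lemma usubring_K: "usubring K"
  by standard (use K_one K_mult K_add[OF _ K_uminus] in \<open>simp_all\<close>)

lemma of_nat_fract_neq_0: "d > 0 \<Longrightarrow> (of_nat d :: 'k jet_poly fract) \<noteq> 0"
proof -
  have "of_nat d = emb (of_nat d)" by (induction d) (simp_all add: emb.map_zero emb.map_one emb.map_add)
  then show "d > 0 \<Longrightarrow> (of_nat d :: 'k jet_poly fract) \<noteq> 0" by simp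
qed

sublocale bs: block_setting n "Suc m" lam K
  by standard (use usubring_K[unfolded usubring_def] K_inverse of_nat_fract_neq_0 sum_lam in auto)

lemma lam_le: "i \<in> {1..n} \<Longrightarrow> lam i \<le> Suc m"
  using member_le_sum[of i "{1..n}" lam] sum_lam by simp

abbreviation low where "low \<equiv> bs.low"

lemma low_sub: "low \<subseteq> V"
  using lam_le by (fastforce simp: bs.low_def V_def)

lemma free_sub: "free \<subseteq> V"
  by (auto simp: free_vars_def V_def)

lemma free_iff: "v \<in> free \<longleftrightarrow> v \<in> V \<and> v \<notin> low"
  by (auto simp: free_vars_def V_def bs.low_def)

lemma finite_low: "finite low"
  by (rule finite_subset[OF low_sub]) (simp add: V_def)

sublocale R: usubring R
  unfolding R_def by (rule usubring_mpoly_over[OF usubring_UNIV])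

lemma jet_ring_eq: "jet_ring n m = subring_rec R"
  by (simp add: jet_ring_def mpoly_ring_def R_def V_def)

lemma mvar_in_R: "v \<in> V \<Longrightarrow> mvar v \<in> R"
  unfolding R_def by (rule mvar_in_mpoly_over[OF usubring_UNIV])

lemma mconst_in_R: "mconst c \<in> R"
  unfolding R_def by (rule mconst_in_mpoly_over[OF usubring_UNIV]) simp

lemma free_poly_in_R: "f \<in> Kf \<Longrightarrow> f \<in> R"
  using mpoly_over_mono[OF free_sub] by (auto simp: R_def)

subsection \<open>The prime ideal\<close>

text \<open>Reduction modulo the prime: a retraction onto polynomials in the remaining variables, by
  which membership in \<open>S\<close> becomes \<open>rho s \<noteq> 0\<close>.\<close>

definition rho :: "'k jet_poly \<Rightarrow> 'k jet_poly" where
  "rho = meval mconst (\<lambda>v. if v \<in> low then 0 else mvar v)"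

sublocale rho: ring_map rho
  unfolding rho_def by (rule ring_map.ring_map_meval[OF ring_map_mconst])

lemma rho_mconst [simp]: "rho (mconst c) = mconst c"
  unfolding rho_def by (rule ring_map.meval_mconst[OF ring_map_mconst])

lemma rho_mvar: "rho (mvar v) = (if v \<in> low then 0 else mvar v)"
  unfolding rho_def by (rule ring_map.meval_mvar[OF ring_map_mconst])

lemma rho_free:
  assumes "f \<in> Kf"
  shows "rho f = f"
  by (rule ring_map_eq_on_mpoly_over[OF usubring_UNIV rho.ring_map_axioms ring_map_id _ _ assms])
    (auto simp: rho_mvar free_iff)

lemma rho_order_ge: "f \<in> order_ge low 1 \<Longrightarrow> rho f = 0"
proof -
  assume f: "f \<in> order_ge low 1"
  have "exp_eval (\<lambda>v. if v \<in> low then 0 else mvar v) x = (0 :: 'k jet_poly)" if "x \<in> keys f" for x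
  proof -
    have "part_degree low x \<noteq> 0" using f that by (auto simp: order_ge_def)
    then obtain v where v: "v \<in> keys x" "v \<in> low" "lookup x v \<noteq> 0"
      unfolding part_degree_def by (metis (no_types, lifting) Int_iff sum.not_neutral_contains_not_neutral)
    then show ?thesis
      unfolding exp_eval_def by (intro prod_zero) (auto intro!: bexI[of _ v] simp: zero_power)
  qed
  then show ?thesis by (simp add: rho_def meval_def)
qed

text \<open>\<open>rho\<close> kills the generators, and conversely every \<open>f\<close> is
  congruent to \<open>rho f\<close> modulo the ideal they generate.\<close>

lemma p_lam_iff:
  assumes "f \<in> R"
  shows "f \<in> p_lam n m lam \<longleftrightarrow> rho f = 0"
proof -
  have gens: "{mvar (i, j) | i j. i \<in> {1..n} \<and> j < lam i} = (mvar ` low :: 'k jet_poly set)"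
    by (auto simp: bs.low_def)
  have lowR: "mvar ` low \<subseteq> R" using low_sub mvar_in_R by auto
  define p where "p = (genideal (subring_rec R) (mvar ` low) :: 'k jet_poly set)"
  have p: "p_lam n m lam = p" by (simp only: p_lam_def gens jet_ring_eq p_def)
  interpret p: uideal R p unfolding p_def by (rule R.genideal_subring_rec(1)[OF lowR])
  have low_p: "mvar ` low \<subseteq> p" unfolding p_def by (rule R.genideal_subring_rec(2)[OF lowR])
  have "uideal R {f \<in> R. rho f = 0}"
    by standard (auto simp: rho.map_zero rho.map_add rho.map_mult R.closed)
  then have "p \<subseteq> {f \<in> R. rho f = 0}"
    unfolding p_def by (rule R.genideal_subring_rec(3)[OF lowR]) (use lowR in \<open>auto simp: rho_mvar\<close>)
  moreover have "f - rho f \<in> p"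
    by (rule ring_maps_congruent_on_mpoly_over[OF usubring_UNIV ring_map_id rho.ring_map_axioms
          p.uideal_axioms _ _ assms[unfolded R_def]])
      (auto simp: mconst_in_R mvar_in_R R.zero_in p.ideal_zero rho_mvar intro: subsetD[OF low_p, OF imageI])
  ultimately show ?thesis using assms p by auto
qed

lemma S_iff: "s \<in> S \<longleftrightarrow> s \<in> R \<and> rho s \<noteq> 0"
  using p_lam_iff by (auto simp: S_def)

lemma S_neq_0: "s \<in> S \<Longrightarrow> s \<noteq> 0"
  by (auto simp: S_iff rho.map_zero)

lemma S_one: "1 \<in> S"
  by (simp add: S_iff R.one_in rho.map_one)

text \<open>This is the primality of \<open>p_lam\<close>: \<open>rho\<close> is multiplicative and
  the polynomial ring is a domain.\<close>

lemma S_mult: "s \<in> S \<Longrightarrow> t \<in> S \<Longrightarrow> s * t \<in> S"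
  by (simp add: S_iff R.mult_in rho.map_mult)

lemma free_poly_in_S: "g \<in> Kf \<Longrightarrow> g \<noteq> 0 \<Longrightarrow> g \<in> S"
  by (simp add: S_iff free_poly_in_R rho_free)

text \<open>The quotients of polynomials in the free variables contain the generators and are closed
  under the field operations, so the generated field does not exceed them.\<close>

lemma K_eq_quotient:
  assumes "c \<in> K"
  shows "\<exists>f g. f \<in> Kf \<and> g \<in> Kf \<and> g \<noteq> 0 \<and> c = Fract f g"
proof -
  interpret Kf: usubring Kf by (rule usubring_mpoly_over[OF usubring_UNIV])
  have *: "Kf - {0} \<subseteq> Kf" "1 \<in> Kf - {0}" "\<And>g h. g \<in> Kf - {0} \<Longrightarrow> h \<in> Kf - {0} \<Longrightarrow> g * h \<in> Kf - {0}"
    by (auto intro: Kf.closed)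
  interpret Q: usubring "fractions Kf (Kf - {0})"
    by (rule usubring_fractions[OF Kf.usubring_axioms *]) simp_all
  have "c \<in> fractions Kf (Kf - {0})"
    using assms unfolding K_def K_lam_def
  proof induction
    case (incl h)
    then obtain f where "f \<in> Kf" "h = Fract f 1"
      by (auto intro: mconst_in_mpoly_over[OF usubring_UNIV] mvar_in_mpoly_over[OF usubring_UNIV])
    then show ?case using *(2) unfolding fractions_def by blast
  next
    case (m_inv h)
    then obtain f g where fg: "f \<in> Kf" "g \<in> Kf" "g \<noteq> 0" "h = Fract f g" by (auto simp: fractions_def)
    moreover from this m_inv.hyps(2) have "f \<noteq> 0" by (auto simp: fract_collapse)
    moreover have "inv\<^bsub>ring_of_type_algebra\<^esub> h = Fract g f" using fg m_inv.hyps(2) by (simp add: m_inv_type)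
    ultimately show ?case by (auto simp: fractions_def)
  qed (simp_all add: Q.closed)
  then show ?thesis by (auto simp: fractions_def)
qed

lemma emb_free_in_K: "f \<in> Kf \<Longrightarrow> emb f \<in> K"
  by (rule ring_map_mpoly_over_into[OF usubring_UNIV emb.ring_map_axioms usubring_K]) (auto intro: K_gen)

subsection \<open>The jet ideal\<close>

text \<open>Adding the term \<open>t^(m+1)\<close> to each factor does not change the product modulo \<open>t^(m+1)\<close>; it makes
  the coefficient of index \<open>lam i\<close> a unit of the localization also when \<open>lam i = m + 1\<close>.\<close>

definition xc :: "nat \<Rightarrow> nat \<Rightarrow> 'k jet_poly" where
  "xc i j = (if j \<le> m then mvar (i, j) else if j = Suc m then 1 else 0)"

definition Xp :: "nat \<Rightarrow> 'k jet_poly poly" where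
  "Xp i = (\<Sum>j\<le>Suc m. Polynomial.monom (xc i j) j)"

lemma coeff_Xp: "coeff (Xp i) j = xc i j"
proof -
  have "coeff (Xp i) j = (\<Sum>k\<le>Suc m. if k = j then xc i k else 0)"
    by (simp add: Xp_def coeff_sum)
  then show ?thesis by (auto simp: xc_def)
qed

lemma xc_in_R: "i \<in> {1..n} \<Longrightarrow> xc i j \<in> R"
  by (auto simp: xc_def R.closed V_def intro!: mvar_in_R)

lemma xc_free: "i \<in> {1..n} \<Longrightarrow> lam i \<le> j \<Longrightarrow> xc i j \<in> Kf"
proof -
  interpret Fr: usubring Kf by (rule usubring_mpoly_over[OF usubring_UNIV])
  have "(i, j) \<in> free" if "i \<in> {1..n}" "lam i \<le> j" "j \<le> m"
    using that by (simp add: free_vars_def)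
  then show "i \<in> {1..n} \<Longrightarrow> lam i \<le> j \<Longrightarrow> xc i j \<in> Kf"
    by (auto simp: xc_def Fr.closed intro!: mvar_in_mpoly_over[OF usubring_UNIV])
qed

lemma xc_lam_in_S: "i \<in> {1..n} \<Longrightarrow> xc i (lam i) \<in> S"
  using lam_le[of i] by (intro free_poly_in_S xc_free) (auto simp: xc_def mvar_neq_0)

lemma coeff_jet_product:
  assumes "s \<le> m"
  shows "coeff (jet_product n m :: 'k jet_poly poly) s = coeff (\<Prod>i\<in>{1..n}. Xp i) s"
proof -
  have "coeff (\<Sum>j\<in>{0..m}. Polynomial.monom (mvar (i, j) :: 'k jet_poly) j) s = coeff (Xp i) s"
    if "s \<le> m" for i s
  proof -
    have "coeff (\<Sum>j\<in>{0..m}. Polynomial.monom (mvar (i, j) :: 'k jet_poly) j) s =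
        (\<Sum>j\<in>{0..m}. if j = s then mvar (i, j) else 0)"
      by (simp add: coeff_sum)
    then show ?thesis using that by (auto simp: coeff_Xp xc_def)
  qed
  then show ?thesis unfolding jet_product_def using assms by (intro coeff_prod_cong_low) auto
qed

definition jet_gens :: "'k jet_poly set" where
  "jet_gens = {coeff (\<Prod>i\<in>{1..n}. Xp i) s | s. s \<le> m}"

lemma J_eq: "J = genideal (subring_rec R) jet_gens"
proof -
  have "{coeff (jet_product n m) s | s. s \<le> m} = jet_gens"
    unfolding jet_gens_def using coeff_jet_product by (metis (no_types, opaque_lifting))
  then show ?thesis by (simp add: J_def jet_ideal_def jet_ring_eq)
qed

lemma jet_gens_sub: "jet_gens \<subseteq> R"
proof -
  interpret c: usubring "cpoly R" by (rule R.usubring_cpoly)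
  have "(\<Prod>i\<in>{1..n}. Xp i) \<in> cpoly R"
    by (intro c.prod_in cpolyI) (auto simp: coeff_Xp xc_in_R)
  then show ?thesis by (auto simp: jet_gens_def dest: cpolyD)
qed

sublocale J: uideal R J
  unfolding J_eq by (rule R.genideal_subring_rec(1)[OF jet_gens_sub])

lemma coeff_prod_Xp_in_J: "s \<le> m \<Longrightarrow> coeff (\<Prod>i\<in>{1..n}. Xp i) s \<in> J"
  using R.genideal_subring_rec(2)[OF jet_gens_sub] by (auto simp: J_eq jet_gens_def)

lemma J_minimal: "uideal R I \<Longrightarrow> jet_gens \<subseteq> I \<Longrightarrow> J \<subseteq> I"
  unfolding J_eq by (rule R.genideal_subring_rec(3)[OF jet_gens_sub])

sublocale loc: subring_localization R J S
  by standard (simp_all add: S_one S_mult, simp add: S_iff)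

section \<open>The homomorphism to the block-symmetric algebra\<close>

definition Xhi :: "nat \<Rightarrow> (nat \<times> nat, 'k jet_poly fract) mpoly poly" where
  "Xhi i = (\<Sum>j\<in>{lam i..Suc m}. Polynomial.monom (mconst (emb (xc i j))) j)"

lemma mconst_0 [simp]: "mconst 0 = 0"
  by (simp add: mconst_def)

lemma mconst_1 [simp]: "mconst 1 = 1"
  by (simp add: mconst_def)

lemma coeff_Xhi: "coeff (Xhi i) j = (if lam i \<le> j then mconst (emb (xc i j)) else 0)"
proof -
  have "coeff (Xhi i) j = (\<Sum>k\<in>{lam i..Suc m}. if k = j then mconst (emb (xc i k)) else 0)"
    by (simp add: Xhi_def coeff_sum)
  then show ?thesis by (auto simp: xc_def emb.map_zero)
qed

lemma emb_xc_in_K: "i \<in> {1..n} \<Longrightarrow> lam i \<le> j \<Longrightarrow> emb (xc i j) \<in> K"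
  by (rule emb_free_in_K[OF xc_free])

lemma Xhi_division:
  assumes "i \<in> {1..n}"
  shows "\<exists>s r. s \<in> cpoly bs.Ka \<and> r \<in> cpoly bs.Ka \<and> Xhi i = bs.G i * s + r \<and> (\<forall>j\<ge>lam i. coeff r j = 0)"
proof -
  have "Xhi i \<in> cpoly bs.Ka"
    using assms by (intro cpolyI) (auto simp: coeff_Xhi bs.Ka.zero_in emb_xc_in_K intro!: bs.mconst_in_Ka)
  then show ?thesis
    using bs.Ka.monic_division[of "lam i" "bs.G i" "Xhi i"] bs.G_in_cpoly[OF assms]
      monic_of_generic_poly[of lam i] unfolding bs.G_def by blast
qed

text \<open>Only the quotient is chosen; \<open>rest\<close> is then defined from it, so the
  division identity holds by definition.\<close>

definition quo :: "nat \<Rightarrow> (nat \<times> nat, 'k jet_poly fract) mpoly poly" where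
  "quo i = (SOME s. \<exists>r. s \<in> cpoly bs.Ka \<and> r \<in> cpoly bs.Ka \<and> Xhi i = bs.G i * s + r \<and>
      (\<forall>j\<ge>lam i. coeff r j = 0))"

definition rest :: "nat \<Rightarrow> (nat \<times> nat, 'k jet_poly fract) mpoly poly" where
  "rest i = Xhi i - bs.G i * quo i"

lemma quo_rest:
  assumes "i \<in> {1..n}"
  shows "quo i \<in> cpoly bs.Ka" "rest i \<in> cpoly bs.Ka" "Xhi i = bs.G i * quo i + rest i"
    "j \<ge> lam i \<Longrightarrow> coeff (rest i) j = 0"
proof -
  obtain r where r: "quo i \<in> cpoly bs.Ka" "r \<in> cpoly bs.Ka" "Xhi i = bs.G i * quo i + r"
      "\<forall>j\<ge>lam i. coeff r j = 0"
    using someI_ex[OF Xhi_division[OF assms]] unfolding quo_def by blast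
  then have "rest i = r" by (simp add: rest_def)
  then show "quo i \<in> cpoly bs.Ka" "rest i \<in> cpoly bs.Ka" "Xhi i = bs.G i * quo i + rest i"
    "j \<ge> lam i \<Longrightarrow> coeff (rest i) j = 0" using r by auto
qed

definition phi :: "'k jet_poly \<Rightarrow> (nat \<times> nat, 'k jet_poly fract) mpoly" where
  "phi = meval (mconst \<circ> (emb \<circ> mconst))
     (\<lambda>(i, j). if j < lam i then - coeff (rest i) j else mconst (emb (mvar (i, j))))"

lemma ring_map_consts: "ring_map (mconst \<circ> (emb \<circ> mconst) :: 'k \<Rightarrow> (nat \<times> nat, 'k jet_poly fract) mpoly)"
  by (intro ring_map_comp ring_map_mconst emb.ring_map_axioms)

sublocale phi: ring_map phi
  unfolding phi_def by (rule ring_map.ring_map_meval[OF ring_map_consts])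

lemma phi_mconst: "phi (mconst c) = mconst (emb (mconst c))"
  unfolding phi_def by (simp add: ring_map.meval_mconst[OF ring_map_consts])

lemma phi_mvar: "phi (mvar (i, j)) = (if j < lam i then - coeff (rest i) j else mconst (emb (mvar (i, j))))"
  unfolding phi_def by (simp add: ring_map.meval_mvar[OF ring_map_consts])

lemma ring_map_mconst_emb: "ring_map (mconst \<circ> emb :: 'k jet_poly \<Rightarrow> ('v, 'k jet_poly fract) mpoly)"
  by (intro ring_map_comp ring_map_mconst emb.ring_map_axioms)

lemma phi_free:
  assumes "f \<in> Kf"
  shows "phi f = mconst (emb f)"
proof -
  have "phi f = (mconst \<circ> emb) f"
    by (rule ring_map_eq_on_mpoly_over[OF usubring_UNIV phi.ring_map_axioms ring_map_mconst_emb _ _ assms])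
      (auto simp: phi_mconst phi_mvar free_vars_def)
  then show ?thesis by simp
qed

lemma phi_in_Ka: "f \<in> R \<Longrightarrow> phi f \<in> bs.Ka"
  unfolding R_def
proof (rule ring_map_mpoly_over_into[OF usubring_UNIV phi.ring_map_axioms bs.Ka.usubring_axioms])
  show "phi (mconst c) \<in> bs.Ka" for c
    by (auto simp: phi_mconst intro!: bs.mconst_in_Ka K_gen)
  show "phi (mvar v) \<in> bs.Ka" if v: "v \<in> V" for v
  proof -
    obtain i j where ij: "v = (i, j)" "i \<in> {1..n}" "j \<le> m" using v by (auto simp: V_def)
    show ?thesis
    proof (cases "j < lam i")
      case True
      then show ?thesis using ij cpolyD[OF quo_rest(2)[OF ij(2)]] by (simp add: phi_mvar bs.Ka.uminus_in)
    next
      case False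
      then have "(i, j) \<in> free" using ij by (simp add: free_vars_def)
      then show ?thesis using False ij by (auto simp: phi_mvar intro!: bs.mconst_in_Ka K_gen)
    qed
  qed
qed

lemma phi_xc:
  assumes "i \<in> {1..n}"
  shows "phi (xc i j) = (if j < lam i then - coeff (rest i) j else mconst (emb (xc i j)))"
proof (cases "j < lam i")
  case True
  then have "j \<le> m" using lam_le[OF assms] by simp
  then show ?thesis using True by (simp add: xc_def phi_mvar)
next
  case False
  then show ?thesis using phi_free[OF xc_free[OF assms]] by simp
qed

lemma map_phi_Xp: "i \<in> {1..n} \<Longrightarrow> map_poly phi (Xp i) = bs.G i * quo i"
proof -
  assume i: "i \<in> {1..n}"
  have "map_poly phi (Xp i) = Xhi i - rest i"
    by (rule poly_eqI) (auto simp: coeff_Xp phi_xc[OF i] coeff_Xhi quo_rest(4)[OF i])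
  then show ?thesis using quo_rest(3)[OF i] by simp
qed

text \<open>The image of the product of the jets is divisible by the product of the
  \<open>G i\<close>, so its coefficient of index \<open>s\<close> involves only \<open>Ec a\<close>
  with \<open>a \<le> s \<le> m\<close>, and these are generators of \<open>Ic\<close>.\<close>

lemma phi_J: "f \<in> J \<Longrightarrow> phi f \<in> bs.Ic"
proof -
  have "uideal R {f \<in> R. phi f \<in> bs.Ic}"
    by standard (auto simp: phi.map_zero phi.map_add phi.map_mult R.closed phi_in_Ka
        intro: bs.Ic.ideal_zero bs.Ic.ideal_add bs.Ic.ideal_mult)
  moreover have "jet_gens \<subseteq> {f \<in> R. phi f \<in> bs.Ic}"
  proof
    fix f assume f: "f \<in> jet_gens"
    then obtain s where s: "f = coeff (\<Prod>i\<in>{1..n}. Xp i) s" "s \<le> m" by (auto simp: jet_gens_def)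
    interpret mp: ring_map "map_poly phi" by (rule phi.ring_map_map_poly)
    interpret c: usubring "cpoly bs.Ka" by (rule bs.Ka.usubring_cpoly)
    have "phi f = coeff (map_poly phi (\<Prod>i\<in>{1..n}. Xp i)) s" by (simp add: s)
    also have "map_poly phi (\<Prod>i\<in>{1..n}. Xp i) = (\<Prod>i\<in>{1..n}. bs.G i) * (\<Prod>i\<in>{1..n}. quo i)"
      by (simp add: mp.map_prod map_phi_Xp prod.distrib)
    also have "coeff \<dots> s = (\<Sum>a\<le>s. coeff (\<Prod>i\<in>{1..n}. quo i) (s - a) * bs.Ec a)"
      by (simp add: coeff_mult bs.Ec_def mult.commute)
    also have "\<dots> \<in> bs.Ic"
    proof (intro bs.Ic.ideal_sum bs.Ic.ideal_mult)
      have "(\<Prod>i\<in>{1..n}. quo i) \<in> cpoly bs.Ka" by (intro c.prod_in quo_rest(1))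
      then show "coeff (\<Prod>i\<in>{1..n}. quo i) (s - a) \<in> bs.Ka" for a by (rule cpolyD)
      show "bs.Ec a \<in> bs.Ic" if "a \<in> {..s}" for a
        using that s unfolding bs.Ic_def by (intro lin_span_generator[OF bs.Ka.usubring_axioms]) auto
    qed
    finally show "f \<in> {f \<in> R. phi f \<in> bs.Ic}" using f jet_gens_sub by auto
  qed
  ultimately show "f \<in> J \<Longrightarrow> phi f \<in> bs.Ic" using J_minimal by blast
qed

lemma lookup_zero_e:
  assumes "p \<in> bs.Ka"
  shows "lookup (bs.e p) 0 = lookup p 0"
proof -
  interpret ra: ring_map "\<lambda>p :: (nat \<times> nat, 'k jet_poly fract) mpoly. lookup p 0" by (rule ring_map_lookup_zero)
  interpret rz: ring_map "\<lambda>p :: (nat, 'k jet_poly fract) mpoly. lookup p 0" by (rule ring_map_lookup_zero)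
  define c where "c = lookup p 0"
  define q where "q = p - mconst c"
  have c: "c \<in> K" using assms by (simp add: c_def bs.Ka_def mpoly_over_def)
  then have q: "q \<in> bs.Ka" unfolding q_def using assms by (intro bs.Ka.diff_in bs.mconst_in_Ka)
  then have "keys q \<subseteq> {x. keys x \<subseteq> low}" unfolding bs.Ka_def mpoly_over_def by blast
  moreover have "lookup q 0 = 0" by (simp add: q_def c_def ra.map_minus)
  ultimately have "q \<in> order_ge low 1" using order_ge_1_iff by blast
  then have "bs.e q \<in> order_ge {1..Suc m} 1" by (rule bs.e_order_ge[OF q])
  then have "lookup (bs.e q) 0 = 0"
    using bs.order_ge_1_P_iff bs.e_in_D[OF q] by (auto simp: bs.mem_D_iff)
  then show ?thesis by (simp add: q_def bs.e.map_minus rz.map_minus c_def)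
qed

text \<open>At a = 0 each \<open>G i\<close> becomes t^(lam i), which divides \<open>Xhi i\<close>,
  so the remainder vanishes. Thus \<open>phi\<close> lies over the reduction modulo the prime, which
  is why elements of \<open>S\<close> become units.\<close>

lemma lookup_zero_phi:
  assumes "f \<in> R"
  shows "lookup (phi f) 0 = emb (rho f)"
proof -
  interpret r: ring_map "\<lambda>p :: (nat \<times> nat, 'k jet_poly fract) mpoly. lookup p 0" by (rule ring_map_lookup_zero)
  have 1: "ring_map ((\<lambda>p. lookup p 0) \<circ> phi)"
    by (rule ring_map_comp[OF r.ring_map_axioms phi.ring_map_axioms])
  have 2: "ring_map (emb \<circ> rho)"
    by (rule ring_map_comp[OF emb.ring_map_axioms rho.ring_map_axioms])
  have rest_0: "lookup (coeff (rest i) j) 0 = 0" if i: "i \<in> {1..n}" and j: "j < lam i" for i j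
  proof -
    interpret mp: ring_map "map_poly (\<lambda>p :: (nat \<times> nat, 'k jet_poly fract) mpoly. lookup p 0)"
      by (rule r.ring_map_map_poly)
    let ?c = "\<lambda>p. map_poly (\<lambda>p :: (nat \<times> nat, 'k jet_poly fract) mpoly. lookup p 0) p"
    have "?c (bs.G i) = Polynomial.monom 1 (lam i)"
      by (rule poly_eqI) (auto simp: bs.G_def coeff_generic_poly r.map_zero)
    then have "?c (Xhi i) = Polynomial.monom 1 (lam i) * ?c (quo i) + ?c (rest i)"
      by (subst quo_rest(3)[OF i]) (simp add: mp.map_add mp.map_mult)
    then have "coeff (?c (Xhi i)) j = coeff (?c (rest i)) j"
      using j by (simp add: coeff_monom_mult)
    then show ?thesis using j by (simp add: coeff_Xhi)
  qed
  have "((\<lambda>p. lookup p 0) \<circ> phi) f = (emb \<circ> rho) f"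
  proof (rule ring_map_eq_on_mpoly_over[OF usubring_UNIV 1 2 _ _ assms[unfolded R_def]])
    show "((\<lambda>p. lookup p 0) \<circ> phi) (mconst c) = (emb \<circ> rho) (mconst c)" for c
      by (simp add: phi_mconst)
    show "((\<lambda>p. lookup p 0) \<circ> phi) (mvar v) = (emb \<circ> rho) (mvar v)" if v: "v \<in> V" for v
    proof -
      obtain i j where ij: "v = (i, j)" "i \<in> {1..n}" using v by (auto simp: V_def)
      then show ?thesis
        by (cases "j < lam i") (simp_all add: phi_mvar rho_mvar bs.low_def rest_0 emb.map_zero)
    qed
  qed
  then show ?thesis by simp
qed

definition Phi :: "'k jet_poly \<Rightarrow> (nat, 'k jet_poly fract) mpoly" where
  "Phi f = bs.e (phi f)"

lemma ring_map_Phi: "ring_map Phi"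
proof -
  have "Phi = bs.e \<circ> phi" by (simp add: fun_eq_iff Phi_def)
  then show ?thesis using ring_map_comp[OF bs.e.ring_map_axioms phi.ring_map_axioms] by simp
qed

sublocale Phi: ring_map Phi by (rule ring_map_Phi)

lemma Phi_in_D: "f \<in> R \<Longrightarrow> Phi f \<in> bs.D"
  by (simp add: Phi_def bs.e_in_D phi_in_Ka)

lemma Phi_J: "f \<in> J \<Longrightarrow> Phi f \<in> bs.SI"
  using phi_J phi_in_Ka J.ideal_sub by (simp add: Phi_def bs.e_in_SI_iff)

lemma Phi_unit: "s \<in> S \<Longrightarrow> \<exists>d\<in>bs.D. Phi s * d - 1 \<in> bs.SI"
proof (rule bs.unit_mod_SI)
  assume s: "s \<in> S"
  then show "Phi s \<in> bs.D" by (simp add: Phi_in_D S_iff)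
  show "lookup (Phi s) 0 \<noteq> 0"
    using s by (simp add: S_iff Phi_def lookup_zero_e phi_in_Ka lookup_zero_phi)
qed

lemma Phi_free: "f \<in> Kf \<Longrightarrow> Phi f = mconst (emb f)"
  by (simp add: Phi_def phi_free)

subsection \<open>Surjectivity\<close>

text \<open>The part of \<open>Ka\<close> known to be reached, since its elements are fractions of
  values of \<open>phi\<close>. Surjectivity amounts to approximating \<open>Ka\<close> by it to
  high order.\<close>

definition B0 :: "(nat \<times> nat, 'k jet_poly fract) mpoly set" where
  "B0 = ring_gen (mconst ` K \<union> (\<lambda>v. phi (mvar v)) ` low)"

sublocale B0: usubring B0 unfolding B0_def by (rule usubring_ring_gen)

lemma mconst_in_B0: "c \<in> K \<Longrightarrow> mconst c \<in> B0"
  unfolding B0_def by (intro gen_incl) auto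

lemma B0_sub: "x \<in> B0 \<Longrightarrow> x \<in> bs.Ka"
proof -
  have "B0 \<subseteq> bs.Ka"
    unfolding B0_def using low_sub
    by (intro ring_gen_minimal bs.Ka.usubring_axioms) (auto intro: bs.mconst_in_Ka phi_in_Ka mvar_in_R)
  then show "x \<in> B0 \<Longrightarrow> x \<in> bs.Ka" by auto
qed

definition approx :: "nat \<Rightarrow> (nat \<times> nat, 'k jet_poly fract) mpoly set" where
  "approx k = {x \<in> UNIV. \<exists>y\<in>B0. x - y \<in> order_ge low k}"

lemma usubring_approx: "usubring (approx k)"
proof -
  interpret O: uideal UNIV "order_ge low k :: (nat \<times> nat, 'k jet_poly fract) mpoly set" by (rule uideal_order_ge)
  show ?thesis unfolding approx_def by (rule O.congruent_subring[OF B0.usubring_axioms]) simp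
qed

lemma B0_approx: "x \<in> B0 \<Longrightarrow> x \<in> approx k"
  unfolding approx_def using order_ge_zero by (auto intro!: bexI[of _ x])

text \<open>For elements of positive order a product is approximated one order better than its
  factors; this gain drives the induction in \<open>Ka_approx\<close>.\<close>

lemma approx_mult:
  assumes "x \<in> approx k" "y \<in> approx k" "x \<in> order_ge low 1" "y \<in> order_ge low 1" "k \<ge> 1"
  shows "x * y \<in> approx (Suc k)"
proof -
  obtain a b where ab: "a \<in> B0" "b \<in> B0" "x - a \<in> order_ge low k" "y - b \<in> order_ge low k"
    using assms by (auto simp: approx_def)
  interpret O: uideal UNIV "order_ge low 1 :: (nat \<times> nat, 'k jet_poly fract) mpoly set" by (rule uideal_order_ge)
  interpret Ok: uideal UNIV "order_ge low (Suc k) :: (nat \<times> nat, 'k jet_poly fract) mpoly set" by (rule uideal_order_ge)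
  have "y - b \<in> order_ge low 1" using ab(4) assms(5) by (rule order_ge_antimono)
  then have b: "b \<in> order_ge low 1" using O.ideal_cong assms(4) by blast
  have "x * (y - b) \<in> order_ge low (Suc k)" using order_ge_mult[OF assms(3) ab(4)] by simp
  moreover have "(x - a) * b \<in> order_ge low (Suc k)" using order_ge_mult[OF ab(3) b] by simp
  ultimately have "x * (y - b) + (x - a) * b \<in> order_ge low (Suc k)" by (rule Ok.ideal_add)
  then have "x * y - a * b \<in> order_ge low (Suc k)" by (simp add: algebra_simps)
  then show ?thesis using B0.mult_in[OF ab(1,2)] by (auto simp: approx_def)
qed

text \<open>Modulo the a-variables \<open>G i\<close> is t^(lam i), so there the quotient is just
  \<open>Xhi i\<close> shifted down. This gives the linear parts of the coefficients of
  \<open>rest i\<close>.\<close>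

lemma quo_split:
  assumes i: "i \<in> {1..n}"
  shows "coeff (quo i) b - mconst (emb (xc i (lam i + b))) \<in> order_ge low 1"
proof -
  interpret O: uideal UNIV "order_ge low 1 :: (nat \<times> nat, 'k jet_poly fract) mpoly set" by (rule uideal_order_ge)
  have "coeff (Xhi i) (lam i + b) = coeff (bs.G i * quo i) (lam i + b)"
    using quo_rest(3,4)[OF i] by simp
  also have "\<dots> = coeff (quo i) b + (\<Sum>a<lam i. coeff (bs.G i) a * coeff (quo i) (lam i + b - a))"
    unfolding bs.G_def by (rule coeff_monic_mult[OF monic_of_generic_poly])
  finally have "coeff (quo i) b - mconst (emb (xc i (lam i + b))) =
      - (\<Sum>a<lam i. coeff (quo i) (lam i + b - a) * mvar (i, a))"
    by (simp add: coeff_Xhi bs.G_def coeff_generic_poly mult.commute)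
  also have "\<dots> \<in> order_ge low 1"
    using i by (intro O.ideal_uminus O.ideal_sum O.ideal_mult order_ge_mvar) (auto simp: bs.low_def)
  finally show ?thesis .
qed

text \<open>Successive approximation on the order, starting from 0 as an approximation of every
  variable. Within one order the variables of a block are treated by increasing index, since the
  linear system is triangular.\<close>

lemma Ka_approx: "x \<in> bs.Ka \<Longrightarrow> x \<in> approx (Suc k)"
proof (induction k arbitrary: x)
  case 0
  have "bs.Ka \<subseteq> approx 1"
    unfolding bs.Ka_def mpoly_over_eq_ring_gen[OF usubring_K]
  proof (rule ring_gen_minimal[OF usubring_approx])
    have "mvar v \<in> approx 1" if "v \<in> low" for v
      unfolding approx_def using that B0.zero_in order_ge_mvar by (auto intro!: bexI[of _ 0])
    then show "mconst ` K \<union> mvar ` low \<subseteq> approx 1" by (auto intro: B0_approx mconst_in_B0)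
  qed
  then show ?case using 0 by auto
next
  case (Suc k)
  interpret A: usubring "approx (Suc (Suc k))" by (rule usubring_approx)
  have gens: "mvar (i, j) \<in> approx (Suc (Suc k))" if i: "i \<in> {1..n}" and j: "j < lam i" for i j
    using j
  proof (induction j rule: less_induct)
    case (less j)
    let ?c = "\<lambda>b. emb (xc i (lam i + b))"
    let ?u = "\<lambda>b. coeff (quo i) b - mconst (?c b)"
    have cK: "?c b \<in> K" for b using emb_xc_in_K[OF i] by simp
    have c_B0: "mconst (?c b) \<in> approx (Suc (Suc k))" for b by (intro B0_approx mconst_in_B0 cK)
    have "phi (mvar (i, j)) = coeff (map_poly phi (Xp i)) j"
      using less.prems lam_le[OF i] by (simp add: coeff_Xp xc_def)
    also have "\<dots> = (\<Sum>a\<le>j. coeff (bs.G i) a * coeff (quo i) (j - a))"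
      by (simp add: map_phi_Xp[OF i] coeff_mult)
    also have "\<dots> = (\<Sum>a\<le>j. mvar (i, a) * mconst (?c (j - a)) + mvar (i, a) * ?u (j - a))"
      using less.prems by (intro sum.cong) (auto simp: bs.G_def coeff_generic_poly algebra_simps)
    also have "\<dots> = (\<Sum>a<j. mvar (i, a) * mconst (?c (j - a))) + mvar (i, j) * mconst (?c 0) +
        (\<Sum>a\<le>j. mvar (i, a) * ?u (j - a))"
      by (simp add: sum.distrib lessThan_Suc_atMost[symmetric])
    \<comment> \<open>Solved for the diagonal term: the first sum is covered by the induction on
      \<open>j\<close>, while the second has order two and is covered by \<open>approx_mult\<close>
      and the outer induction. The diagonal entry \<open>?c 0\<close> is a nonzero element of
      \<open>K\<close>.\<close>
    finally have eq: "mvar (i, j) * mconst (?c 0) = phi (mvar (i, j)) -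
        (\<Sum>a<j. mvar (i, a) * mconst (?c (j - a))) - (\<Sum>a\<le>j. mvar (i, a) * ?u (j - a))"
      by simp
    have ij: "(i, a) \<in> low" if "a \<le> j" for a using i less.prems that by (simp add: bs.low_def)
    have "phi (mvar (i, j)) \<in> approx (Suc (Suc k))"
      using ij[of j] by (intro B0_approx) (auto simp: B0_def intro: gen_incl)
    moreover have "(\<Sum>a<j. mvar (i, a) * mconst (?c (j - a))) \<in> approx (Suc (Suc k))"
      using less by (intro A.sum_in A.mult_in c_B0) auto
    moreover have "(\<Sum>a\<le>j. mvar (i, a) * ?u (j - a)) \<in> approx (Suc (Suc k))"
    proof (rule A.sum_in)
      fix a assume a: "a \<in> {..j}"
      have "?u (j - a) \<in> bs.Ka"
        using cpolyD[OF quo_rest(1)[OF i]] cK by (intro bs.Ka.diff_in bs.mconst_in_Ka)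
      then show "mvar (i, a) * ?u (j - a) \<in> approx (Suc (Suc k))"
        using a ij by (intro approx_mult Suc.IH bs.mvar_in_Ka order_ge_mvar quo_split[OF i]) auto
    qed
    ultimately have "mvar (i, j) * mconst (?c 0) \<in> approx (Suc (Suc k))"
      unfolding eq by (intro A.diff_in)
    then have "mvar (i, j) * mconst (?c 0) * mconst (inverse (?c 0)) \<in> approx (Suc (Suc k))"
      by (rule A.mult_in) (rule B0_approx[OF mconst_in_B0[OF K_inverse[OF cK]]])
    moreover have "mconst (?c 0) * mconst (inverse (?c 0)) = (1 :: (nat \<times> nat, 'k jet_poly fract) mpoly)"
    proof -
      have "?c 0 \<noteq> 0" using S_neq_0[OF xc_lam_in_S[OF i]] by simp
      then show ?thesis
        using ring_map.map_mult[OF ring_map_mconst, of "?c 0" "inverse (?c 0)", where ?'v1 = "nat \<times> nat"] by simp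
    qed
    ultimately show ?case by (simp add: mult.assoc)
  qed
  have "bs.Ka \<subseteq> approx (Suc (Suc k))"
    unfolding bs.Ka_def mpoly_over_eq_ring_gen[OF usubring_K]
    by (rule ring_gen_minimal[OF A.usubring_axioms])
      (auto simp: bs.low_def intro: B0_approx mconst_in_B0 gens)
  then show ?case using Suc.prems by auto
qed

text \<open>Common denominators. The statement is multiplied out because \<open>phi s\<close> need
  not be a unit of \<open>Ka\<close>.\<close>

lemma B0_fraction: "b \<in> B0 \<Longrightarrow> \<exists>f\<in>R. \<exists>s\<in>S. phi f = phi s * b"
  unfolding B0_def
proof (induction rule: ring_gen.induct)
  case gen_one
  have "phi 1 = phi 1 * 1" by simp
  then show ?case using R.one_in S_one by blast
next
  case (gen_incl x)
  then consider c where "c \<in> K" "x = mconst c" | v where "v \<in> low" "x = phi (mvar v)" by auto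
  then show ?case
  proof cases
    case 1
    obtain f g where fg: "f \<in> Kf" "g \<in> Kf" "g \<noteq> 0" "c = Fract f g"
      using K_eq_quotient[OF 1(1)] by blast
    then have "emb f = emb g * c" by (simp add: Fract_eq_emb)
    then have "phi f = phi g * x"
      using 1 fg ring_map.map_mult[OF ring_map_mconst, of "emb g" c, where ?'v1 = "nat \<times> nat"] by (simp add: phi_free)
    then show ?thesis using free_poly_in_R[OF fg(1)] free_poly_in_S[OF fg(2,3)] by blast
  next
    case 2
    then have "mvar v \<in> R" "phi (mvar v) = phi 1 * x"
      using low_sub by (auto simp: phi.map_one intro: mvar_in_R)
    then show ?thesis using S_one by blast
  qed
next
  case (gen_diff x y)
  then obtain f s g t where "f \<in> R" "s \<in> S" "phi f = phi s * x" "g \<in> R" "t \<in> S" "phi g = phi t * y" by blast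
  moreover from this have "phi (f * t - g * s) = phi (s * t) * (x - y)"
    by (simp add: phi.map_minus phi.map_mult algebra_simps)
  moreover from calculation have "f * t - g * s \<in> R" "s * t \<in> S"
    by (auto simp: S_iff intro!: R.diff_in R.mult_in S_mult[unfolded S_iff])
  ultimately show ?case by blast
next
  case (gen_mult x y)
  then obtain f s g t where "f \<in> R" "s \<in> S" "phi f = phi s * x" "g \<in> R" "t \<in> S" "phi g = phi t * y" by blast
  moreover from this have "phi (f * g) = phi (s * t) * (x * y)"
    by (simp add: phi.map_mult algebra_simps)
  moreover from calculation have "f * g \<in> R" "s * t \<in> S"
    by (auto intro!: R.mult_in S_mult)
  ultimately show ?case by blast
qed

text \<open>At order \<open>bs.order_bound\<close> the approximation error lies in
  \<open>bs.SI\<close>, so an approximation from \<open>B0\<close> is as good as the element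
  itself.\<close>

lemma Phi_surjective:
  assumes "d \<in> bs.D"
  shows "\<exists>f\<in>R. \<exists>s\<in>S. Phi f - Phi s * d \<in> bs.SI"
proof -
  obtain p where p: "p \<in> bs.Ka" "d = bs.e p" using assms bs.D_eq_image by auto
  have "p \<in> approx bs.order_bound" using Ka_approx[OF p(1)] by (simp add: bs.order_bound_def)
  then obtain b where b: "b \<in> B0" "p - b \<in> order_ge low bs.order_bound" by (auto simp: approx_def)
  then obtain f s where fs: "f \<in> R" "s \<in> S" "phi f = phi s * b" using B0_fraction by blast
  have pb: "p - b \<in> bs.Ka" using p b B0_sub by (intro bs.Ka.diff_in)
  have "bs.e (p - b) \<in> bs.SI"
    using bs.e_in_D[OF pb] bs.e_order_ge[OF pb b(2)] by (intro bs.high_order_in_SI) (auto simp: bs.mem_D_iff)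
  then have "- (Phi s * bs.e (p - b)) \<in> bs.SI"
    using Phi_in_D[of s] fs by (intro bs.SI.ideal_uminus bs.SI.ideal_mult) (auto simp: bs.mem_D_iff S_iff)
  also have "- (Phi s * bs.e (p - b)) = Phi f - Phi s * d"
    using fs p by (simp add: Phi_def bs.e.map_mult bs.e.map_minus algebra_simps)
  finally show ?thesis using fs by blast
qed

section \<open>Injectivity\<close>

abbreviation fracs where "fracs A \<equiv> fractions A S"
text \<open>\<open>R\<close> localized at the prime, realized inside the field of fractions; working
  modulo \<open>Jp\<close> replaces the localized quotient.\<close>

abbreviation Rp where "Rp \<equiv> fracs R"
abbreviation Jp where "Jp \<equiv> fracs J"

lemma fracsI: "f \<in> A \<Longrightarrow> g \<in> S \<Longrightarrow> Fract f g \<in> fracs A"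
  by (auto simp: fractions_def)

lemma emb_in_fracs: "f \<in> A \<Longrightarrow> emb f \<in> fracs A"
  unfolding emb_def by (rule fracsI[OF _ S_one])

lemma S_sub: "s \<in> S \<Longrightarrow> s \<in> R"
  by (simp add: S_iff)

sublocale Rp: usubring Rp
  by (rule usubring_fractions[OF R.usubring_axioms _ S_one S_mult]) (auto dest: S_sub S_neq_0)

lemma uideal_fracs:
  assumes "uideal R A"
  shows "uideal Rp (fracs A)"
proof -
  interpret A: uideal R A by fact
  show ?thesis
  proof
    show "x \<in> fracs A \<Longrightarrow> x \<in> Rp" for x using A.ideal_sub by (auto simp: fractions_def)
    show "0 \<in> fracs A" using emb_in_fracs[OF A.ideal_zero] by (simp add: emb.map_zero)
    show "x + y \<in> fracs A" if "x \<in> fracs A" "y \<in> fracs A" for x y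
    proof -
      obtain f g f' g' where fg: "f \<in> A" "g \<in> S" "x = Fract f g" "f' \<in> A" "g' \<in> S" "y = Fract f' g'"
        using \<open>x \<in> fracs A\<close> \<open>y \<in> fracs A\<close> by (auto simp: fractions_def)
      then have ne: "g \<noteq> 0" "g' \<noteq> 0" using S_neq_0 by auto
      have "f * g' + f' * g \<in> A" using fg S_sub by (intro A.ideal_add A.ideal_mult_right) auto
      then show ?thesis using fg ne fracsI[OF _ S_mult[OF fg(2,5)]] by simp
    qed
    show "x * y \<in> fracs A" if "x \<in> Rp" "y \<in> fracs A" for x y
    proof -
      obtain f g f' g' where fg: "f \<in> R" "g \<in> S" "x = Fract f g" "f' \<in> A" "g' \<in> S" "y = Fract f' g'"
        using \<open>x \<in> Rp\<close> \<open>y \<in> fracs A\<close> by (auto simp: fractions_def)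
      have "f * f' \<in> A" using fg by (intro A.ideal_mult)
      then show ?thesis using fg fracsI[OF _ S_mult[OF fg(2,5)]] by simp
    qed
  qed
qed

sublocale Jp: uideal Rp Jp by (rule uideal_fracs[OF J.uideal_axioms])

text \<open>The powers of the maximal ideal of \<open>Rp\<close>.\<close>

definition N :: "nat \<Rightarrow> 'k jet_poly fract set" where
  "N k = fracs (R \<inter> order_ge low k)"

lemma uideal_R_order_ge: "uideal R (R \<inter> order_ge low k)"
proof -
  interpret O: uideal UNIV "order_ge low k :: 'k jet_poly set" by (rule uideal_order_ge)
  show ?thesis by standard (auto intro: R.closed O.ideal_zero O.ideal_add O.ideal_mult)
qed

sublocale filt: ideal_filtration Rp N
proof (intro ideal_filtration.intro ideal_filtration_axioms.intro Rp.usubring_axioms)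
  show "uideal Rp (N k)" for k unfolding N_def by (rule uideal_fracs[OF uideal_R_order_ge])
  show "x \<in> N (Suc k) \<Longrightarrow> x \<in> N k" for x k
    unfolding N_def fractions_def using order_ge_antimono[of _ low "Suc k" k] by auto
  show "x * y \<in> N (j + k)" if "x \<in> N j" "y \<in> N k" for x y j k
  proof -
    obtain f g f' g' where fg: "f \<in> R" "f \<in> order_ge low j" "g \<in> S" "x = Fract f g"
      "f' \<in> R" "f' \<in> order_ge low k" "g' \<in> S" "y = Fract f' g'"
      using \<open>x \<in> N j\<close> \<open>y \<in> N k\<close> by (auto simp: N_def fractions_def)
    have "f * f' \<in> R \<inter> order_ge low (j + k)"
      using R.mult_in[OF fg(1,5)] order_ge_mult[OF fg(2,6)] by blast
    from fracsI[OF this S_mult[OF fg(3,7)]] show ?thesis unfolding N_def fg(4,8) by simp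
  qed
qed

lemma Rp_unit: "s \<in> S \<Longrightarrow> \<exists>w\<in>Rp. emb s * w = 1"
  using fracsI[OF R.one_in] S_neq_0[of s]
  by (intro bexI[of _ "Fract 1 s"]) (auto simp: emb_def One_fract_def eq_fract)

text \<open>Locality of \<open>Rp\<close>: over a common denominator the numerator is
  \<open>s * b + a\<close>, and \<open>rho\<close> kills \<open>a\<close> but neither
  \<open>s\<close> nor \<open>b\<close>.\<close>

lemma near_unit:
  assumes s: "s \<in> S" and u: "u - emb s \<in> N 1"
  shows "\<exists>w\<in>Rp. u * w = 1"
proof -
  obtain a b where ab: "a \<in> R" "a \<in> order_ge low 1" "b \<in> S" "u - emb s = Fract a b"
    using u by (auto simp: N_def fractions_def)
  have b: "b \<noteq> 0" using S_neq_0 ab by auto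
  define c where "c = s * b + a"
  have "c \<in> S"
    using s ab rho_order_ge[OF ab(2)]
    by (auto simp: c_def S_iff rho.map_add rho.map_mult intro: R.closed)
  then have c: "c \<noteq> 0" by (rule S_neq_0)
  have "u = emb s + Fract a b" using ab(4) by (simp add: algebra_simps)
  also have "\<dots> = Fract c b" using b by (simp add: emb_def c_def)
  finally have "u * Fract b c = 1" using b c by (simp add: One_fract_def eq_fract)
  then show ?thesis using fracsI[OF S_sub[OF ab(3)] \<open>c \<in> S\<close>] by blast
qed

lemma emb_Xp_in_cpoly: "i \<in> {1..n} \<Longrightarrow> map_poly emb (Xp i) \<in> cpoly Rp"
  by (intro cpolyI) (simp add: coeff_Xp emb_in_fracs xc_in_R)

lemma coeff_prod_emb_Xp: "s \<le> m \<Longrightarrow> coeff (\<Prod>i\<in>{1..n}. map_poly emb (Xp i)) s \<in> Jp"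
proof -
  interpret mp: ring_map "map_poly emb" by (rule emb.ring_map_map_poly)
  have "coeff (\<Prod>i\<in>{1..n}. map_poly emb (Xp i)) s = emb (coeff (\<Prod>i\<in>{1..n}. Xp i) s)"
    by (simp flip: mp.map_prod)
  moreover assume "s \<le> m"
  ultimately show "coeff (\<Prod>i\<in>{1..n}. map_poly emb (Xp i)) s \<in> Jp"
    using emb_in_fracs[OF coeff_prod_Xp_in_J] by (simp only:)
qed

text \<open>A suitable product of jet coefficients, one from each jet, lies in the radical because
  its indices add up to at most \<open>m\<close>; all its factors other than the given variable are
  units.\<close>

lemma low_nilpotent:
  assumes v: "v \<in> low"
  shows "\<exists>M. emb (mvar v) ^ M \<in> Jp"
proof -
  interpret Rad: uideal Rp "radical_of Rp Jp" by (rule Jp.uideal_radical)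
  interpret Rad: radical_uideal Rp "radical_of Rp Jp"
    by standard (rule radical_of_square)
  obtain i j where ij: "v = (i, j)" "i \<in> {1..n}" "j < lam i" using v by (auto simp: bs.low_def)
  \<comment> \<open>Index \<open>lam k\<close> everywhere except at \<open>i\<close>, where the
    smaller \<open>j\<close> brings the total down from \<open>m + 1\<close> to at most
    \<open>m\<close>.\<close>
  define js where "js k = (if k = i then j else lam k)" for k
  have "(\<Sum>k\<in>{1..n}. js k) = j + (\<Sum>k\<in>{1..n} - {i}. lam k)"
    using ij by (subst sum.remove[of _ i]) (auto simp: js_def intro!: sum.cong)
  moreover have "(\<Sum>k\<in>{1..n}. lam k) = lam i + (\<Sum>k\<in>{1..n} - {i}. lam k)"
    using ij by (subst sum.remove[of _ i]) auto
  ultimately have le: "(\<Sum>k\<in>{1..n}. js k) \<le> m" using sum_lam ij by simp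
  have "1 * (\<Prod>k\<in>{1..n}. coeff (map_poly emb (Xp k)) (js k)) \<in> radical_of Rp Jp"
  proof (rule Rad.coeff_prod_in_radical[OF _ _ Rp.one_in _ le])
    show "1 * coeff (\<Prod>k\<in>{1..n}. map_poly emb (Xp k)) s \<in> radical_of Rp Jp" if "s \<le> m" for s
      using coeff_prod_emb_Xp[OF that] Jp.ideal_sub
      unfolding radical_of_def by (auto intro!: exI[of _ 1])
  qed (simp_all add: emb_Xp_in_cpoly)
  also have "1 * (\<Prod>k\<in>{1..n}. coeff (map_poly emb (Xp k)) (js k)) =
      emb (mvar v) * (\<Prod>k\<in>{1..n} - {i}. emb (xc k (lam k)))"
  proof -
    have "coeff (map_poly emb (Xp i)) (js i) = emb (mvar v)"
      using ij lam_le[OF ij(2)] by (simp add: coeff_Xp js_def xc_def)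
    moreover have "(\<Prod>k\<in>{1..n} - {i}. coeff (map_poly emb (Xp k)) (js k)) =
        (\<Prod>k\<in>{1..n} - {i}. emb (xc k (lam k)))"
      by (intro prod.cong) (auto simp: coeff_Xp js_def)
    ultimately show ?thesis using ij by (subst prod.remove[of _ i]) auto
  qed
  finally have rad: "emb (mvar v) * emb (\<Prod>k\<in>{1..n} - {i}. xc k (lam k)) \<in> radical_of Rp Jp"
    by (simp add: emb.map_prod)
  have "(\<Prod>k\<in>A. xc k (lam k)) \<in> S" if "A \<subseteq> {1..n}" for A
    using finite_subset[OF that finite_atLeastAtMost] that
    by (induction A rule: finite_induct) (auto intro: S_one intro!: S_mult xc_lam_in_S)
  then obtain w where w: "w \<in> Rp" "emb (\<Prod>k\<in>{1..n} - {i}. xc k (lam k)) * w = 1"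
    using Rp_unit by (metis Diff_subset)
  have "emb (mvar v) * emb (\<Prod>k\<in>{1..n} - {i}. xc k (lam k)) * w \<in> radical_of Rp Jp"
    by (rule Rad.ideal_mult_right[OF rad w(1)])
  then have "emb (mvar v) \<in> radical_of Rp Jp" using w(2) by (simp add: mult.assoc)
  then show ?thesis by (simp add: radical_of_def)
qed

text \<open>With finitely many nilpotent generators a power of the maximal ideal lies in
  \<open>Jp\<close>, so Weierstrass factorization to finite precision is exact modulo
  \<open>Jp\<close>.\<close>

lemma N_sub_Jp: "\<exists>k. N (Suc k) \<subseteq> Jp"
proof -
  obtain Mv where Mv: "\<And>v. v \<in> low \<Longrightarrow> emb (mvar v) ^ Mv v \<in> Jp" using low_nilpotent by metis
  \<comment> \<open>The sum serves as a common upper bound for the nilpotency exponents.\<close>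
  define M where "M = (\<Sum>v\<in>low. Mv v)"
  have emb_low: "emb (mvar v) \<in> Rp" if "v \<in> V" for v by (rule emb_in_fracs[OF mvar_in_R[OF that]])
  have M: "emb (mvar v) ^ M \<in> Jp" if "v \<in> low" for v
  proof (rule Jp.ideal_power_le[OF _ Mv[OF that]])
    show "emb (mvar v) \<in> Rp" by (rule emb_low[OF subsetD[OF low_sub that]])
    show "Mv v \<le> M" unfolding M_def by (rule member_le_sum[OF that]) (simp_all add: finite_low)
  qed
  have "N (Suc (M * card low)) \<subseteq> Jp"
  proof
    fix x assume "x \<in> N (Suc (M * card low))"
    then obtain f g where fg: "f \<in> R" "f \<in> order_ge low (Suc (M * card low))" "g \<in> S" "x = Fract f g"
      by (auto simp: N_def fractions_def)
    have "emb f \<in> Jp"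
    proof (rule high_order_in_ideal[OF emb.ring_map_axioms Jp.uideal_axioms])
      show "f \<in> mpoly_over UNIV V" using fg(1) by (simp add: R_def)
      show "emb (mconst c) \<in> Rp" for c by (rule emb_in_fracs[OF mconst_in_R])
    qed (use emb_low M fg finite_low in auto)
    then have "emb f * Fract 1 g \<in> Jp" by (rule Jp.ideal_mult_right) (rule fracsI[OF R.one_in fg(3)])
    then show "x \<in> Jp" using fg by (simp add: emb_def)
  qed
  then show ?thesis by blast
qed

lemma weierstrass_mod_Jp:
  assumes i: "i \<in> {1..n}"
  shows "\<exists>q v. q \<in> cpoly Rp \<and> v \<in> cpoly Rp \<and> monic_of (lam i) q \<and> (\<exists>w\<in>Rp. coeff v 0 * w = 1) \<and>
    map_poly emb (Xp i) - q * v \<in> cpoly Jp"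
proof -
  obtain k where k: "N (Suc k) \<subseteq> Jp" using N_sub_Jp by blast
  have "\<exists>q\<in>cpoly Rp. \<exists>v\<in>cpoly Rp. monic_of (lam i) q \<and> (\<forall>j<lam i. coeff q j \<in> N 1) \<and>
      coeff v 0 - coeff (map_poly emb (Xp i)) (lam i) \<in> N 1 \<and>
      map_poly emb (Xp i) - q * v \<in> cpoly (N (Suc k))"
  proof (rule filt.weierstrass_factorization[OF emb_Xp_in_cpoly[OF i]])
    fix j assume j: "j < lam i"
    then have "(i, j) \<in> low" "j \<le> m" using i lam_le[OF i] by (auto simp: bs.low_def)
    then show "coeff (map_poly emb (Xp i)) j \<in> N 1"
      unfolding N_def using low_sub
      by (auto simp: coeff_Xp xc_def intro!: emb_in_fracs mvar_in_R order_ge_mvar[simplified])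
  next
    show "\<exists>w\<in>Rp. u * w = 1" if "u - coeff (map_poly emb (Xp i)) (lam i) \<in> N 1" for u
      using near_unit[OF xc_lam_in_S[OF i]] that by (simp add: coeff_Xp)
  qed
  then obtain q v where qv: "q \<in> cpoly Rp" "v \<in> cpoly Rp" "monic_of (lam i) q"
      "coeff v 0 - emb (xc i (lam i)) \<in> N 1" "map_poly emb (Xp i) - q * v \<in> cpoly (N (Suc k))"
    by (auto simp: coeff_Xp)
  moreover have "\<exists>w\<in>Rp. coeff v 0 * w = 1" using near_unit[OF xc_lam_in_S[OF i] qv(4)] .
  moreover have "map_poly emb (Xp i) - q * v \<in> cpoly Jp" using qv(5) k by (auto simp: cpoly_def)
  ultimately show ?thesis by blast
qed

text \<open>The Weierstrass polynomials of the jets define a homomorphism \<open>psi\<close> from \<open>K[a]\<close> to the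
  localized jet ring which is a left inverse of \<open>phi\<close> modulo the jet ideal.\<close>

lemma phi_injective:
  assumes f: "f \<in> R" and phi_f: "phi f \<in> bs.Ic"
  shows "\<exists>u\<in>S. u * f \<in> J"
proof -
  have "\<forall>i\<in>{1..n}. \<exists>q v. q \<in> cpoly Rp \<and> v \<in> cpoly Rp \<and> monic_of (lam i) q \<and>
      (\<exists>w\<in>Rp. coeff v 0 * w = 1) \<and> map_poly emb (Xp i) - q * v \<in> cpoly Jp"
    using weierstrass_mod_Jp by blast
  then obtain W v where Wv: "\<And>i. i \<in> {1..n} \<Longrightarrow> W i \<in> cpoly Rp \<and> v i \<in> cpoly Rp \<and> monic_of (lam i) (W i) \<and>
      (\<exists>w\<in>Rp. coeff (v i) 0 * w = 1) \<and> map_poly emb (Xp i) - W i * v i \<in> cpoly Jp"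
    by metis
  interpret cJ: uideal "cpoly Rp" "cpoly Jp" by (rule Jp.uideal_cpoly)
  define psi where "psi = meval (\<lambda>x. x) (\<lambda>(i, k). coeff (W i) k)"
  interpret psi: ring_map psi unfolding psi_def by (rule ring_map.ring_map_meval[OF ring_map_id])
  interpret mpsi: ring_map "map_poly psi" by (rule psi.ring_map_map_poly)
  have psi_mconst: "psi (mconst c) = c" for c
    unfolding psi_def by (rule ring_map.meval_mconst[OF ring_map_id])
  have psi_mvar: "psi (mvar (i, k)) = coeff (W i) k" for i k
    unfolding psi_def by (subst ring_map.meval_mvar[OF ring_map_id]) simp
  have K_Rp: "c \<in> Rp" if c: "c \<in> K" for c
  proof -
    obtain f g where "f \<in> Kf" "g \<in> Kf" "g \<noteq> 0" "c = Fract f g"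
      using K_eq_quotient[OF c] by blast
    then show ?thesis by (auto intro: fracsI free_poly_in_R free_poly_in_S)
  qed
  have psi_Ka: "psi x \<in> Rp" if "x \<in> bs.Ka" for x
    using that unfolding bs.Ka_def
  proof (rule ring_map_mpoly_over_into[OF usubring_K psi.ring_map_axioms Rp.usubring_axioms, rotated 2])
    show "psi (mvar v) \<in> Rp" if v: "v \<in> low" for v
    proof -
      obtain i k where "v = (i, k)" "i \<in> {1..n}" using v by (auto simp: bs.low_def)
      then show ?thesis using Wv by (auto simp: psi_mvar dest: cpolyD)
    qed
  qed (simp add: psi_mconst K_Rp)
  have psi_cpoly: "map_poly psi p \<in> cpoly Rp" if "p \<in> cpoly bs.Ka" for p
    using that psi_Ka by (auto simp: cpoly_def)
  have psi_G: "map_poly psi (bs.G i) = W i" if i: "i \<in> {1..n}" for i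
  proof (rule poly_eqI)
    show "coeff (map_poly psi (bs.G i)) k = coeff (W i) k" for k
      using Wv[OF i]
      by (auto simp: bs.G_def coeff_generic_poly psi_mvar psi.map_one psi.map_zero monic_of_def)
  qed
  have psi_rest: "psi (coeff (rest i) j) + emb (mvar (i, j)) \<in> Jp" if i: "i \<in> {1..n}" and j: "j < lam i" for i j
  proof -
    define F where "F = map_poly emb (Xp i)"
    define lo where "lo = poly_cutoff (lam i) F"
    have "map_poly psi (Xhi i) = F - lo"
      by (rule poly_eqI) (simp add: F_def lo_def coeff_Xhi coeff_poly_cutoff coeff_Xp psi_mconst psi.map_zero)
    moreover have "map_poly psi (Xhi i) = W i * map_poly psi (quo i) + map_poly psi (rest i)"
      using quo_rest(3)[OF i] by (simp add: mpsi.map_add mpsi.map_mult psi_G[OF i])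
    \<comment> \<open>Both \<open>W i * v i\<close> and the \<open>psi\<close>-image of the division
      account for the jet; subtracting them leaves a multiple of \<open>W i\<close> congruent to a
      polynomial of degree below \<open>lam i\<close>, to which uniqueness of division
      applies.\<close>
    ultimately have eq: "W i * (v i - map_poly psi (quo i)) - (map_poly psi (rest i) + lo) = - (F - W i * v i)"
      by (simp add: algebra_simps)
    have "map_poly psi (rest i) + lo \<in> cpoly Jp"
    proof (rule Jp.monic_mult_mod(2)[of "lam i" "W i" "v i - map_poly psi (quo i)"])
      show "v i - map_poly psi (quo i) \<in> cpoly Rp"
        using Wv[OF i] quo_rest(1)[OF i] by (intro cJ.diff_in psi_cpoly) auto
      show "coeff (map_poly psi (rest i) + lo) k = 0" if "k \<ge> lam i" for k
        using that quo_rest(4)[OF i that] by (simp add: lo_def coeff_poly_cutoff psi.map_zero)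
      show "W i * (v i - map_poly psi (quo i)) - (map_poly psi (rest i) + lo) \<in> cpoly Jp"
        unfolding eq using Wv[OF i] by (intro cJ.ideal_uminus) (simp add: F_def)
    qed (use Wv[OF i] in auto)
    from cpolyD[OF this, of j] show ?thesis
      using j lam_le[OF i] by (simp add: lo_def F_def coeff_poly_cutoff coeff_Xp xc_def)
  qed
  have psi_phi: "psi (phi g) - emb g \<in> Jp" if "g \<in> R" for g
  proof -
    have "ring_map (psi \<circ> phi)" by (rule ring_map_comp[OF psi.ring_map_axioms phi.ring_map_axioms])
    then have "(psi \<circ> phi) g - emb g \<in> Jp"
    proof (rule ring_maps_congruent_on_mpoly_over[OF usubring_UNIV _ emb.ring_map_axioms Jp.uideal_axioms
          _ _ that[unfolded R_def]])
      have into: "psi (phi g) \<in> Rp \<and> emb g \<in> Rp" if "g \<in> R" for g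
        using that by (simp add: psi_Ka phi_in_Ka emb_in_fracs)
      show "(psi \<circ> phi) (mconst c) \<in> Rp \<and> emb (mconst c) \<in> Rp \<and> (psi \<circ> phi) (mconst c) - emb (mconst c) \<in> Jp"
        for c using into[OF mconst_in_R] by (simp add: phi_mconst psi_mconst Jp.ideal_zero)
      show "(psi \<circ> phi) (mvar v) \<in> Rp \<and> emb (mvar v) \<in> Rp \<and> (psi \<circ> phi) (mvar v) - emb (mvar v) \<in> Jp"
        if v: "v \<in> V" for v
      proof -
        obtain i j where ij: "v = (i, j)" "i \<in> {1..n}" using v by (auto simp: V_def)
        have "psi (phi (mvar v)) - emb (mvar v) \<in> Jp"
        proof (cases "j < lam i")
          case True
          from Jp.ideal_uminus[OF psi_rest[OF ij(2) True]] show ?thesis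
            using True ij by (simp add: phi_mvar psi.map_uminus)
        qed (simp add: ij phi_mvar psi_mconst Jp.ideal_zero)
        then show ?thesis using into[OF mvar_in_R[OF v]] by simp
      qed
    qed
    then show ?thesis by simp
  qed
  \<comment> \<open>Modulo \<open>Jp\<close> the product of the jets is the product of the
    \<open>W i\<close> times that of the units \<open>v i\<close>. Its coefficients up to
    \<open>m\<close> vanish, and cancelling the unit leaves those of the product of the
    \<open>W i\<close>.\<close>
  have psi_Ec: "psi (bs.Ec s) \<in> Jp" if s: "s \<le> m" for s
  proof -
    have W: "(\<Prod>i\<in>{1..n}. W i) \<in> cpoly Rp" and v: "(\<Prod>i\<in>{1..n}. v i) \<in> cpoly Rp"
      using Wv by (auto intro!: cJ.prod_in)
    obtain w where w: "\<And>i. i \<in> {1..n} \<Longrightarrow> w i \<in> Rp \<and> coeff (v i) 0 * w i = 1"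
      using Wv by metis
    have "coeff (\<Prod>i\<in>{1..n}. v i) 0 = (\<Prod>i\<in>{1..n}. coeff (v i) 0)"
      by (simp add: poly_prod flip: poly_0_coeff_0)
    then have "(\<Prod>i\<in>{1..n}. w i) * coeff (\<Prod>i\<in>{1..n}. v i) 0 = (\<Prod>i\<in>{1..n}. coeff (v i) 0 * w i)"
      by (simp add: prod.distrib mult.commute)
    also have "\<dots> = 1" using w by simp
    finally have unit: "(\<Prod>i\<in>{1..n}. w i) * coeff (\<Prod>i\<in>{1..n}. v i) 0 - 1 \<in> Jp"
      by (simp add: Jp.ideal_zero)
    have "(\<Prod>i\<in>{1..n}. map_poly emb (Xp i)) - (\<Prod>i\<in>{1..n}. W i * v i) \<in> cpoly Jp"
      using Wv emb_Xp_in_cpoly by (intro cJ.ideal_prod_cong) (auto intro: cJ.mult_in)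
    then have prod: "coeff ((\<Prod>i\<in>{1..n}. W i) * (\<Prod>i\<in>{1..n}. v i)) k \<in> Jp" if "k \<le> m" for k
      using Jp.ideal_cong[OF coeff_prod_emb_Xp[OF that]] cpolyD[of _ Jp k]
      by (simp add: prod.distrib cpoly_def)
    have "(\<Prod>i\<in>{1..n}. w i) \<in> Rp" using w by (intro Rp.prod_in) auto
    from Jp.low_coeffs_cancel_unit[OF W v this unit prod s]
    have "coeff (\<Prod>i\<in>{1..n}. W i) s \<in> Jp" .
    moreover have "(\<Prod>i\<in>{1..n}. W i) = map_poly psi (\<Prod>i\<in>{1..n}. bs.G i)"
      by (simp add: mpsi.map_prod psi_G)
    ultimately show ?thesis by (simp add: bs.Ec_def)
  qed
  obtain h where h: "phi f = (\<Sum>k<Suc m. h k * bs.Ec k)" "\<forall>k<Suc m. h k \<in> bs.Ka"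
    using phi_f by (auto simp: bs.Ic_def lin_span_def)
  have "psi (phi f) = (\<Sum>k<Suc m. psi (h k) * psi (bs.Ec k))"
    unfolding h(1) by (simp only: psi.map_sum psi.map_mult)
  also have "\<dots> \<in> Jp" using h(2) psi_Ka psi_Ec by (intro Jp.ideal_sum Jp.ideal_mult) auto
  finally have "psi (phi f) \<in> Jp" .
  then have "emb f \<in> Jp" using Jp.ideal_cong psi_phi[OF f] by blast
  then obtain a s where as: "a \<in> J" "s \<in> S" "emb f = Fract a s" by (auto simp: fractions_def)
  then have "s * f = a" using S_neq_0[OF as(2)] by (simp add: emb_def eq_fract mult.commute)
  then show ?thesis using as by blast
qed

lemma Phi_injective: "f \<in> R \<Longrightarrow> Phi f \<in> bs.SI \<Longrightarrow> \<exists>u\<in>S. u * f \<in> J"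
  using phi_injective by (simp add: Phi_def bs.e_in_SI_iff phi_in_Ka)

section \<open>The isomorphism\<close>

text \<open>The definite description is well defined: two quotients representing one element of
  \<open>K\<close> agree after cross multiplication already in \<open>R\<close>, hence modulo
  \<open>J\<close>.\<close>

lemma jet_loc_map_Fract:
  assumes "f \<in> Kf" "g \<in> Kf" "g \<noteq> 0"
  shows "jet_loc_map n m lam (Fract f g) = loc.frac f g"
proof -
  have frac: "loc_frac (jet_quot n m) (jet_denoms n m lam) (jet_class n m a) (jet_class n m b) = loc.frac a b"
    for a b :: "'k jet_poly"
    unfolding loc.frac_def jet_quot_def jet_denoms_def jet_class_def jet_ring_eq J_def[symmetric]
    by (simp add: S_def)
  show ?thesis
    unfolding jet_loc_map_def frac
  proof (rule the_equality)
    show "\<exists>f' g'. f' \<in> Kf \<and> g' \<in> Kf \<and> g' \<noteq> 0 \<and>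
        Fract f g = Fract f' g' \<and> loc.frac f g = loc.frac f' g'"
      using assms by blast
    fix y assume "\<exists>f' g'. f' \<in> Kf \<and> g' \<in> Kf \<and> g' \<noteq> 0 \<and>
        Fract f g = Fract f' g' \<and> y = loc.frac f' g'"
    then obtain f' g' where fg': "f' \<in> Kf" "g' \<in> Kf" "g' \<noteq> 0"
      "Fract f g = Fract f' g'" "y = loc.frac f' g'" by blast
    have "f * g' = f' * g" using fg'(4) assms(3) fg'(3) by (simp add: eq_fract)
    then have "1 * (f' * g) - 1 * (f * g') \<in> J" using J.ideal_zero by simp
    then have "\<exists>u\<in>S. u * (f' * g) - u * (f * g') \<in> J" using S_one by blast
    then have "loc.frac f' g' = loc.frac f g"
      using loc.frac_eq_iff[OF free_poly_in_R[OF fg'(1)] free_poly_in_R[OF assms(1)]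
          free_poly_in_S[OF fg'(2,3)] free_poly_in_S[OF assms(2,3)]] by simp
    then show "y = loc.frac f g" using fg' by simp
  qed
qed

text \<open>The graph of the isomorphism: f/s corresponds to \<open>d\<close> when
  \<open>Phi f\<close> equals \<open>Phi s * d\<close> modulo \<open>bs.SI\<close>, which avoids
  inverting \<open>Phi s\<close>.\<close>

definition rel :: "('k jet_poly set \<times> 'k jet_poly set) set \<Rightarrow> (nat, 'k jet_poly fract) mpoly set \<Rightarrow> bool" where
  "rel x y \<longleftrightarrow> (\<exists>f\<in>R. \<exists>s\<in>S. \<exists>d\<in>bs.D. x = loc.frac f s \<and> y = qclass bs.P bs.SI d \<and>
     Phi f - Phi s * d \<in> bs.SI)"

lemma D_P: "d \<in> bs.D \<Longrightarrow> d \<in> bs.P"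
  by (simp add: bs.mem_D_iff)

lemma Phi_P: "f \<in> R \<Longrightarrow> Phi f \<in> bs.P"
  by (rule D_P[OF Phi_in_D])

lemma Phi_cancel:
  assumes s: "s \<in> S" and x: "x \<in> bs.P" and sx: "Phi s * x \<in> bs.SI"
  shows "x \<in> bs.SI"
proof -
  obtain d where d: "d \<in> bs.D" "Phi s * d - 1 \<in> bs.SI" using Phi_unit[OF s] by blast
  have "d * (Phi s * x) - x * (Phi s * d - 1) \<in> bs.SI"
    by (rule bs.SI.ideal_diff[OF bs.SI.ideal_mult[OF D_P[OF d(1)] sx] bs.SI.ideal_mult[OF x d(2)]])
  then show ?thesis by (simp add: algebra_simps)
qed

lemma relE:
  assumes "rel x y"
  obtains f s d where "f \<in> R" "s \<in> S" "d \<in> bs.D" "x = loc.frac f s" "y = qclass bs.P bs.SI d"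
    "Phi f - Phi s * d \<in> bs.SI"
  using assms unfolding rel_def by blast

lemma relI:
  "f \<in> R \<Longrightarrow> s \<in> S \<Longrightarrow> d \<in> bs.D \<Longrightarrow> Phi f - Phi s * d \<in> bs.SI \<Longrightarrow>
    rel (loc.frac f s) (qclass bs.P bs.SI d)"
  unfolding rel_def by blast

text \<open>One direction is well-definedness, from \<open>Phi_J\<close> and the invertibility of
  \<open>Phi s\<close>; the other is injectivity, from \<open>Phi_injective\<close>.\<close>

lemma rel_inj:
  assumes "rel x y" "rel x' y'"
  shows "x = x' \<longleftrightarrow> y = y'"
proof -
  obtain f s d where 1: "f \<in> R" "s \<in> S" "d \<in> bs.D" "x = loc.frac f s" "y = qclass bs.P bs.SI d"
    "Phi f - Phi s * d \<in> bs.SI" using assms(1) by (rule relE)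
  obtain f' s' d' where 2: "f' \<in> R" "s' \<in> S" "d' \<in> bs.D" "x' = loc.frac f' s'" "y' = qclass bs.P bs.SI d'"
    "Phi f' - Phi s' * d' \<in> bs.SI" using assms(2) by (rule relE)
  note in_R = 1(1) 2(1) S_sub[OF 1(2)] S_sub[OF 2(2)]
  note in_P = D_P[OF 1(3)] D_P[OF 2(3)] Phi_P[OF in_R(1)] Phi_P[OF in_R(2)] Phi_P[OF in_R(3)] Phi_P[OF in_R(4)]
  \<comment> \<open>Cross multiplication relates the difference of the fractions to the difference
    of the images; both directions follow from this congruence.\<close>
  have key: "Phi (f * s' - f' * s) - Phi (s * s') * (d - d') \<in> bs.SI"
  proof -
    have "Phi s' * (Phi f - Phi s * d) - Phi s * (Phi f' - Phi s' * d') \<in> bs.SI"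
      by (rule bs.SI.ideal_diff[OF bs.SI.ideal_mult[OF in_P(6) 1(6)] bs.SI.ideal_mult[OF in_P(5) 2(6)]])
    then show ?thesis by (simp add: Phi.map_minus Phi.map_mult algebra_simps)
  qed
  have y_iff: "y = y' \<longleftrightarrow> d - d' \<in> bs.SI" using 1 2 by (simp add: bs.SI.qclass_eq_iff)
  have x_iff: "x = x' \<longleftrightarrow> (\<exists>u\<in>S. u * (f * s') - u * (f' * s) \<in> J)"
    using 1 2 by (simp add: loc.frac_eq_iff)
  show ?thesis
  proof
    assume "x = x'"
    then obtain u where u: "u \<in> S" "u * (f * s') - u * (f' * s) \<in> J"
      using x_iff by blast
    then have "u * (f * s' - f' * s) \<in> J" by (simp only: right_diff_distrib)
    then have "Phi u * Phi (f * s' - f' * s) \<in> bs.SI" using Phi_J[of "u * (f * s' - f' * s)"] by (simp only: Phi.map_mult)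
    moreover have "Phi (f * s' - f' * s) \<in> bs.P" using in_R by (intro Phi_P R.diff_in R.mult_in)
    ultimately have "Phi (f * s' - f' * s) \<in> bs.SI" by (rule Phi_cancel[OF u(1), rotated])
    then have "Phi (s * s') * (d - d') \<in> bs.SI" using key bs.SI.ideal_cong by blast
    then have "d - d' \<in> bs.SI"
      by (rule Phi_cancel[OF S_mult[OF 1(2) 2(2)] bs.P.diff_in[OF in_P(1,2)]])
    then show "y = y'" using y_iff by simp
  next
    assume "y = y'"
    then have "Phi (s * s') * (d - d') \<in> bs.SI"
      using y_iff by (intro bs.SI.ideal_mult Phi_P R.mult_in in_R) blast
    then have "Phi (f * s' - f' * s) \<in> bs.SI" using key bs.SI.ideal_cong' by blast
    moreover have "f * s' - f' * s \<in> R" by (intro R.diff_in R.mult_in in_R)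
    ultimately obtain u where "u \<in> S" "u * (f * s' - f' * s) \<in> J"
      using Phi_injective by blast
    then have "\<exists>u\<in>S. u * (f * s') - u * (f' * s) \<in> J" unfolding right_diff_distrib by blast
    then show "x = x'" using x_iff by blast
  qed
qed

lemma rel_add_mult:
  assumes "rel x y" "rel x' y'"
  shows "x \<oplus>\<^bsub>loc.L\<^esub> x' \<in> carrier loc.L \<and> rel (x \<oplus>\<^bsub>loc.L\<^esub> x') (y \<oplus>\<^bsub>subring_rec bs.P Quot bs.SI\<^esub> y')"
    and "x \<otimes>\<^bsub>loc.L\<^esub> x' \<in> carrier loc.L \<and> rel (x \<otimes>\<^bsub>loc.L\<^esub> x') (y \<otimes>\<^bsub>subring_rec bs.P Quot bs.SI\<^esub> y')"
proof -
  obtain f s d where 1: "f \<in> R" "s \<in> S" "d \<in> bs.D" "x = loc.frac f s" "y = qclass bs.P bs.SI d"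
    "Phi f - Phi s * d \<in> bs.SI" using assms(1) by (rule relE)
  obtain f' s' d' where 2: "f' \<in> R" "s' \<in> S" "d' \<in> bs.D" "x' = loc.frac f' s'" "y' = qclass bs.P bs.SI d'"
    "Phi f' - Phi s' * d' \<in> bs.SI" using assms(2) by (rule relE)
  note in_R = 1(1) 2(1) S_sub[OF 1(2)] S_sub[OF 2(2)]
  note in_P = D_P[OF 1(3)] D_P[OF 2(3)] Phi_P[OF in_R(1)] Phi_P[OF in_R(2)] Phi_P[OF in_R(3)] Phi_P[OF in_R(4)]
  have S: "s * s' \<in> S" by (rule S_mult[OF 1(2) 2(2)])
  have "Phi s' * (Phi f - Phi s * d) + Phi s * (Phi f' - Phi s' * d') \<in> bs.SI"
    by (rule bs.SI.ideal_add[OF bs.SI.ideal_mult[OF in_P(6) 1(6)] bs.SI.ideal_mult[OF in_P(5) 2(6)]])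
  then have add: "Phi (f * s' + f' * s) - Phi (s * s') * (d + d') \<in> bs.SI"
    by (simp add: Phi.map_add Phi.map_mult algebra_simps)
  have "(Phi f - Phi s * d) * Phi f' + Phi s * d * (Phi f' - Phi s' * d') \<in> bs.SI"
    by (rule bs.SI.ideal_add[OF bs.SI.ideal_mult_right[OF 1(6) in_P(4)]
          bs.SI.ideal_mult[OF bs.P.mult_in[OF in_P(5,1)] 2(6)]])
  then have mult: "Phi (f * f') - Phi (s * s') * (d * d') \<in> bs.SI"
    by (simp add: Phi.map_mult algebra_simps)
  have num: "f * s' + f' * s \<in> R" "f * f' \<in> R" using in_R by (auto intro: R.add_in R.mult_in)
  have "x \<oplus>\<^bsub>loc.L\<^esub> x' = loc.frac (f * s' + f' * s) (s * s')"
    using 1 2 by (simp add: loc.loc_add)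
  moreover have "y \<oplus>\<^bsub>subring_rec bs.P Quot bs.SI\<^esub> y' = qclass bs.P bs.SI (d + d')"
    using 1 2 in_P by (simp add: bs.SI.quot_simps)
  ultimately show "x \<oplus>\<^bsub>loc.L\<^esub> x' \<in> carrier loc.L \<and> rel (x \<oplus>\<^bsub>loc.L\<^esub> x') (y \<oplus>\<^bsub>subring_rec bs.P Quot bs.SI\<^esub> y')"
    using relI[OF num(1) S bs.D.add_in[OF 1(3) 2(3)] add] num S unfolding loc.loc_carrier by auto
  have "x \<otimes>\<^bsub>loc.L\<^esub> x' = loc.frac (f * f') (s * s')"
    using 1 2 by (simp add: loc.loc_mult)
  moreover have "y \<otimes>\<^bsub>subring_rec bs.P Quot bs.SI\<^esub> y' = qclass bs.P bs.SI (d * d')"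
    using 1 2 in_P by (simp add: bs.SI.quot_simps)
  ultimately show "x \<otimes>\<^bsub>loc.L\<^esub> x' \<in> carrier loc.L \<and> rel (x \<otimes>\<^bsub>loc.L\<^esub> x') (y \<otimes>\<^bsub>subring_rec bs.P Quot bs.SI\<^esub> y')"
    using relI[OF num(2) S bs.D.mult_in[OF 1(3) 2(3)] mult] num S unfolding loc.loc_carrier by auto
qed

lemma jet_algebra_isomorphic:
  "algebra_isomorphic (K_lam_ring n m lam :: 'k jet_poly fract ring)
     (jet_local_algebra n m lam) (A_lam (K_lam n m lam) n lam)"
proof -
  have L: "(localization (jet_quot n m) (jet_denoms n m lam) :: ('k jet_poly set \<times> 'k jet_poly set) set ring) = loc.L"
  proof -
    have "(jet_denoms n m lam :: 'k jet_poly set set) = qclass R J ` S"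
      by (simp add: jet_denoms_def jet_class_def jet_ring_eq J_def S_def)
    then show ?thesis by (simp add: jet_quot_def jet_ring_eq J_def)
  qed
  have "algebra_isomorphic (subring_rec K) (algebra_via loc.L (jet_loc_map n m lam))
    (algebra_via ((subring_rec bs.P Quot bs.SI)\<lparr>carrier := qclass bs.P bs.SI ` bs.D\<rparr>)
      (\<lambda>c. qclass bs.P bs.SI (mconst c)))" (is "algebra_isomorphic _ _ (algebra_via ?A ?h)")
  proof (rule algebra_isomorphic_of_relation[where rel = rel])
    show "cring (subring_rec K)" by (rule usubring.cring_subring_rec[OF usubring_K])
    show "cring ?A" by (rule bs.SI.cring_quot_subring[OF bs.D.usubring_axioms]) (auto intro: D_P)
    show "?h \<in> ring_hom (subring_rec K) ?A"
    proof (rule ring_hom_memI)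
      interpret mc: ring_map "mconst :: 'k jet_poly fract \<Rightarrow> (nat, 'k jet_poly fract) mpoly" by (rule ring_map_mconst)
      show "?h c \<in> carrier ?A" if "c \<in> carrier (subring_rec K)" for c
        using that by (simp add: bs.mconst_in_D)
      show "?h (c \<otimes>\<^bsub>subring_rec K\<^esub> d) = ?h c \<otimes>\<^bsub>?A\<^esub> ?h d"
        "?h (c \<oplus>\<^bsub>subring_rec K\<^esub> d) = ?h c \<oplus>\<^bsub>?A\<^esub> ?h d"
        if "c \<in> carrier (subring_rec K)" "d \<in> carrier (subring_rec K)" for c d
        using that by (simp_all add: bs.SI.quot_simps bs.mconst_in_P mc.map_add mc.map_mult)
      show "?h \<one>\<^bsub>subring_rec K\<^esub> = \<one>\<^bsub>?A\<^esub>" by (simp add: bs.SI.quot_simps)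
    qed
    show "\<exists>y\<in>carrier ?A. rel x y" if x: "x \<in> carrier loc.L" for x
    proof -
      obtain f s where fs: "f \<in> R" "s \<in> S" "x = loc.frac f s" using x by (auto simp: loc.loc_carrier)
      obtain d where d: "d \<in> bs.D" "Phi s * d - 1 \<in> bs.SI" using Phi_unit[OF fs(2)] by blast
      \<comment> \<open>As \<open>d\<close> inverts \<open>Phi s\<close> modulo
        \<open>bs.SI\<close>, the partner of f/s is the class of \<open>d * Phi f\<close>.\<close>
      have "- (Phi f * (Phi s * d - 1)) \<in> bs.SI"
        by (intro bs.SI.ideal_uminus bs.SI.ideal_mult d Phi_P fs)
      then have "Phi f - Phi s * (d * Phi f) \<in> bs.SI" by (simp add: algebra_simps)
      moreover have "d * Phi f \<in> bs.D" by (intro bs.D.mult_in d Phi_in_D fs)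
      ultimately show ?thesis using relI[OF fs(1,2)] fs(3) by auto
    qed
    show "\<exists>x\<in>carrier loc.L. rel x y" if y: "y \<in> carrier ?A" for y
    proof -
      obtain d where d: "d \<in> bs.D" "y = qclass bs.P bs.SI d" using y by auto
      obtain f s where "f \<in> R" "s \<in> S" "Phi f - Phi s * d \<in> bs.SI" using Phi_surjective[OF d(1)] by blast
      then show ?thesis using relI d unfolding loc.loc_carrier by blast
    qed
    show "x = x' \<longleftrightarrow> y = y'" if "rel x y" "rel x' y'" for x x' y y' using rel_inj[OF that] .
    show "\<one>\<^bsub>loc.L\<^esub> \<in> carrier loc.L" "\<zero>\<^bsub>loc.L\<^esub> \<in> carrier loc.L"
      using R.one_in R.zero_in S_one unfolding loc.loc_one loc.loc_zero loc.loc_carrier by auto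
    have "rel (loc.frac 1 1) (qclass bs.P bs.SI 1)" "rel (loc.frac 0 1) (qclass bs.P bs.SI 0)"
      by (auto intro!: relI R.closed S_one bs.D.closed simp: Phi.map_one Phi.map_zero bs.SI.ideal_zero)
    then show "rel \<one>\<^bsub>loc.L\<^esub> \<one>\<^bsub>?A\<^esub>" "rel \<zero>\<^bsub>loc.L\<^esub> \<zero>\<^bsub>?A\<^esub>"
      by (simp_all add: loc.loc_one loc.loc_zero bs.SI.quot_simps)
    show "x \<oplus>\<^bsub>loc.L\<^esub> x' \<in> carrier loc.L \<and> rel (x \<oplus>\<^bsub>loc.L\<^esub> x') (y \<oplus>\<^bsub>?A\<^esub> y')"
      if "rel x y" "rel x' y'" for x x' y y' using rel_add_mult(1)[OF that] by simp
    show "x \<otimes>\<^bsub>loc.L\<^esub> x' \<in> carrier loc.L \<and> rel (x \<otimes>\<^bsub>loc.L\<^esub> x') (y \<otimes>\<^bsub>?A\<^esub> y')"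
      if "rel x y" "rel x' y'" for x x' y y' using rel_add_mult(2)[OF that] by simp
    show "jet_loc_map n m lam c \<in> carrier loc.L \<and> rel (jet_loc_map n m lam c) (?h c)"
      if c: "c \<in> carrier (subring_rec K)" for c
    proof -
      obtain f g where fg: "f \<in> Kf" "g \<in> Kf" "g \<noteq> 0" "c = Fract f g"
        using K_eq_quotient[of c] c by auto
      have fR: "f \<in> R" and gS: "g \<in> S" using fg by (auto intro: free_poly_in_R free_poly_in_S)
      \<comment> \<open>For polynomials in the free variables \<open>Phi\<close> gives constants, so
        the relation for the structure maps holds exactly and not merely modulo
        \<open>bs.SI\<close>.\<close>
      have "emb f = emb g * c" using fg by (simp add: Fract_eq_emb)
      then have "Phi f = Phi g * mconst c"
        using fg ring_map.map_mult[OF ring_map_mconst, of "emb g" c, where ?'v1 = nat] by (simp add: Phi_free)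
      then have "rel (loc.frac f g) (?h c)"
        using fR gS c by (intro relI) (auto simp: bs.SI.ideal_zero bs.mconst_in_D)
      then show ?thesis using fR gS fg unfolding loc.loc_carrier by (auto simp: jet_loc_map_Fract)
    qed
  qed
  then show ?thesis
    unfolding K_lam_ring_def jet_local_algebra_def L K_def[symmetric] bs.A_lam_eq .
qed

end

theorem theorem4p1:
  fixes n m :: nat and lam :: "nat \<Rightarrow> nat"
  assumes "n \<ge> 1" and "m \<ge> 1"
    and "(\<Sum>i \<in> {1..n}. lam i) = m + 1"
  shows "algebra_isomorphic
           (K_lam_ring n m lam :: 'k::field_char_0 jet_poly fract ring)
           (jet_local_algebra n m lam)
           (A_lam (K_lam n m lam) n lam)"
proof -
  interpret jet_setting n m lam "TYPE('k)" by standard (rule assms(3))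
  show ?thesis by (rule jet_algebra_isomorphic)
qed

end
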